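(* Let ${\bf k}=(k_0,\ldots,k_n)\in\mathbb{N}_{\geq 0}^{n+1}$ and let $\mathcal{V}_{\bf k}:=M^n_{d,g;\langle 2,2g+1\rangle,{\bf k}}\subset M^n_{d,g}$. Suppose that $n\leq 2g$, that $d\geq\max(n,2g-2)$, and that $\mathcal{V}_{\bf k}\neq\emptyset$. Then $$\mathrm{cod}(\mathcal{V}_{\bf k},M^n_d)\geq (n-1)g+\sum_{i=2}^n\left(\frac{k_i}{2}-i\right).$$ In particular, the variety $\mathcal{V}:=M^n_{d,g;\langle 2,2g+1\rangle}$ of rational curves with a unique singularity of hyperelliptic cuspidal type is of codimension at least $(n-1)g$ in $M^n_d$.
   Context: We work over $\mathbb{C}$. $M^n_d$ denotes the space of nondegenerate morphisms $f:\mathbb{P}^1\to\mathbb{P}^n$ of degree $d>0$, each morphism being identified with the set of coefficients of its homogeneous parameterizing polynomials. $M^n_{d,g}\subset M^n_d$ is the subvariety of morphisms whose images have arithmetic genus $g>0$. A cusp is a unibranch curve singularity. If $P$ is a cusp of $f(\mathbb{P}^1)$, then near the preimage of $P$, with local coordinate $t$, the morphism is given by power series $(f_1(t),\dots,f_n(t))$, i.e. by a ring map $\phi:\mathbb{C}[[x_1,\dots,x_n]]\to\mathbb{C}[[t]]$, $x_i\mapsto f_i(t)$. The value semigroup of $P$ is the numerical semigroup ${\rm S}=v_t(\phi(\mathbb{C}[[x_1,\dots,x_n]]))$ of $t$-adic valuations, and the (local) genus of $P$ is $\#(\mathbb{N}\setminus{\rm S})$. $M^n_{d,g;{\rm S}}\subset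 M^n_{d,g}$ is the subvariety parameterizing morphisms whose image has a unique singularity, which is a cusp with value semigroup ${\rm S}$ (so $\#(\mathbb{N}\setminus{\rm S})=g$). $M^n_{d,g;{\rm S},{\bf k}}\subset M^n_{d,g;{\rm S}}$ is the subvariety of those morphisms for which the strictly increasing sequence of vanishing orders at $t=0$ of linear combinations of $1,f_1(t),\dots,f_n(t)$ is ${\bf k}=(k_0,k_1,\dots,k_n)$, with $k_0=0$. A cusp is hyperelliptic if $2$ belongs to its value semigroup; a hyperelliptic cusp of genus $g$ has value semigroup $\langle 2,2g+1\rangle$. *)

theory Defs
  imports
    "HOL-Analysis.Analysis"
    "HOL-Computational_Algebra.Computational_Algebra"
    "HOL-Library.Function_Algebras"
    "HOL-Library.Extended_Real"
begin

section \<open>Projective spaces over the complex numbers\<close>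

text \<open>
  For a finite index set \<open>I\<close>, \<open>proj_space I\<close> is the projective space with homogeneous
  coordinates indexed by \<open>I\<close>, so \<open>proj_space {..n}\<close> is complex projective \<open>n\<close>-space. A vector is
  a function that vanishes outside \<open>I\<close>; a point is the set of all nonzero multiples of a nonzero
  vector.
\<close>

definition vec_space :: "'i set \<Rightarrow> ('i \<Rightarrow> complex) set" where
  "vec_space I = {x. \<forall>i. i \<notin> I \<longrightarrow> x i = 0}"

definition proj_point :: "('i \<Rightarrow> complex) \<Rightarrow> ('i \<Rightarrow> complex) set" where
  "proj_point x = {(\<lambda>i. c * x i) | c. c \<noteq> 0}"

definition proj_space :: "'i set \<Rightarrow> ('i \<Rightarrow> complex) set set" where
  "proj_space I = proj_point ` (vec_space I - {0})"

text \<open>Homogeneous polynomials of degree \<open>m\<close>. The base field is infinite, so polynomials in the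
  variables indexed by \<open>I\<close> are identified with the functions they define.\<close>

definition forms :: "'i set \<Rightarrow> nat \<Rightarrow> (('i \<Rightarrow> complex) \<Rightarrow> complex) set" where
  "forms I m = {F. \<exists>(A :: ('i \<Rightarrow> nat) set) c. finite A \<and> (\<forall>\<alpha>\<in>A. (\<Sum>i\<in>I. \<alpha> i) = m) \<and>
     F = (\<lambda>x. \<Sum>\<alpha>\<in>A. c \<alpha> * (\<Prod>i\<in>I. x i ^ \<alpha> i))}"

text \<open>The Zariski topology, with the sets \<open>F \<noteq> 0\<close>, for \<open>F\<close> homogeneous, as basic open sets.\<close>

definition zariski :: "'i set \<Rightarrow> ('i \<Rightarrow> complex) set topology" where
  "zariski I = topology_generated_by
     {{X \<in> proj_space I. \<exists>x\<in>X. F x \<noteq> 0} | F. F \<in> (\<Union>m. forms I m)}"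

definition fun_scale :: "complex \<Rightarrow> ('a \<Rightarrow> complex) \<Rightarrow> 'a \<Rightarrow> complex" where
  "fun_scale c f = (\<lambda>x. c * f x)"

lemma vector_space_fun_scale: "vector_space fun_scale"
  by unfold_locales (auto simp: fun_scale_def fun_eq_iff algebra_simps)

definition fun_dim :: "('a \<Rightarrow> complex) set \<Rightarrow> nat" where
  "fun_dim = vector_space.dim fun_scale"


section \<open>Dimension and codimension\<close>

definition irreducible_closedin :: "'a topology \<Rightarrow> 'a set \<Rightarrow> bool" where
  "irreducible_closedin T Z \<longleftrightarrow> closedin T Z \<and> Z \<noteq> {} \<and>
     (\<forall>A B. closedin T A \<and> closedin T B \<and> Z = A \<union> B \<longrightarrow> Z = A \<or> Z = B)"

text \<open>Krull dimension; the value is \<open>-\<infinity>\<close> for the empty space.\<close>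

definition krull_dim :: "'a topology \<Rightarrow> ereal" where
  "krull_dim T = Sup {ereal (real m) | m. \<exists>C :: nat \<Rightarrow> 'a set.
     (\<forall>i\<le>m. irreducible_closedin T (C i)) \<and> (\<forall>i<m. C i \<subset> C (Suc i))}"

text \<open>Codimension of \<open>Z\<close> in \<open>M\<close>, for \<open>Z \<subseteq> M \<subseteq> proj_space I\<close>, both with the induced topology. The
  subset \<open>Z\<close> need not be closed in \<open>M\<close>; constructible sets have the dimension of their closure.\<close>

definition codim :: "'i set \<Rightarrow> ('i \<Rightarrow> complex) set set \<Rightarrow> ('i \<Rightarrow> complex) set set \<Rightarrow> ereal" where
  "codim I Z M = krull_dim (subtopology (zariski I) M) - krull_dim (subtopology (zariski I) Z)"


section \<open>Projective curves\<close>

text \<open>The degree \<open>m\<close> part of the homogeneous coordinate ring of \<open>X\<close> (forms modulo the forms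
  vanishing on \<open>X\<close>) is realised as the space of restrictions of forms to the cone over \<open>X\<close>.\<close>

definition hilbert_function :: "'i set \<Rightarrow> ('i \<Rightarrow> complex) set set \<Rightarrow> nat \<Rightarrow> nat" where
  "hilbert_function I X m = fun_dim ((\<lambda>F x. if x \<in> \<Union>X then F x else 0) ` forms I m)"

text \<open>The arithmetic genus of a curve is \<open>1 - P(0)\<close>, with \<open>P\<close> its Hilbert polynomial.\<close>

definition has_arith_genus :: "'i set \<Rightarrow> ('i \<Rightarrow> complex) set set \<Rightarrow> nat \<Rightarrow> bool" where
  "has_arith_genus I X g \<longleftrightarrow> (\<exists>P :: real poly.
     (\<forall>\<^sub>F m in sequentially. real (hilbert_function I X m) = poly P (real m)) \<and>
     real g = 1 - poly P 0)"

text \<open>The Zariski tangent space, at the vector \<open>x\<close>, of the affine cone over \<open>X\<close>: all directions in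
  which the derivatives at \<open>x\<close> of all forms vanishing on \<open>X\<close> are zero.\<close>

definition cone_tangent_space ::
    "'i set \<Rightarrow> ('i \<Rightarrow> complex) set set \<Rightarrow> ('i \<Rightarrow> complex) \<Rightarrow> ('i \<Rightarrow> complex) set" where
  "cone_tangent_space I X x = {v \<in> vec_space I. \<forall>m. \<forall>F\<in>forms I m. (\<forall>y\<in>\<Union>X. F y = 0) \<longrightarrow>
     ((\<lambda>e. F (\<lambda>i. x i + e * v i)) has_field_derivative 0) (at 0)}"

text \<open>Jacobian criterion for a point of a curve; the affine cone over a curve has dimension 2.\<close>

definition curve_singularities :: "'i set \<Rightarrow> ('i \<Rightarrow> complex) set set \<Rightarrow> ('i \<Rightarrow> complex) set set" where
  "curve_singularities I X = {Q \<in> X. \<exists>x\<in>Q. fun_dim (cone_tangent_space I X x) \<noteq> 2}"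


section \<open>Morphisms from the projective line\<close>

text \<open>A coefficient vector \<open>a\<close> describes the forms
  \<open>f\<^sub>i(u) = (\<Sum>j\<le>d. a (i, j) * u\<^sub>0^(d-j) * u\<^sub>1^j)\<close>, for \<open>i \<le> n\<close>, in \<open>u = (u\<^sub>0, u\<^sub>1)\<close>.\<close>

definition coeff_index :: "nat \<Rightarrow> nat \<Rightarrow> (nat \<times> nat) set" where
  "coeff_index n d = {..n} \<times> {..d}"

definition param_eval ::
    "nat \<Rightarrow> nat \<Rightarrow> (nat \<times> nat \<Rightarrow> complex) \<Rightarrow> (nat \<Rightarrow> complex) \<Rightarrow> nat \<Rightarrow> complex" where
  "param_eval n d a u = (\<lambda>i. if i \<le> n then \<Sum>j\<le>d. a (i, j) * u 0 ^ (d - j) * u 1 ^ j else 0)"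

text \<open>A morphism determines its coefficients up to a common nonzero factor, so it is a point \<open>A\<close> of
  \<open>proj_space (coeff_index n d)\<close>. As \<open>a\<close> and \<open>u\<close> run through all representatives of \<open>A\<close> and \<open>p\<close>, the
  values run through all representatives of the image of \<open>p\<close>.\<close>

definition morph ::
    "nat \<Rightarrow> nat \<Rightarrow> (nat \<times> nat \<Rightarrow> complex) set \<Rightarrow> (nat \<Rightarrow> complex) set \<Rightarrow> (nat \<Rightarrow> complex) set" where
  "morph n d A p = {param_eval n d a u | a u. a \<in> A \<and> u \<in> p}"

abbreviation P1 :: "(nat \<Rightarrow> complex) set set" where
  "P1 \<equiv> proj_space {..1}"

definition curve_image ::
    "nat \<Rightarrow> nat \<Rightarrow> (nat \<times> nat \<Rightarrow> complex) set \<Rightarrow> (nat \<Rightarrow> complex) set set" where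
  "curve_image n d A = morph n d A ` P1"

text \<open>The first condition says that the parameterizing forms have no common zero, the second that the
  image lies in no hyperplane.\<close>

definition M_nd :: "nat \<Rightarrow> nat \<Rightarrow> (nat \<times> nat \<Rightarrow> complex) set set" where
  "M_nd n d = {A \<in> proj_space (coeff_index n d).
     (\<forall>p\<in>P1. morph n d A p \<in> proj_space {..n}) \<and>
     (\<forall>b :: nat \<Rightarrow> complex. (\<forall>x\<in>\<Union>(curve_image n d A). (\<Sum>i\<le>n. b i * x i) = 0) \<longrightarrow>
        (\<forall>i\<le>n. b i = 0))}"

definition M_ndg :: "nat \<Rightarrow> nat \<Rightarrow> nat \<Rightarrow> (nat \<times> nat \<Rightarrow> complex) set set" where
  "M_ndg n d g = {A \<in> M_nd n d. has_arith_genus {..n} (curve_image n d A) g}"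


section \<open>Cusps and their value semigroups\<close>

text \<open>The form \<open>f\<^sub>i\<close> along \<open>u + t w\<close>, as a power series in \<open>t\<close>.\<close>

definition local_form ::
    "nat \<Rightarrow> (nat \<times> nat \<Rightarrow> complex) \<Rightarrow> (nat \<Rightarrow> complex) \<Rightarrow> (nat \<Rightarrow> complex) \<Rightarrow> nat \<Rightarrow> complex fps" where
  "local_form d a u w i = (\<Sum>j\<le>d. fps_const (a (i, j)) *
     (fps_const (u 0) + fps_const (w 0) * fps_X) ^ (d - j) *
     (fps_const (u 1) + fps_const (w 1) * fps_X) ^ j)"

text \<open>\<open>local_germ n d A p r f\<close>: in the affine chart \<open>x\<^sub>r \<noteq> 0\<close>, with origin moved to the image of \<open>p\<close>,
  the morphism \<open>A\<close> is given near \<open>p\<close> by the \<open>n\<close> power series \<open>f i\<close>, for \<open>i \<in> {..n} - {r}\<close>, in a local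
  coordinate at \<open>p\<close>. The value semigroup and the vanishing orders below do not depend on the choices
  of \<open>a\<close>, \<open>u\<close>, \<open>w\<close>, \<open>r\<close>.\<close>

definition local_germ ::
    "nat \<Rightarrow> nat \<Rightarrow> (nat \<times> nat \<Rightarrow> complex) set \<Rightarrow> (nat \<Rightarrow> complex) set \<Rightarrow> nat \<Rightarrow>
     (nat \<Rightarrow> complex fps) \<Rightarrow> bool" where
  "local_germ n d A p r f \<longleftrightarrow> (\<exists>a\<in>A. \<exists>u\<in>p. \<exists>w :: nat \<Rightarrow> complex.
     u 0 * w 1 - u 1 * w 0 \<noteq> 0 \<and> r \<le> n \<and> fps_nth (local_form d a u w r) 0 \<noteq> 0 \<and>
     f = (\<lambda>i. let h = local_form d a u w i / local_form d a u w r
              in h - fps_const (fps_nth h 0)))"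

text \<open>The ring map \<open>\<complex>[[x\<^sub>i | i \<in> I]] \<rightarrow> \<complex>[[t]]\<close>, \<open>x\<^sub>i \<mapsto> f i\<close>, where every \<open>f i\<close> has zero constant
  term. A power series \<open>\<Sum>\<^sub>\<alpha> G \<alpha> x\<^sup>\<alpha>\<close> is given by its coefficients. Monomials of total degree above
  \<open>m\<close> do not contribute to the coefficient of \<open>t\<^sup>m\<close>.\<close>

definition fps_substitute ::
    "nat set \<Rightarrow> (nat \<Rightarrow> complex fps) \<Rightarrow> ((nat \<Rightarrow> nat) \<Rightarrow> complex) \<Rightarrow> complex fps" where
  "fps_substitute I f G = Abs_fps (\<lambda>m.
     \<Sum>\<alpha> | (\<forall>i. i \<notin> I \<longrightarrow> \<alpha> i = 0) \<and> (\<Sum>i\<in>I. \<alpha> i) \<le> m. G \<alpha> * fps_nth (\<Prod>i\<in>I. f i ^ \<alpha> i) m)"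

definition value_semigroup :: "nat set \<Rightarrow> (nat \<Rightarrow> complex fps) \<Rightarrow> nat set" where
  "value_semigroup I f = subdegree ` (range (fps_substitute I f) - {0})"

definition has_value_semigroup ::
    "nat \<Rightarrow> nat \<Rightarrow> (nat \<times> nat \<Rightarrow> complex) set \<Rightarrow> (nat \<Rightarrow> complex) set \<Rightarrow> nat set \<Rightarrow> bool" where
  "has_value_semigroup n d A p S \<longleftrightarrow>
     (\<exists>r f. local_germ n d A p r f \<and> value_semigroup ({..n} - {r}) f = S)"

text \<open>Vanishing orders of the nonzero linear combinations of 1 and the \<open>f i\<close>.\<close>

definition vanishing_orders :: "nat set \<Rightarrow> (nat \<Rightarrow> complex fps) \<Rightarrow> nat set" where
  "vanishing_orders I f =
     subdegree ` ({fps_const c + (\<Sum>i\<in>I. fps_const (b i) * f i) | c b. True} - {0})"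

definition has_vanishing_sequence ::
    "nat \<Rightarrow> nat \<Rightarrow> (nat \<times> nat \<Rightarrow> complex) set \<Rightarrow> (nat \<Rightarrow> complex) set \<Rightarrow> (nat \<Rightarrow> nat) \<Rightarrow> bool" where
  "has_vanishing_sequence n d A p k \<longleftrightarrow> strict_mono_on {..n} k \<and>
     (\<exists>r f. local_germ n d A p r f \<and> vanishing_orders ({..n} - {r}) f = k ` {..n})"

text \<open>The image of \<open>A\<close> has a unique singularity; this has \<open>p\<close> as its only preimage (it is
  unibranch) and has value semigroup \<open>S\<close>.\<close>

definition unique_cusp_at ::
    "nat \<Rightarrow> nat \<Rightarrow> (nat \<times> nat \<Rightarrow> complex) set \<Rightarrow> (nat \<Rightarrow> complex) set \<Rightarrow> nat set \<Rightarrow> bool" where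
  "unique_cusp_at n d A p S \<longleftrightarrow> p \<in> P1 \<and>
     curve_singularities {..n} (curve_image n d A) = {morph n d A p} \<and>
     (\<forall>q\<in>P1. morph n d A q = morph n d A p \<longrightarrow> q = p) \<and>
     has_value_semigroup n d A p S"

definition M_ndgS :: "nat \<Rightarrow> nat \<Rightarrow> nat \<Rightarrow> nat set \<Rightarrow> (nat \<times> nat \<Rightarrow> complex) set set" where
  "M_ndgS n d g S = {A \<in> M_ndg n d g. \<exists>p. unique_cusp_at n d A p S}"

text \<open>Only the values \<open>k 0, \<dots>, k n\<close> matter.\<close>

definition M_ndgSk ::
    "nat \<Rightarrow> nat \<Rightarrow> nat \<Rightarrow> nat set \<Rightarrow> (nat \<Rightarrow> nat) \<Rightarrow> (nat \<times> nat \<Rightarrow> complex) set set" where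
  "M_ndgSk n d g S k =
     {A \<in> M_ndg n d g. \<exists>p. unique_cusp_at n d A p S \<and> has_vanishing_sequence n d A p k}"

text \<open>The numerical semigroup generated by 2 and \<open>2g+1\<close>.\<close>

definition hyperelliptic_semigroup :: "nat \<Rightarrow> nat set" where
  "hyperelliptic_semigroup g = {2 * a + (2 * g + 1) * b | a b. True}"

end

theory Submission
  imports Defs
begin

text \<open>
  Both codimensions are differences of Krull dimensions inside the projective space of coefficient
  vectors, whose dimension is \<open>N = (n + 1) * (d + 1) - 1\<close>. So the space \<open>M_nd n d\<close> has to be at least
  \<open>N\<close>-dimensional and the cuspidal loci have to be small.

  \<^bold>\<open>The ambient space.\<close> All small perturbations of one explicit morphism are again nondegenerate
  morphisms. Hence the members of a full flag of linear subspaces through this point meet \<open>M_nd n d\<close>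
  in a chain of \<open>N + 1\<close> irreducible closed sets (\<open>krull_dim_M_nd_ge\<close>).

  \<^bold>\<open>Upper bounds for dimensions.\<close> Along a chain of \<open>m + 1\<close> irreducible closed sets there are \<open>m + 1\<close>
  forms of one degree whose monomials are linearly independent on the largest set. A set on which
  the forms of degree \<open>l\<close> span a space of dimension \<open>O(l ^ D)\<close> therefore has Krull dimension at most
  \<open>D\<close> (\<open>krull_dim_le_growth\<close>). Such a growth bound follows as soon as all coordinates are
  linear in \<open>q\<close> functions, with coefficients that are polynomials in \<open>r\<close> further functions, with
  \<open>D = q - 1 + r\<close> (\<open>growth_le_parameters\<close>). The functions are arbitrary; they need not come
  from an algebraic parametrization.

  \<^bold>\<open>The cusp.\<close> In a coordinate \<open>t\<close> at the preimage of the cusp the rows of the coefficient matrix span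
  a space of polynomials of degree at most \<open>d\<close>. Its set \<open>P\<close> of vanishing orders has \<open>n + 1\<close> elements
  and contains \<open>0\<close> and \<open>2\<close> but not \<open>1\<close>. The space has a unique basis \<open>h r = t ^ r + \<dots>\<close>, for \<open>r \<in> P\<close>, in which
  \<open>h r\<close> has no term \<open>t ^ s\<close> for the other \<open>s \<in> P\<close>. As no element of the local ring has odd order below
  \<open>2 * g\<close>, each quotient \<open>h r / h 0\<close> is modulo \<open>t ^ (2 * g)\<close> a polynomial in \<open>h 2 / h 0\<close>
  (\<open>cusp_normal_form_exists\<close>). Consequently the coefficients of \<open>h r\<close> at odd positions below \<open>2 * g\<close>
  are polynomials in those at even positions and in the coefficients of \<open>h 0\<close> and \<open>h 2\<close>. Counting the
  position of the cusp, the \<open>(n + 1)\<^sup>2\<close> entries of the matrix of coordinates (up to scaling) and the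
  remaining coefficients leaves at most
  \<open>N - (\<Sum>r\<in>P - {0, 2}. r - card {s \<in> P. s < r} + max 0 (g - r / 2))\<close> parameters.
  If \<open>P\<close> consists of \<open>k 0 < \<dots> < k n\<close>, the summand of \<open>k i\<close> is at least \<open>g + k i / 2 - i\<close>, which is
  the first bound. Every summand is at least \<open>g\<close>, because all elements of \<open>P\<close> below \<open>2 * g\<close>
  are even, which is the second bound.

  \<^bold>\<open>The boundary case.\<close> If \<open>d = 2 * g - 2\<close>, there is no coefficient at \<open>2 * g - 1\<close> to be eliminated, and
  each \<open>r \<in> P - {0, 2}\<close> has to give up another parameter. Let \<open>e m\<close> be the coefficient of
  \<open>t ^ (2 * g - 1)\<close> in \<open>h 0 * (h 2 / h 0) ^ m\<close>. If \<open>h r\<close> is congruent to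
  \<open>h 0 * (\<Sum>m<g. c m * (h 2 / h 0) ^ m)\<close>, then \<open>(\<Sum>m<g. c m * e m) = 0\<close> because
  \<open>h r\<close> has degree below \<open>2 * g - 1\<close>. Let \<open>\<mu>\<close> be the
  largest \<open>m < g\<close> with \<open>m \<ge> 2\<close> and \<open>e m \<noteq> 0\<close>. If \<open>r < 2 * \<mu>\<close>, the relation determines \<open>c \<mu>\<close>. If
  \<open>r > 2 * \<mu>\<close>, then \<open>e (r / 2) = 0\<close>, which determines a coefficient of \<open>h 2\<close>, a different one for each
  \<open>r\<close>. The case \<open>r = 2 * \<mu>\<close> cannot occur. So the count is the same on each of the
  finitely many strata.\<close>

section \<open>Homogeneous forms and the Zariski topology\<close>

lemma forms_monomial:
  "(\<Sum>i\<in>I. \<alpha> i) = m \<Longrightarrow> (\<lambda>x. c * (\<Prod>i\<in>I. x i ^ \<alpha> i)) \<in> forms I m"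
  unfolding forms_def by (intro CollectI exI[of _ "{\<alpha>}"] exI[of _ "\<lambda>_. c"]) auto

lemma forms_add:
  assumes "F \<in> forms I m" "G \<in> forms I m"
  shows "(\<lambda>x. F x + G x) \<in> forms I m"
proof -
  obtain A c where A: "finite A" "\<forall>\<alpha>\<in>A. (\<Sum>i\<in>I. \<alpha> i) = m"
    "F = (\<lambda>x. \<Sum>\<alpha>\<in>A. c \<alpha> * (\<Prod>i\<in>I. x i ^ \<alpha> i))"
    using assms(1) unfolding forms_def by blast
  obtain B b where B: "finite B" "\<forall>\<alpha>\<in>B. (\<Sum>i\<in>I. \<alpha> i) = m"
    "G = (\<lambda>x. \<Sum>\<alpha>\<in>B. b \<alpha> * (\<Prod>i\<in>I. x i ^ \<alpha> i))"
    using assms(2) unfolding forms_def by blast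
  define cb where "cb = (\<lambda>\<alpha>. (if \<alpha> \<in> A then c \<alpha> else 0) + (if \<alpha> \<in> B then b \<alpha> else 0))"
  have "F x + G x = (\<Sum>\<alpha>\<in>A\<union>B. cb \<alpha> * (\<Prod>i\<in>I. x i ^ \<alpha> i))" for x
  proof -
    have "(\<Sum>\<alpha>\<in>A\<union>B. (if \<alpha> \<in> A then c \<alpha> else 0) * (\<Prod>i\<in>I. x i ^ \<alpha> i)) = F x"
      unfolding A(3) using A(1) B(1) by (intro sum.mono_neutral_cong_right) auto
    moreover have "(\<Sum>\<alpha>\<in>A\<union>B. (if \<alpha> \<in> B then b \<alpha> else 0) * (\<Prod>i\<in>I. x i ^ \<alpha> i)) = G x"
      unfolding B(3) using A(1) B(1) by (intro sum.mono_neutral_cong_right) auto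
    ultimately show ?thesis
      unfolding cb_def by (simp add: distrib_right sum.distrib)
  qed
  then show ?thesis
    unfolding forms_def using A(1,2) B(1,2)
    by (intro CollectI exI[of _ "A \<union> B"] exI[of _ cb]) auto
qed

lemma forms_zero: "(\<lambda>x. 0) \<in> forms I m"
  unfolding forms_def by (intro CollectI exI[of _ "{}"]) auto

lemma forms_sum:
  "(\<And>k. k \<in> K \<Longrightarrow> F k \<in> forms I m) \<Longrightarrow> (\<lambda>x. \<Sum>k\<in>K. F k x) \<in> forms I m"
  by (induction K rule: infinite_finite_induct) (auto intro: forms_zero forms_add)

lemma forms_mult:
  assumes "F \<in> forms I m" "G \<in> forms I m'"
  shows "(\<lambda>x. F x * G x) \<in> forms I (m + m')"
proof -
  obtain A c where A: "\<forall>\<alpha>\<in>A. (\<Sum>i\<in>I. \<alpha> i) = m"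
    "F = (\<lambda>x. \<Sum>\<alpha>\<in>A. c \<alpha> * (\<Prod>i\<in>I. x i ^ \<alpha> i))"
    using assms(1) unfolding forms_def by blast
  obtain B b where B: "\<forall>\<alpha>\<in>B. (\<Sum>i\<in>I. \<alpha> i) = m'"
    "G = (\<lambda>x. \<Sum>\<alpha>\<in>B. b \<alpha> * (\<Prod>i\<in>I. x i ^ \<alpha> i))"
    using assms(2) unfolding forms_def by blast
  have eq: "(\<lambda>x. F x * G x) = (\<lambda>x. \<Sum>\<alpha>\<in>A. \<Sum>\<beta>\<in>B. (c \<alpha> * b \<beta>) * (\<Prod>i\<in>I. x i ^ (\<alpha> i + \<beta> i)))"
    unfolding A(2) B(2) sum_product
    by (intro ext sum.cong refl) (simp add: power_add prod.distrib mult_ac)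
  show ?thesis
    unfolding eq using A(1) B(1) by (intro forms_sum forms_monomial) (simp add: sum.distrib)
qed

lemma forms_const: "(\<lambda>x. c) \<in> forms I 0"
  using forms_monomial[of "\<lambda>_. 0" I 0 c] by simp

lemma forms_cmult: "F \<in> forms I m \<Longrightarrow> (\<lambda>x. c * F x) \<in> forms I m"
  using forms_mult[OF forms_const, of F I m c] by simp

lemma forms_power: "F \<in> forms I m \<Longrightarrow> (\<lambda>x. F x ^ k) \<in> forms I (m * k)"
  by (induction k) (use forms_const[of 1] forms_mult in auto)

lemma forms_prod:
  "finite K \<Longrightarrow> (\<And>k. k \<in> K \<Longrightarrow> F k \<in> forms I (m k)) \<Longrightarrow>
     (\<lambda>x. \<Prod>k\<in>K. F k x) \<in> forms I (\<Sum>k\<in>K. m k)"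
  by (induction K rule: finite_induct) (auto intro: forms_const forms_mult)

lemma forms_coordinate:
  assumes "finite I" "i \<in> I" shows "(\<lambda>x. x i) \<in> forms I 1"
proof -
  have "(\<Prod>k\<in>I. x k ^ (if k = i then 1 else 0)) = x i" for x :: "'a \<Rightarrow> complex"
    using assms by (subst prod.remove[OF assms]) (simp add: prod.neutral)
  then show ?thesis
    using forms_monomial[of "\<lambda>k. if k = i then 1 else 0" I 1 1] assms by simp
qed

lemma form_homogeneous:
  assumes "F \<in> forms I m" shows "F (\<lambda>i. c * x i) = c ^ m * F x"
proof -
  obtain A b where A: "\<forall>\<alpha>\<in>A. (\<Sum>i\<in>I. \<alpha> i) = m"
    "F = (\<lambda>x. \<Sum>\<alpha>\<in>A. b \<alpha> * (\<Prod>i\<in>I. x i ^ \<alpha> i))"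
    using assms unfolding forms_def by blast
  show ?thesis
    unfolding A(2) sum_distrib_left
  proof (rule sum.cong[OF refl])
    fix \<alpha> assume "\<alpha> \<in> A"
    then have "(\<Prod>i\<in>I. c ^ \<alpha> i) = c ^ m" using A(1) by (simp add: power_sum[symmetric])
    then show "b \<alpha> * (\<Prod>i\<in>I. (c * x i) ^ \<alpha> i) = c ^ m * (b \<alpha> * (\<Prod>i\<in>I. x i ^ \<alpha> i))"
      by (simp add: power_mult_distrib prod.distrib)
  qed
qed

lemma form_on_line:
  assumes "F \<in> forms I m" shows "\<exists>p. \<forall>e. F (\<lambda>i. x i + e * v i) = poly p e"
proof -
  obtain A b where A: "F = (\<lambda>x. \<Sum>\<alpha>\<in>A. b \<alpha> * (\<Prod>i\<in>I. x i ^ \<alpha> i))"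
    using assms unfolding forms_def by blast
  have "F (\<lambda>i. x i + e * v i) = poly (\<Sum>\<alpha>\<in>A. smult (b \<alpha>) (\<Prod>i\<in>I. [:x i, v i:] ^ \<alpha> i)) e" for e
    unfolding A poly_sum by (simp add: poly_prod)
  then show ?thesis by blast
qed

lemma proj_space_scale:
  assumes "A \<in> proj_space I" "x \<in> A" "y \<in> A"
  shows "\<exists>c. c \<noteq> 0 \<and> y = (\<lambda>i. c * x i)"
proof -
  obtain z where A: "A = proj_point z" using assms(1) by (auto simp: proj_space_def)
  obtain a b where "a \<noteq> 0" "x = (\<lambda>i. a * z i)" "b \<noteq> 0" "y = (\<lambda>i. b * z i)"
    using assms(2,3) A by (auto simp: proj_point_def)
  then show ?thesis by (intro exI[of _ "b / a"]) auto
qed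

lemma form_zero_iff:
  assumes "F \<in> forms I m" "A \<in> proj_space I" "x \<in> A" "y \<in> A"
  shows "F x = 0 \<longleftrightarrow> F y = 0"
  using proj_space_scale[OF assms(2-4)] form_homogeneous[OF assms(1)] by auto

lemma proj_space_memD:
  assumes "A \<in> proj_space I" "x \<in> A"
  shows "x \<in> vec_space I" "x \<noteq> 0"
proof -
  obtain z where z: "A = proj_point z" "z \<in> vec_space I" "z \<noteq> 0"
    using assms(1) by (auto simp: proj_space_def)
  obtain a where a: "a \<noteq> 0" "x = (\<lambda>i. a * z i)" using assms(2) z by (auto simp: proj_point_def)
  show "x \<in> vec_space I" using z a by (auto simp: vec_space_def)
  show "x \<noteq> 0" using z a by (auto simp: fun_eq_iff)
qed

lemma self_in_proj_point: "x \<in> proj_point x"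
  unfolding proj_point_def by (auto intro: exI[of _ 1])

definition vanishes_on :: "(('i \<Rightarrow> complex) \<Rightarrow> complex) \<Rightarrow> ('i \<Rightarrow> complex) set set \<Rightarrow> bool" where
  "vanishes_on F C \<longleftrightarrow> (\<forall>A\<in>C. \<forall>x\<in>A. F x = 0)"

definition nonzero_locus :: "'i set \<Rightarrow> (('i \<Rightarrow> complex) \<Rightarrow> complex) \<Rightarrow> ('i \<Rightarrow> complex) set set" where
  "nonzero_locus I F = {A \<in> proj_space I. \<exists>x\<in>A. F x \<noteq> 0}"

lemma openin_nonzero_locus: "F \<in> forms I m \<Longrightarrow> openin (zariski I) (nonzero_locus I F)"
  unfolding zariski_def nonzero_locus_def openin_topology_generated_by_iff
  by (rule generate_topology_on.Basis) blast

lemma topspace_zariski: "topspace (zariski I) = proj_space I"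
proof
  show "topspace (zariski I) \<subseteq> proj_space I"
    unfolding zariski_def topology_generated_by_topspace by auto
  have "proj_space I \<subseteq> nonzero_locus I (\<lambda>x. 1)"
    by (auto simp: nonzero_locus_def proj_space_def intro: self_in_proj_point)
  then show "proj_space I \<subseteq> topspace (zariski I)"
    using openin_subset[OF openin_nonzero_locus[OF forms_const[of 1]]] by blast
qed

text \<open>The sets \<open>nonzero_locus I F\<close> generate the topology as a subbasis. They are even a basis, because
  the product of two forms is a form.\<close>

lemma zariski_basis:
  assumes "openin (zariski I) U" "A \<in> U"
  shows "\<exists>m. \<exists>F\<in>forms I m. A \<in> nonzero_locus I F \<and> nonzero_locus I F \<subseteq> U"
proof -
  have "generate_topology_on {{X \<in> proj_space I. \<exists>x\<in>X. F x \<noteq> 0} | F. F \<in> (\<Union>m. forms I m)} U"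
    using assms(1) unfolding zariski_def openin_topology_generated_by_iff .
  then show ?thesis using assms(2)
  proof (induction arbitrary: A)
    case (Int U V)
    obtain m F where F: "F \<in> forms I m" "A \<in> nonzero_locus I F" "nonzero_locus I F \<subseteq> U"
      using Int.IH(1)[of A] Int.prems by blast
    obtain m' G where G: "G \<in> forms I m'" "A \<in> nonzero_locus I G" "nonzero_locus I G \<subseteq> V"
      using Int.IH(2)[of A] Int.prems by blast
    have "A \<in> nonzero_locus I (\<lambda>x. F x * G x)"
    proof -
      have AP: "A \<in> proj_space I" using F(2) by (simp add: nonzero_locus_def)
      obtain x where x: "x \<in> A" "F x \<noteq> 0" using F(2) by (auto simp: nonzero_locus_def)
      obtain y where y: "y \<in> A" "G y \<noteq> 0" using G(2) by (auto simp: nonzero_locus_def)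
      have "G x \<noteq> 0" using form_zero_iff[OF G(1) AP x(1) y(1)] y(2) by simp
      then show ?thesis using AP x by (auto simp: nonzero_locus_def)
    qed
    moreover have "nonzero_locus I (\<lambda>x. F x * G x) \<subseteq> U \<inter> V"
      using F G by (auto simp: nonzero_locus_def)
    ultimately show ?case using forms_mult[OF F(1) G(1)] by blast
  next
    case (UN K)
    then show ?case by (meson Union_upper UnionE subset_trans)
  next
    case (Basis s)
    then show ?case unfolding nonzero_locus_def by blast
  qed auto
qed

text \<open>Closed sets are cut out by forms, since the complement is a union of sets \<open>nonzero_locus I F\<close>.\<close>

lemma closedin_zariski_separate:
  assumes "closedin (subtopology (zariski I) Z) C" "A \<in> Z" "A \<in> proj_space I" "A \<notin> C"
  shows "\<exists>m. \<exists>F\<in>forms I m. vanishes_on F C \<and> (\<forall>x\<in>A. F x \<noteq> 0)"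
proof -
  have C: "C \<subseteq> Z" "C \<subseteq> proj_space I"
    using closedin_subset[OF assms(1)] by (auto simp: topspace_zariski)
  have "openin (subtopology (zariski I) Z) (proj_space I \<inter> Z - C)"
    using assms(1) by (simp add: closedin_def topspace_zariski)
  then obtain U where U: "openin (zariski I) U" "proj_space I \<inter> Z - C = U \<inter> Z"
    unfolding openin_subtopology by blast
  then have "A \<in> U" using assms by blast
  then obtain m F where F: "F \<in> forms I m" "A \<in> nonzero_locus I F" "nonzero_locus I F \<subseteq> U"
    using zariski_basis[OF U(1)] by blast
  have "vanishes_on F C"
    using F(3) U(2) C unfolding vanishes_on_def nonzero_locus_def by blast
  moreover have "\<forall>x\<in>A. F x \<noteq> 0"
    using F(2) form_zero_iff[OF F(1) assms(3)] unfolding nonzero_locus_def by blast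
  ultimately show ?thesis using F(1) by blast
qed

lemma closedin_zero_locus:
  assumes "closedin (subtopology (zariski I) Z) C" "F \<in> forms I m"
  shows "closedin (subtopology (zariski I) Z) {A \<in> C. \<forall>x\<in>A. F x = 0}"
proof -
  have C: "C \<subseteq> Z" "C \<subseteq> proj_space I"
    using closedin_subset[OF assms(1)] by (auto simp: topspace_zariski)
  have "closedin (zariski I) (proj_space I - nonzero_locus I F)"
    using openin_nonzero_locus[OF assms(2)] by (metis closedin_diff closedin_topspace topspace_zariski)
  then have "closedin (subtopology (zariski I) Z) (Z \<inter> (proj_space I - nonzero_locus I F))"
    by (auto simp: closedin_subtopology)
  moreover have "{A \<in> C. \<forall>x\<in>A. F x = 0} = C \<inter> (Z \<inter> (proj_space I - nonzero_locus I F))"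
    using C by (auto simp: nonzero_locus_def)
  ultimately show ?thesis using assms(1) by auto
qed

lemma irreducible_closedin_prime:
  assumes "irreducible_closedin (subtopology (zariski I) Z) C" "F \<in> forms I m" "G \<in> forms I m'"
    and "vanishes_on (\<lambda>x. F x * G x) C"
  shows "vanishes_on F C \<or> vanishes_on G C"
proof -
  let ?T = "subtopology (zariski I) Z"
  have cl: "closedin ?T C" using assms(1) by (simp add: irreducible_closedin_def)
  have C: "C \<subseteq> proj_space I"
    using closedin_subset[OF cl] by (auto simp: topspace_zariski)
  have "C = {A \<in> C. \<forall>x\<in>A. F x = 0} \<union> {A \<in> C. \<forall>x\<in>A. G x = 0}"
  proof (intro equalityI subsetI)
    fix A assume A: "A \<in> C"
    then have AP: "A \<in> proj_space I" using C by blast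
    then obtain x where x: "x \<in> A" by (auto simp: proj_space_def intro: self_in_proj_point)
    then have "F x = 0 \<or> G x = 0" using assms(4) A by (auto simp: vanishes_on_def)
    then show "A \<in> {A \<in> C. \<forall>x\<in>A. F x = 0} \<union> {A \<in> C. \<forall>x\<in>A. G x = 0}"
      using A form_zero_iff[OF assms(2) AP x] form_zero_iff[OF assms(3) AP x] by blast
  qed blast
  then have "C = {A \<in> C. \<forall>x\<in>A. F x = 0} \<or> C = {A \<in> C. \<forall>x\<in>A. G x = 0}"
    using assms(1) closedin_zero_locus[OF cl assms(2)] closedin_zero_locus[OF cl assms(3)]
    unfolding irreducible_closedin_def by blast
  then show ?thesis unfolding vanishes_on_def by blast
qed

section \<open>Krull dimension and the growth of spaces of forms\<close>

text \<open>Positive degree is needed to pass to powers of a common degree in the next lemma; it is achieved by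
  multiplying with a coordinate that does not vanish at the point.\<close>

lemma separating_form_pos_degree:
  assumes "finite I" "closedin (subtopology (zariski I) Z) C" "A \<in> Z" "A \<in> proj_space I" "A \<notin> C"
  shows "\<exists>m>0. \<exists>F\<in>forms I m. vanishes_on F C \<and> \<not> vanishes_on F {A}"
proof -
  obtain m F where F: "F \<in> forms I m" "vanishes_on F C" "\<forall>x\<in>A. F x \<noteq> 0"
    using closedin_zariski_separate[OF assms(2-5)] by blast
  obtain x where x: "x \<in> A" using assms(4) by (auto simp: proj_space_def intro: self_in_proj_point)
  obtain i where i: "x i \<noteq> 0" "i \<in> I"
    using proj_space_memD(1,2)[OF assms(4) x] by (auto simp: vec_space_def fun_eq_iff)
  have "(\<lambda>x. F x * x i) \<in> forms I (m + 1)"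
    by (intro forms_mult F forms_coordinate assms i)
  moreover have "vanishes_on (\<lambda>x. F x * x i) C" using F(2) by (auto simp: vanishes_on_def)
  moreover have "\<not> vanishes_on (\<lambda>x. F x * x i) {A}"
    using F(3) x i by (auto simp: vanishes_on_def)
  ultimately show ?thesis by (intro exI[of _ "m + 1"] conjI bexI[of _ "\<lambda>x. F x * x i"]) auto
qed

text \<open>Each step of the chain contributes a form that vanishes on the smaller set but not on the larger
  one, and the smallest set contributes a form that does not vanish on it. Powers of these forms have
  a common degree, the product of the original degrees.\<close>

lemma chain_forms:
  assumes fin: "finite I" and Z: "Z \<subseteq> proj_space I"
    and irr: "\<And>i. i \<le> m \<Longrightarrow> irreducible_closedin (subtopology (zariski I) Z) (C i)"
    and chain: "\<And>i. i < m \<Longrightarrow> C i \<subset> C (Suc i)"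
  shows "\<exists>e F. (\<forall>i\<le>m. F i \<in> forms I e \<and> \<not> vanishes_on (F i) (C i)) \<and>
           (\<forall>i<m. vanishes_on (F (Suc i)) (C i))"
proof -
  have cl: "closedin (subtopology (zariski I) Z) (C i)" if "i \<le> m" for i
    using irr[OF that] by (simp add: irreducible_closedin_def)
  have sub: "C i \<subseteq> Z" if "i \<le> m" for i
    using closedin_subset[OF cl[OF that]] by auto
  have ex: "\<exists>m'>0. \<exists>F\<in>forms I m'. \<not> vanishes_on F (C i) \<and> (\<forall>j. i = Suc j \<longrightarrow> vanishes_on F (C j))"
    if i: "i \<le> m" for i
  proof (cases i)
    case 0
    obtain A where A: "A \<in> C 0" using irr[OF i] 0 by (auto simp: irreducible_closedin_def)
    then have "A \<in> Z" "A \<in> proj_space I" using sub[OF i] 0 Z by auto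
    then obtain m' F where F: "m' > 0" "F \<in> forms I m'" "\<not> vanishes_on F {A}"
      using separating_form_pos_degree[OF fin closedin_empty, of A Z] by blast
    then have "\<not> vanishes_on F (C i)" using A 0 by (auto simp: vanishes_on_def)
    then show ?thesis using F 0 by blast
  next
    case (Suc j)
    then obtain A where A: "A \<in> C i" "A \<notin> C j" using chain[of j] i by auto
    then have "A \<in> Z" "A \<in> proj_space I" using sub[OF i] Z by auto
    then obtain m' F where F: "m' > 0" "F \<in> forms I m'" "vanishes_on F (C j)" "\<not> vanishes_on F {A}"
      using separating_form_pos_degree[OF fin cl[of j], of A] A i Suc by auto
    then have "\<not> vanishes_on F (C i)" using A by (auto simp: vanishes_on_def)
    then show ?thesis using F Suc by blast
  qed
  obtain q G where G: "\<And>i. i \<le> m \<Longrightarrow> q i > (0::nat) \<and> G i \<in> forms I (q i) \<and> \<not> vanishes_on (G i) (C i) \<and>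
      (\<forall>j. i = Suc j \<longrightarrow> vanishes_on (G i) (C j))"
    using ex by metis
  define e where "e = (\<Prod>i\<le>m. q i)"
  have dvd: "q i * (e div q i) = e" if "i \<le> m" for i
    using that unfolding e_def by (simp add: dvd_prodI)
  have "e > 0" unfolding e_def using G by (simp add: prod_pos)
  have pos: "e div q i \<noteq> 0" if "i \<le> m" for i using dvd[OF that] \<open>e > 0\<close> by (metis mult_0_right less_irrefl)
  define F where "F i = (\<lambda>x. G i x ^ (e div q i))" for i
  have "F i \<in> forms I e" if "i \<le> m" for i
    using forms_power[of "G i" I "q i" "e div q i"] G[OF that] dvd[OF that] by (simp add: F_def)
  moreover have "\<not> vanishes_on (F i) (C i)" if "i \<le> m" for i
    using G[OF that] pos[OF that] by (auto simp: F_def vanishes_on_def)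
  moreover have "vanishes_on (F (Suc i)) (C i)" if "i < m" for i
    using G[of "Suc i"] pos[of "Suc i"] that by (auto simp: F_def vanishes_on_def)
  ultimately show ?thesis by blast
qed

lemma forms_monomial_sum:
  assumes "\<And>i. i \<le> (m::nat) \<Longrightarrow> F i \<in> forms I e" "\<And>\<alpha>. \<alpha> \<in> B \<Longrightarrow> (\<Sum>i\<le>m. \<alpha> i) = l"
  shows "(\<lambda>x. \<Sum>\<alpha>\<in>B. c \<alpha> * (\<Prod>i\<le>m. F i x ^ \<alpha> i)) \<in> forms I (e * l)"
proof (intro forms_sum forms_cmult)
  fix \<alpha> assume "\<alpha> \<in> B"
  have "(\<lambda>x. \<Prod>i\<le>m. F i x ^ \<alpha> i) \<in> forms I (\<Sum>i\<le>m. e * \<alpha> i)"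
    using assms(1) by (intro forms_prod forms_power) auto
  then show "(\<lambda>x. \<Prod>i\<le>m. F i x ^ \<alpha> i) \<in> forms I (e * l)"
    using assms(2)[OF \<open>\<alpha> \<in> B\<close>] by (simp add: sum_distrib_left[symmetric])
qed

text \<open>The monomials in the forms of a chain are linearly independent on its largest member. In a
  vanishing combination, the terms without \<open>F (Suc m)\<close> form a combination that vanishes on \<open>C m\<close>, as
  all other terms do, so their coefficients are zero by induction on \<open>m\<close>. The remaining terms have the
  common factor \<open>F (Suc m)\<close>, which can be cancelled on the irreducible set \<open>C (Suc m)\<close>; this lowers the
  degree \<open>l\<close>.\<close>

lemma chain_monomials_independent:
  assumes "\<And>i. i \<le> m \<Longrightarrow> irreducible_closedin (subtopology (zariski I) Z) (C i)"
    and "\<And>i. i \<le> m \<Longrightarrow> F i \<in> forms I e"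
    and "\<And>i. i \<le> m \<Longrightarrow> \<not> vanishes_on (F i) (C i)"
    and "\<And>i. i < m \<Longrightarrow> vanishes_on (F (Suc i)) (C i)"
    and "\<And>i. i < m \<Longrightarrow> C i \<subset> C (Suc i)"
    and "finite B" "B \<subseteq> {\<alpha>. (\<forall>i>m. \<alpha> i = 0) \<and> (\<Sum>i\<le>m. \<alpha> i) = l}"
    and "vanishes_on (\<lambda>x. \<Sum>\<alpha>\<in>B. c \<alpha> * (\<Prod>i\<le>m. F i x ^ \<alpha> i)) (C m)"
    and "\<alpha> \<in> B"
  shows "c \<alpha> = 0"
  using assms
proof (induction m arbitrary: l B c \<alpha>)
  case 0
  have "\<beta> = \<alpha>" if "\<beta> \<in> B" for \<beta>
  proof
    fix i show "\<beta> i = \<alpha> i" using subsetD[OF 0(7) that] subsetD[OF 0(7) 0(9)] by (cases "i = 0") auto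
  qed
  then have "B = {\<alpha>}" using 0(9) by blast
  then have "vanishes_on (\<lambda>x. c \<alpha> * F 0 x ^ \<alpha> 0) (C 0)" using 0(8) by simp
  moreover have "\<not> vanishes_on (F 0) (C 0)" using 0(3) by simp
  ultimately show ?case by (auto simp: vanishes_on_def)
next
  case (Suc m)
  note irr = Suc.prems(1) and F = Suc.prems(2) and nv = Suc.prems(3) and v = Suc.prems(4)
    and chain = Suc.prems(5)
  show ?case
    using Suc.prems(6-9)
  proof (induction l arbitrary: B c \<alpha> rule: less_induct)
    case (less l)
    let ?M = "\<lambda>\<alpha> x. \<Prod>i\<le>m. F i x ^ \<alpha> i"
    define B0 where "B0 = {\<beta> \<in> B. \<beta> (Suc m) = 0}"
    define B1 where "B1 = {\<beta> \<in> B. \<beta> (Suc m) \<noteq> 0}"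
    have split: "B = B0 \<union> B1" "B0 \<inter> B1 = {}" "finite B0" "finite B1"
      using less.prems(1) by (auto simp: B0_def B1_def)
    have sum_split: "(\<Sum>\<alpha>\<in>B. c \<alpha> * (\<Prod>i\<le>Suc m. F i x ^ \<alpha> i)) =
        (\<Sum>\<alpha>\<in>B0. c \<alpha> * ?M \<alpha> x) + (\<Sum>\<alpha>\<in>B1. c \<alpha> * (?M \<alpha> x * F (Suc m) x ^ \<alpha> (Suc m)))" for x
    proof -
      have "(\<Sum>\<alpha>\<in>B0. c \<alpha> * (\<Prod>i\<le>Suc m. F i x ^ \<alpha> i)) = (\<Sum>\<alpha>\<in>B0. c \<alpha> * ?M \<alpha> x)"
        by (intro sum.cong refl) (simp add: B0_def)
      then show ?thesis unfolding split(1) using split(2-4) by (simp add: sum.union_disjoint)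
    qed
    have B0: "c \<beta> = 0" if "\<beta> \<in> B0" for \<beta>
    proof (rule Suc.IH[where l = l and B = B0 and c = c and \<alpha> = \<beta>])
      show "vanishes_on (\<lambda>x. \<Sum>\<alpha>\<in>B0. c \<alpha> * ?M \<alpha> x) (C m)"
        unfolding vanishes_on_def
      proof (intro ballI)
        fix A x assume A: "A \<in> C m" "x \<in> A"
        have "F (Suc m) x = 0" using v[of m] A by (auto simp: vanishes_on_def)
        then have "(\<Sum>\<alpha>\<in>B1. c \<alpha> * (?M \<alpha> x * F (Suc m) x ^ \<alpha> (Suc m))) = 0"
          by (intro sum.neutral) (auto simp: B1_def)
        moreover have "A \<in> C (Suc m)" using chain[of m] A by auto
        then have "(\<Sum>\<alpha>\<in>B. c \<alpha> * (\<Prod>i\<le>Suc m. F i x ^ \<alpha> i)) = 0"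
          using less.prems(3) A(2) unfolding vanishes_on_def by blast
        ultimately show "(\<Sum>\<alpha>\<in>B0. c \<alpha> * ?M \<alpha> x) = 0"
          unfolding sum_split by simp
      qed
      show "B0 \<subseteq> {\<alpha>. (\<forall>i>m. \<alpha> i = 0) \<and> sum \<alpha> {..m} = l}"
      proof
        fix \<beta> assume "\<beta> \<in> B0"
        then have b: "\<forall>i>Suc m. \<beta> i = 0" "sum \<beta> {..Suc m} = l" "\<beta> (Suc m) = 0"
          using less.prems(2) by (auto simp: B0_def)
        then show "\<beta> \<in> {\<alpha>. (\<forall>i>m. \<alpha> i = 0) \<and> sum \<alpha> {..m} = l}"
          by (auto) (metis Suc_lessI)
      qed
    qed (use irr F nv v chain split that in auto)
    show ?case
    proof (cases "\<alpha> \<in> B0")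
      case True then show ?thesis by (rule B0)
    next
      case False
      then have aB1: "\<alpha> \<in> B1" using less.prems(4) split(1) by blast
      define dn where "dn = (\<lambda>\<beta>::nat \<Rightarrow> nat. \<beta>(Suc m := \<beta> (Suc m) - 1))"
      define up where "up = (\<lambda>\<beta>::nat \<Rightarrow> nat. \<beta>(Suc m := \<beta> (Suc m) + 1))"
      have ud: "up (dn \<beta>) = \<beta>" if "\<beta> \<in> B1" for \<beta>
        using that by (auto simp: up_def dn_def B1_def fun_eq_iff)
      have inj: "inj_on dn B1" using ud by (metis inj_on_inverseI)
      have sum1: "sum \<beta> {..Suc m} = l" "\<forall>i>Suc m. \<beta> i = 0" "\<beta> (Suc m) \<noteq> 0" if "\<beta> \<in> B1" for \<beta>
        using less.prems(2) that by (auto simp: B1_def)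
      have lpos: "l > 0" using sum1(1,3)[OF aB1] by auto
      have sum_dn: "sum (dn \<beta>) {..Suc m} = l - 1" if "\<beta> \<in> B1" for \<beta>
      proof -
        have "sum (dn \<beta>) {..m} = sum \<beta> {..m}" by (intro sum.cong) (auto simp: dn_def)
        then show ?thesis using sum1(1,3)[OF that] by (simp add: dn_def)
      qed
      have Mdn: "?M (dn \<beta>) x = ?M \<beta> x" for \<beta> x
        by (intro prod.cong) (auto simp: dn_def)
      let ?P = "\<lambda>x. \<Sum>\<beta>\<in>dn ` B1. c (up \<beta>) * (\<Prod>i\<le>Suc m. F i x ^ \<beta> i)"
      have Peq: "F (Suc m) x * ?P x = (\<Sum>\<alpha>\<in>B1. c \<alpha> * (?M \<alpha> x * F (Suc m) x ^ \<alpha> (Suc m)))" for x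
      proof -
        have "F (Suc m) x * F (Suc m) x ^ dn \<beta> (Suc m) = F (Suc m) x ^ \<beta> (Suc m)" if "\<beta> \<in> B1" for \<beta>
          using sum1(3)[OF that] by (cases "\<beta> (Suc m)") (auto simp: dn_def)
        then show ?thesis
          unfolding sum.reindex[OF inj] sum_distrib_left
          by (intro sum.cong refl) (simp add: ud Mdn mult_ac)
      qed
      have "vanishes_on (\<lambda>x. F (Suc m) x * ?P x) (C (Suc m))"
        unfolding vanishes_on_def
      proof (intro ballI)
        fix A x assume A: "A \<in> C (Suc m)" "x \<in> A"
        have "(\<Sum>\<alpha>\<in>B0. c \<alpha> * ?M \<alpha> x) = 0" using B0 by (intro sum.neutral) auto
        moreover have "(\<Sum>\<alpha>\<in>B. c \<alpha> * (\<Prod>i\<le>Suc m. F i x ^ \<alpha> i)) = 0"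
          using less.prems(3) A unfolding vanishes_on_def by blast
        ultimately show "F (Suc m) x * ?P x = 0"
          unfolding Peq sum_split by simp
      qed
      moreover have "?P \<in> forms I (e * (l - 1))"
        using F sum_dn by (intro forms_monomial_sum) auto
      ultimately have "vanishes_on ?P (C (Suc m))"
        using irreducible_closedin_prime[OF irr[of "Suc m"] F[of "Suc m"]] nv[of "Suc m"] by blast
      then have "c (up (dn \<alpha>)) = 0"
      proof (intro less.IH[of "l - 1" "dn ` B1" "\<lambda>\<beta>. c (up \<beta>)" "dn \<alpha>"])
        show "dn ` B1 \<subseteq> {\<alpha>. (\<forall>i>Suc m. \<alpha> i = 0) \<and> sum \<alpha> {..Suc m} = l - 1}"
          using sum_dn sum1(2) by (auto simp: dn_def)
      qed (use aB1 lpos split(4) in auto)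
      then show ?thesis using ud[OF aB1] by simp
    qed
  qed
qed

text \<open>Gaussian elimination: an equation with a nonzero coefficient is solved for the corresponding unknown.\<close>

lemma underdetermined_system:
  fixes M :: "'a \<Rightarrow> nat \<Rightarrow> complex"
  assumes "finite B" "K < card B"
  shows "\<exists>c. (\<exists>\<alpha>\<in>B. c \<alpha> \<noteq> 0) \<and> (\<forall>k<K. (\<Sum>\<alpha>\<in>B. c \<alpha> * M \<alpha> k) = 0)"
  using assms
proof (induction K arbitrary: B M)
  case 0
  then have "B \<noteq> {}" by auto
  then show ?case by (intro exI[of _ "\<lambda>_. 1"]) auto
next
  case (Suc K)
  show ?case
  proof (cases "\<forall>\<alpha>\<in>B. M \<alpha> K = 0")
    case True
    obtain c where "\<exists>\<alpha>\<in>B. c \<alpha> \<noteq> 0" "\<forall>k<K. (\<Sum>\<alpha>\<in>B. c \<alpha> * M \<alpha> k) = 0"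
      using Suc.IH[of B M] Suc.prems by auto
    then show ?thesis using True by (intro exI[of _ c]) (auto simp: less_Suc_eq)
  next
    case False
    then obtain \<alpha>0 where a0: "\<alpha>0 \<in> B" "M \<alpha>0 K \<noteq> 0" by blast
    define B' where "B' = B - {\<alpha>0}"
    define M' where "M' = (\<lambda>\<alpha> k. M \<alpha> k - M \<alpha> K / M \<alpha>0 K * M \<alpha>0 k)"
    obtain c where c: "\<exists>\<alpha>\<in>B'. c \<alpha> \<noteq> 0" "\<forall>k<K. (\<Sum>\<alpha>\<in>B'. c \<alpha> * M' \<alpha> k) = 0"
    proof -
      have "finite B'" "K < card B'" using Suc.prems a0(1) by (auto simp: B'_def)
      then show ?thesis using Suc.IH[of B' M'] that by blast
    qed
    define c' where "c' = c(\<alpha>0 := - (\<Sum>\<alpha>\<in>B'. c \<alpha> * M \<alpha> K) / M \<alpha>0 K)"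
    have "(\<Sum>\<alpha>\<in>B. c' \<alpha> * M \<alpha> k) = (\<Sum>\<alpha>\<in>B'. c \<alpha> * M' \<alpha> k)" for k
    proof -
      have "(\<Sum>\<alpha>\<in>B. c' \<alpha> * M \<alpha> k) = c' \<alpha>0 * M \<alpha>0 k + (\<Sum>\<alpha>\<in>B'. c' \<alpha> * M \<alpha> k)"
        unfolding B'_def using Suc.prems a0 by (simp add: sum.remove)
      also have "(\<Sum>\<alpha>\<in>B'. c' \<alpha> * M \<alpha> k) = (\<Sum>\<alpha>\<in>B'. c \<alpha> * M \<alpha> k)"
        by (intro sum.cong) (auto simp: c'_def B'_def)
      also have "c' \<alpha>0 * M \<alpha>0 k = - (\<Sum>\<alpha>\<in>B'. c \<alpha> * (M \<alpha> K / M \<alpha>0 K * M \<alpha>0 k))"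
        by (simp add: c'_def sum_distrib_right sum_distrib_left sum_divide_distrib sum_negf mult_ac)
      finally show ?thesis by (simp add: M'_def right_diff_distrib sum_subtractf)
    qed
    moreover have "M' \<alpha> K = 0" for \<alpha> using a0 by (simp add: M'_def)
    ultimately have "\<forall>k<Suc K. (\<Sum>\<alpha>\<in>B. c' \<alpha> * M \<alpha> k) = 0"
      using c(2) by (auto simp: less_Suc_eq)
    moreover have "\<exists>\<alpha>\<in>B. c' \<alpha> \<noteq> 0" using c(1) by (auto simp: c'_def B'_def)
    ultimately show ?thesis by blast
  qed
qed

text \<open>The \<open>\<phi> k\<close> are arbitrary functions on \<open>W\<close>, so this says that the space of restrictions to \<open>W\<close>
  of the forms of degree \<open>l\<close> has dimension \<open>O(l ^ D)\<close>.\<close>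

definition growth_le :: "'i set \<Rightarrow> ('i \<Rightarrow> complex) set \<Rightarrow> nat \<Rightarrow> bool" where
  "growth_le I W D \<longleftrightarrow> (\<exists>C::nat. \<forall>l. \<exists>K \<phi>. K \<le> C * (l + 1) ^ D \<and>
     (\<forall>F\<in>forms I l. \<exists>c. \<forall>w\<in>W. F w = (\<Sum>k<K. c k * \<phi> k w)))"

lemma growth_le_empty: "growth_le I {} D"
  unfolding growth_le_def by (intro exI[of _ 0] allI) auto

text \<open>Spanning functions for both sets, the first family extended by zero and the second one restricted to
  the complement of \<open>V\<close>, span together.\<close>

lemma growth_le_Un:
  assumes "growth_le I V D" "growth_le I W D" shows "growth_le I (V \<union> W) D"
proof -
  obtain C1 where C1: "\<And>l. \<exists>K \<phi>. K \<le> C1 * (l + 1) ^ D \<and>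
     (\<forall>F\<in>forms I l. \<exists>c. \<forall>w\<in>V. F w = (\<Sum>k<K. c k * \<phi> k w))"
    using assms(1) unfolding growth_le_def by blast
  obtain C2 where C2: "\<And>l. \<exists>K \<phi>. K \<le> C2 * (l + 1) ^ D \<and>
     (\<forall>F\<in>forms I l. \<exists>c. \<forall>w\<in>W. F w = (\<Sum>k<K. c k * \<phi> k w))"
    using assms(2) unfolding growth_le_def by blast
  have "\<exists>K \<phi>. K \<le> (C1 + C2) * (l + 1) ^ D \<and>
     (\<forall>F\<in>forms I l. \<exists>c. \<forall>w\<in>V\<union>W. F w = (\<Sum>k<K. c k * \<phi> k w))" for l
  proof -
    obtain K1 \<phi>1 where 1: "K1 \<le> C1 * (l + 1) ^ D"
      "\<forall>F\<in>forms I l. \<exists>c. \<forall>w\<in>V. F w = (\<Sum>k<K1. c k * \<phi>1 k w)" using C1 by metis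
    obtain K2 \<phi>2 where 2: "K2 \<le> C2 * (l + 1) ^ D"
      "\<forall>F\<in>forms I l. \<exists>c. \<forall>w\<in>W. F w = (\<Sum>k<K2. c k * \<phi>2 k w)" using C2 by metis
    define \<phi> where "\<phi> = (\<lambda>k w. if k < K1 then (if w \<in> V then \<phi>1 k w else 0)
                                else (if w \<in> V then 0 else \<phi>2 (k - K1) w))"
    have "\<exists>c. \<forall>w\<in>V\<union>W. F w = (\<Sum>k<K1+K2. c k * \<phi> k w)" if F: "F \<in> forms I l" for F
    proof -
      obtain c1 where c1: "\<forall>w\<in>V. F w = (\<Sum>k<K1. c1 k * \<phi>1 k w)" using 1 F by blast
      obtain c2 where c2: "\<forall>w\<in>W. F w = (\<Sum>k<K2. c2 k * \<phi>2 k w)" using 2 F by blast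
      define c where "c = (\<lambda>k. if k < K1 then c1 k else c2 (k - K1))"
      have "F w = (\<Sum>k<K1+K2. c k * \<phi> k w)" if "w \<in> V \<union> W" for w
      proof -
        have "(\<Sum>k<K1+K2. c k * \<phi> k w) = (\<Sum>k<K1. c k * \<phi> k w) + (\<Sum>k<K2. c (K1 + k) * \<phi> (K1 + k) w)"
          by (induction K2) auto
        also have "\<dots> = (if w \<in> V then (\<Sum>k<K1. c1 k * \<phi>1 k w) else (\<Sum>k<K2. c2 k * \<phi>2 k w))"
          by (auto simp: c_def \<phi>_def)
        finally show ?thesis using c1 c2 that by auto
      qed
      then show ?thesis by blast
    qed
    then show ?thesis using 1(1) 2(1)
      by (intro exI[of _ "K1 + K2"] exI[of _ \<phi>]) (auto simp: algebra_simps)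
  qed
  then show ?thesis unfolding growth_le_def by blast
qed

lemma growth_le_UN:
  "finite T \<Longrightarrow> (\<And>t. t \<in> T \<Longrightarrow> growth_le I (W t) D) \<Longrightarrow> growth_le I (\<Union>t\<in>T. W t) D"
  by (induction T rule: finite_induct) (auto intro: growth_le_empty growth_le_Un)

lemma growth_le_mono:
  assumes "growth_le I W D" "D \<le> D'" shows "growth_le I W D'"
proof -
  have "(l + 1) ^ D \<le> (l + 1) ^ D'" for l :: nat using assms(2) by (intro power_increasing) auto
  then have *: "K \<le> C * (l + 1) ^ D'" if "K \<le> C * (l + 1) ^ D" for K C l :: nat
    using that mult_le_mono2 le_trans by blast
  obtain C where C: "\<And>l. \<exists>K \<phi>. K \<le> C * (l + 1) ^ D \<and>
     (\<forall>F\<in>forms I l. \<exists>c. \<forall>w\<in>W. F w = (\<Sum>k<K. c k * \<phi> k w))"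
    using assms(1) unfolding growth_le_def by blast
  show ?thesis unfolding growth_le_def
  proof (rule exI[of _ C], rule allI)
    fix l
    show "\<exists>K \<phi>. K \<le> C * (l + 1) ^ D' \<and>
       (\<forall>F\<in>forms I l. \<exists>c. \<forall>w\<in>W. F w = (\<Sum>k<K. c k * \<phi> k w))"
    proof -
      obtain K \<phi> where "K \<le> C * (l + 1) ^ D"
        "\<forall>F\<in>forms I l. \<exists>c. \<forall>w\<in>W. F w = (\<Sum>k<K. c k * \<phi> k w)"
        using C by metis
      then show ?thesis using * by (intro exI[of _ K] exI[of _ \<phi>]) simp
    qed
  qed
qed

text \<open>The exponents of \<open>m\<close> of the variables vary freely in a box, and the exponent of the variable \<open>0\<close>
  makes the total degree constant.\<close>

lemma simplex_many_points:
  fixes m p :: nat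
  shows "\<exists>B. finite B \<and> card B = (p + 1) ^ m \<and>
    B \<subseteq> {\<alpha>. (\<forall>i>m. \<alpha> i = 0) \<and> (\<Sum>i\<le>m. \<alpha> i) = m * p}"
proof -
  let ?P = "Pi\<^sub>E {1..m} (\<lambda>_. {..p})"
  define f where "f = (\<lambda>\<beta>::nat\<Rightarrow>nat. \<lambda>i. if i = 0 then m * p - (\<Sum>i=1..m. \<beta> i) else if i \<le> m then \<beta> i else 0)"
  have "inj_on f ?P"
  proof (rule inj_onI)
    fix \<beta> \<gamma> assume b: "\<beta> \<in> ?P" "\<gamma> \<in> ?P" "f \<beta> = f \<gamma>"
    show "\<beta> = \<gamma>"
    proof
      fix i
      show "\<beta> i = \<gamma> i"
      proof (cases "i \<in> {1..m}")
        case True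
        then show ?thesis using fun_cong[OF b(3), of i] by (auto simp: f_def)
      next
        case False
        then show ?thesis using b(1,2) by (simp only: PiE_def extensional_def) auto
      qed
    qed
  qed
  moreover have "card ?P = (p + 1) ^ m" by (simp add: card_PiE)
  ultimately have "card (f ` ?P) = (p + 1) ^ m" by (simp add: card_image)
  moreover have "finite (f ` ?P)" by (intro finite_imageI finite_PiE) auto
  moreover have "f ` ?P \<subseteq> {\<alpha>. (\<forall>i>m. \<alpha> i = 0) \<and> (\<Sum>i\<le>m. \<alpha> i) = m * p}"
  proof (intro image_subsetI CollectI conjI)
    fix \<beta> assume b: "\<beta> \<in> ?P"
    have "(\<Sum>i=1..m. \<beta> i) \<le> (\<Sum>i=1..m. p)" using b by (intro sum_mono) auto
    then have le: "(\<Sum>i=1..m. \<beta> i) \<le> m * p" by simp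
    have "(\<Sum>i\<le>m. f \<beta> i) = f \<beta> 0 + (\<Sum>i=1..m. f \<beta> i)"
      using sum.atLeast_Suc_atMost[of 0 m "f \<beta>"] by (simp add: atMost_atLeast0)
    also have "(\<Sum>i=1..m. f \<beta> i) = (\<Sum>i=1..m. \<beta> i)"
      by (intro sum.cong) (auto simp: f_def)
    finally show "(\<Sum>i\<le>m. f \<beta> i) = m * p" using le by (simp add: f_def)
  qed (auto simp: f_def)
  ultimately show ?thesis by blast
qed

text \<open>If \<open>m > D\<close>, then for large \<open>p\<close> there are more independent monomials of degree \<open>e * m * p\<close>, namely
  \<open>(p + 1) ^ m\<close> many, than the growth bound \<open>O(p ^ D)\<close> permits.\<close>

lemma chain_length_le_growth:
  assumes fin: "finite I" and Z: "Z \<subseteq> proj_space I"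
    and W: "\<And>A. A \<in> Z \<Longrightarrow> \<exists>w\<in>A. w \<in> W" and gr: "growth_le I W D"
    and irr: "\<And>i. i \<le> m \<Longrightarrow> irreducible_closedin (subtopology (zariski I) Z) (C i)"
    and chain: "\<And>i. i < m \<Longrightarrow> C i \<subset> C (Suc i)"
  shows "m \<le> D"
proof (rule ccontr)
  assume "\<not> m \<le> D"
  then have mD: "D + 1 \<le> m" by simp
  obtain e F where F: "\<And>i. i \<le> m \<Longrightarrow> F i \<in> forms I e" "\<And>i. i \<le> m \<Longrightarrow> \<not> vanishes_on (F i) (C i)"
    "\<And>i. i < m \<Longrightarrow> vanishes_on (F (Suc i)) (C i)"
    using chain_forms[of I Z m C] fin Z irr chain by blast
  obtain N where N: "\<And>l. \<exists>K \<phi>. K \<le> N * (l + 1) ^ D \<and>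
     (\<forall>F\<in>forms I l. \<exists>c. \<forall>w\<in>W. F w = (\<Sum>k<K. c k * \<phi> k w))"
    using gr unfolding growth_le_def by blast
  \<comment> \<open>this choice makes \<open>N * (e * m * p + 1) ^ D\<close> smaller than \<open>(p + 1) ^ (D + 1)\<close>\<close>
  define p where "p = N * (e * m + 1) ^ D"
  obtain K \<phi> where K: "K \<le> N * (e * (m * p) + 1) ^ D"
     "\<And>F. F \<in> forms I (e * (m * p)) \<Longrightarrow> \<exists>c. \<forall>w\<in>W. F w = (\<Sum>k<K. c k * \<phi> k w)"
    using N[of "e * (m * p)"] by metis
  obtain B where B: "finite B" "card B = (p + 1) ^ m"
    "B \<subseteq> {\<alpha>. (\<forall>i>m. \<alpha> i = 0) \<and> (\<Sum>i\<le>m. \<alpha> i) = m * p}"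
    using simplex_many_points by blast
  have "K < card B"
  proof -
    have "e * (m * p) + 1 \<le> (e * m + 1) * (p + 1)" by (simp add: algebra_simps)
    then have "N * (e * (m * p) + 1) ^ D \<le> N * ((e * m + 1) * (p + 1)) ^ D"
      by (intro mult_le_mono2 power_mono) auto
    also have "\<dots> = p * (p + 1) ^ D" unfolding power_mult_distrib p_def by (simp only: mult.assoc)
    also have "\<dots> < (p + 1) ^ (D + 1)" by simp
    also have "\<dots> \<le> (p + 1) ^ m" using mD by (intro power_increasing) auto
    finally show ?thesis using K(1) B(2) by simp
  qed
  let ?M = "\<lambda>\<alpha> x. \<Prod>i\<le>m. F i x ^ \<alpha> i"
  have "\<exists>c. \<forall>w\<in>W. ?M \<alpha> w = (\<Sum>k<K. c k * \<phi> k w)" if "\<alpha> \<in> B" for \<alpha>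
  proof (rule K(2))
    have "(\<lambda>x. \<Sum>\<alpha>\<in>{\<alpha>}. 1 * ?M \<alpha> x) \<in> forms I (e * (m * p))"
      using F(1) B(3) that by (intro forms_monomial_sum) auto
    then show "?M \<alpha> \<in> forms I (e * (m * p))" by simp
  qed
  then obtain b where b: "\<And>\<alpha> w. \<alpha> \<in> B \<Longrightarrow> w \<in> W \<Longrightarrow> ?M \<alpha> w = (\<Sum>k<K. b \<alpha> k * \<phi> k w)" by metis
  obtain c where c: "\<exists>\<alpha>\<in>B. c \<alpha> \<noteq> 0" "\<forall>k<K. (\<Sum>\<alpha>\<in>B. c \<alpha> * b \<alpha> k) = 0"
    using underdetermined_system[OF B(1) \<open>K < card B\<close>, of b] by blast
  let ?P = "\<lambda>x. \<Sum>\<alpha>\<in>B. c \<alpha> * ?M \<alpha> x"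
  have PW: "?P w = 0" if "w \<in> W" for w
  proof -
    have "?P w = (\<Sum>\<alpha>\<in>B. \<Sum>k<K. (c \<alpha> * b \<alpha> k) * \<phi> k w)"
      using b that by (simp add: sum_distrib_left mult.assoc)
    also have "\<dots> = (\<Sum>k<K. (\<Sum>\<alpha>\<in>B. c \<alpha> * b \<alpha> k) * \<phi> k w)"
      by (subst sum.swap) (simp add: sum_distrib_right)
    finally show ?thesis using c(2) by simp
  qed
  have P: "?P \<in> forms I (e * (m * p))" using F(1) B(3) by (intro forms_monomial_sum) auto
  have "C m \<subseteq> Z" using closedin_subset irr[of m] by (fastforce simp: irreducible_closedin_def)
  then have "vanishes_on ?P (C m)"
    using form_zero_iff[OF P] Z W PW unfolding vanishes_on_def by (meson subsetD)
  then have "c \<alpha> = 0" if "\<alpha> \<in> B" for \<alpha>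
    using chain_monomials_independent[of m I Z C F e B "m * p" c \<alpha>] irr F chain B(1,3) that by blast
  then show False using c(1) by blast
qed

theorem krull_dim_le_growth:
  assumes "finite I" "Z \<subseteq> proj_space I" "\<And>A. A \<in> Z \<Longrightarrow> \<exists>w\<in>A. w \<in> W" "growth_le I W D"
  shows "krull_dim (subtopology (zariski I) Z) \<le> ereal (real D)"
  unfolding krull_dim_def
proof (rule Sup_least, clarify)
  fix m and C :: "nat \<Rightarrow> ('a \<Rightarrow> complex) set set"
  assume "\<forall>i\<le>m. irreducible_closedin (subtopology (zariski I) Z) (C i)" "\<forall>i<m. C i \<subset> C (Suc i)"
  then show "ereal (real m) \<le> ereal (real D)"
    using chain_length_le_growth[OF assms, of m C] by auto
qed

section \<open>Growth on parametrized sets\<close>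

text \<open>The functions that agree on \<open>W\<close> with a polynomial in the functions \<open>y j\<close>, for \<open>j \<in> J\<close>. Closure under
  equality on \<open>W\<close> turns every relation that holds on \<open>W\<close> into a membership: a quantity that a relation
  determines by the \<open>y j\<close> need not be counted as a parameter.\<close>

inductive_set poly_alg ::
    "'w set \<Rightarrow> ('j \<Rightarrow> 'w \<Rightarrow> complex) \<Rightarrow> 'j set \<Rightarrow> ('w \<Rightarrow> complex) set"
  for W :: "'w set" and y :: "'j \<Rightarrow> 'w \<Rightarrow> complex" and J :: "'j set" where
  const: "(\<lambda>_. c) \<in> poly_alg W y J"
| gen: "j \<in> J \<Longrightarrow> y j \<in> poly_alg W y J"
| add: "f \<in> poly_alg W y J \<Longrightarrow> g \<in> poly_alg W y J \<Longrightarrow> (\<lambda>w. f w + g w) \<in> poly_alg W y J"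
| mult: "f \<in> poly_alg W y J \<Longrightarrow> g \<in> poly_alg W y J \<Longrightarrow> (\<lambda>w. f w * g w) \<in> poly_alg W y J"
| cong: "f \<in> poly_alg W y J \<Longrightarrow> (\<And>w. w \<in> W \<Longrightarrow> g w = f w) \<Longrightarrow> g \<in> poly_alg W y J"

definition deg_exponents :: "'q set \<Rightarrow> nat \<Rightarrow> ('q \<Rightarrow> nat) set" where
  "deg_exponents Q l = {\<beta>. (\<forall>q. q \<notin> Q \<longrightarrow> \<beta> q = 0) \<and> (\<Sum>q\<in>Q. \<beta> q) = l}"

definition box_exponents :: "'j set \<Rightarrow> nat \<Rightarrow> ('j \<Rightarrow> nat) set" where
  "box_exponents J e = {\<gamma>. (\<forall>j. j \<notin> J \<longrightarrow> \<gamma> j = 0) \<and> (\<forall>j\<in>J. \<gamma> j \<le> e)}"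

lemma box_exponents_card:
  assumes "finite J"
  shows "finite (box_exponents J e)" "card (box_exponents J e) \<le> (e + 1) ^ card J"
proof -
  let ?P = "Pi\<^sub>E J (\<lambda>_. {..e})"
  have inj: "inj_on (\<lambda>\<gamma>. restrict \<gamma> J) (box_exponents J e)"
  proof (rule inj_onI)
    fix \<beta> \<gamma> assume *: "\<beta> \<in> box_exponents J e" "\<gamma> \<in> box_exponents J e" "restrict \<beta> J = restrict \<gamma> J"
    show "\<beta> = \<gamma>"
    proof
      fix j
      have "j \<in> J \<Longrightarrow> \<beta> j = \<gamma> j" using fun_cong[OF *(3), of j] by simp
      then show "\<beta> j = \<gamma> j" using *(1,2) by (cases "j \<in> J") (simp_all add: box_exponents_def)
    qed
  qed
  have sub: "(\<lambda>\<gamma>. restrict \<gamma> J) ` box_exponents J e \<subseteq> ?P"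
    by (auto simp: box_exponents_def)
  have fin: "finite ?P" using assms by (intro finite_PiE) auto
  show "finite (box_exponents J e)" using finite_imageD[OF finite_subset[OF sub fin] inj] .
  show "card (box_exponents J e) \<le> (e + 1) ^ card J"
    using card_inj_on_le[OF inj sub fin] assms by (simp add: card_PiE)
qed

lemma deg_exponents_card:
  assumes "finite Q" "Q \<noteq> {}"
  shows "finite (deg_exponents Q l)" "card (deg_exponents Q l) \<le> (l + 1) ^ (card Q - 1)"
proof -
  obtain q0 where q0: "q0 \<in> Q" using assms(2) by blast
  let ?Q = "Q - {q0}"
  let ?P = "Pi\<^sub>E ?Q (\<lambda>_. {..l})"
  have sum: "(\<Sum>q\<in>Q. \<beta> q) = \<beta> q0 + (\<Sum>q\<in>?Q. \<beta> q)" for \<beta> :: "'a \<Rightarrow> nat"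
    using assms q0 by (simp add: sum.remove)
  have inj: "inj_on (\<lambda>\<gamma>. restrict \<gamma> ?Q) (deg_exponents Q l)"
  proof (rule inj_onI)
    fix \<beta> \<gamma> assume *: "\<beta> \<in> deg_exponents Q l" "\<gamma> \<in> deg_exponents Q l"
      "restrict \<beta> ?Q = restrict \<gamma> ?Q"
    have eq: "\<beta> q = \<gamma> q" if "q \<in> ?Q" for q using fun_cong[OF *(3), of q] that by simp
    then have "(\<Sum>q\<in>?Q. \<beta> q) = (\<Sum>q\<in>?Q. \<gamma> q)" by (intro sum.cong) auto
    then have "\<beta> q0 = \<gamma> q0" using * sum[of \<beta>] sum[of \<gamma>] by (simp add: deg_exponents_def)
    show "\<beta> = \<gamma>"
    proof
      fix j show "\<beta> j = \<gamma> j"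
        using * eq[of j] \<open>\<beta> q0 = \<gamma> q0\<close>
        by (cases "j \<in> ?Q"; cases "j = q0") (auto simp: deg_exponents_def)
    qed
  qed
  have sub: "(\<lambda>\<gamma>. restrict \<gamma> ?Q) ` deg_exponents Q l \<subseteq> ?P"
  proof (intro image_subsetI)
    fix \<beta> assume b: "\<beta> \<in> deg_exponents Q l"
    have "\<beta> q \<le> l" if "q \<in> ?Q" for q
      using b that assms(1) member_le_sum[of q Q \<beta>] by (auto simp: deg_exponents_def)
    then show "restrict \<beta> ?Q \<in> ?P" by auto
  qed
  have fin: "finite ?P" using assms by (intro finite_PiE) auto
  show "finite (deg_exponents Q l)" using finite_imageD[OF finite_subset[OF sub fin] inj] .
  show "card (deg_exponents Q l) \<le> (l + 1) ^ (card Q - 1)"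
    using card_inj_on_le[OF inj sub fin] assms q0 by (simp add: card_PiE)
qed

text \<open>Monomials that are homogeneous in the functions \<open>G q\<close> but have only bounded exponents in the
  functions \<open>y j\<close>. Homogeneity saves one in the exponent of the growth, which accounts
  for passing from vectors to points of projective space.\<close>

locale monomial_span =
  fixes W :: "'w set" and G :: "'q \<Rightarrow> 'w \<Rightarrow> complex" and Q :: "'q set"
    and y :: "'j \<Rightarrow> 'w \<Rightarrow> complex" and J :: "'j set"
  assumes finite_Q: "finite Q" and Q_nonempty: "Q \<noteq> {}" and finite_J: "finite J"
begin

definition monom_fun :: "('q \<Rightarrow> nat) \<times> ('j \<Rightarrow> nat) \<Rightarrow> 'w \<Rightarrow> complex" where
  "monom_fun p w = (\<Prod>q\<in>Q. G q w ^ fst p q) * (\<Prod>j\<in>J. y j w ^ snd p j)"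

definition exponents :: "nat \<Rightarrow> nat \<Rightarrow> (('q \<Rightarrow> nat) \<times> ('j \<Rightarrow> nat)) set" where
  "exponents l e = deg_exponents Q l \<times> box_exponents J e"

definition spanned :: "nat \<Rightarrow> nat \<Rightarrow> ('w \<Rightarrow> complex) set" where
  "spanned l e = {f. \<exists>c. \<forall>w\<in>W. f w = (\<Sum>p\<in>exponents l e. c p * monom_fun p w)}"

lemma finite_exponents: "finite (exponents l e)"
  unfolding exponents_def
  using box_exponents_card(1)[OF finite_J] deg_exponents_card(1)[OF finite_Q Q_nonempty] by blast

lemma spanned_monom: "p \<in> exponents l e \<Longrightarrow> monom_fun p \<in> spanned l e"
  unfolding spanned_def
  by (rule CollectI, rule exI[of _ "\<lambda>q. if q = p then 1 else 0"])
    (simp add: if_distrib[of "\<lambda>z. z * _"] finite_exponents cong: if_cong)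

lemma spanned_add: "f \<in> spanned l e \<Longrightarrow> g \<in> spanned l e \<Longrightarrow> (\<lambda>w. f w + g w) \<in> spanned l e"
  unfolding spanned_def
proof (clarify)
  fix c c' assume "\<forall>w\<in>W. f w = (\<Sum>p\<in>exponents l e. c p * monom_fun p w)"
    "\<forall>w\<in>W. g w = (\<Sum>p\<in>exponents l e. c' p * monom_fun p w)"
  then show "\<exists>c. \<forall>w\<in>W. f w + g w = (\<Sum>p\<in>exponents l e. c p * monom_fun p w)"
    by (intro exI[of _ "\<lambda>p. c p + c' p"]) (simp add: distrib_right sum.distrib)
qed

lemma spanned_scale: "f \<in> spanned l e \<Longrightarrow> (\<lambda>w. a * f w) \<in> spanned l e"
  unfolding spanned_def
proof (clarify)
  fix c assume "\<forall>w\<in>W. f w = (\<Sum>p\<in>exponents l e. c p * monom_fun p w)"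
  then show "\<exists>c. \<forall>w\<in>W. a * f w = (\<Sum>p\<in>exponents l e. c p * monom_fun p w)"
    by (intro exI[of _ "\<lambda>p. a * c p"]) (simp add: sum_distrib_left mult.assoc)
qed

lemma spanned_zero: "(\<lambda>w. 0) \<in> spanned l e"
  unfolding spanned_def by (intro CollectI exI[of _ "\<lambda>_. 0"]) simp

lemma spanned_sum: "(\<And>k. k \<in> K \<Longrightarrow> f k \<in> spanned l e) \<Longrightarrow> (\<lambda>w. \<Sum>k\<in>K. f k w) \<in> spanned l e"
  by (induction K rule: infinite_finite_induct) (auto intro: spanned_zero spanned_add)

lemma spanned_cong: "f \<in> spanned l e \<Longrightarrow> (\<And>w. w \<in> W \<Longrightarrow> g w = f w) \<Longrightarrow> g \<in> spanned l e"
  unfolding spanned_def by simp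

lemma spanned_mult:
  assumes "f \<in> spanned l e" "g \<in> spanned l' e'"
  shows "(\<lambda>w. f w * g w) \<in> spanned (l + l') (e + e')"
proof -
  obtain c where c: "\<And>w. w \<in> W \<Longrightarrow> f w = (\<Sum>p\<in>exponents l e. c p * monom_fun p w)"
    using assms(1) unfolding spanned_def by blast
  obtain c' where c': "\<And>w. w \<in> W \<Longrightarrow> g w = (\<Sum>p\<in>exponents l' e'. c' p * monom_fun p w)"
    using assms(2) unfolding spanned_def by blast
  define plus where "plus = (\<lambda>(p :: ('q \<Rightarrow> nat) \<times> ('j \<Rightarrow> nat)) p'.
    ((\<lambda>q. fst p q + fst p' q), (\<lambda>j. snd p j + snd p' j)))"
  have m: "monom_fun (plus p p') w = monom_fun p w * monom_fun p' w" for p p' w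
    by (simp add: monom_fun_def plus_def power_add prod.distrib mult_ac)
  have "(\<lambda>w. \<Sum>p\<in>exponents l e. \<Sum>p'\<in>exponents l' e'. (c p * c' p') * monom_fun (plus p p') w)
          \<in> spanned (l + l') (e + e')"
  proof (intro spanned_sum spanned_scale spanned_monom)
    fix p p' assume "p \<in> exponents l e" "p' \<in> exponents l' e'"
    then show "plus p p' \<in> exponents (l + l') (e + e')"
      by (auto simp: exponents_def plus_def deg_exponents_def box_exponents_def sum.distrib
          intro: add_mono)
  qed
  then show ?thesis
    by (rule spanned_cong) (simp add: c c' m sum_product, intro sum.cong refl, simp add: mult_ac)
qed

lemma spanned_mono: "f \<in> spanned l e \<Longrightarrow> e \<le> e' \<Longrightarrow> f \<in> spanned l e'"
proof -
  assume f: "f \<in> spanned l e" and e: "e \<le> e'"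
  obtain c where c: "\<And>w. w \<in> W \<Longrightarrow> f w = (\<Sum>p\<in>exponents l e. c p * monom_fun p w)"
    using f unfolding spanned_def by blast
  have "(\<lambda>w. \<Sum>p\<in>exponents l e. c p * monom_fun p w) \<in> spanned l e'"
  proof (intro spanned_sum spanned_scale spanned_monom)
    fix p assume "p \<in> exponents l e"
    then show "p \<in> exponents l e'" using e by (fastforce simp: exponents_def box_exponents_def)
  qed
  then show ?thesis by (rule spanned_cong) (simp add: c)
qed

lemma spanned_const: "(\<lambda>_. c) \<in> spanned 0 0"
proof -
  have "(\<lambda>_. 0, \<lambda>_. 0) \<in> exponents 0 0"
    by (simp add: exponents_def deg_exponents_def box_exponents_def)
  from spanned_scale[OF spanned_monom[OF this], of c] show ?thesis
    by (simp add: monom_fun_def)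
qed

lemma spanned_G:
  assumes "q \<in> Q" shows "G q \<in> spanned 1 0"
proof -
  have "(\<lambda>r. if r = q then 1 else 0, \<lambda>_. 0) \<in> exponents 1 0"
    using assms finite_Q by (auto simp: exponents_def deg_exponents_def box_exponents_def)
  moreover have "monom_fun (\<lambda>r. if r = q then 1 else 0, \<lambda>_. 0) w = G q w" for w
    using prod.remove[OF finite_Q assms, of "\<lambda>r. G r w ^ (if r = q then 1 else 0)"]
    by (simp add: monom_fun_def prod.neutral)
  ultimately show ?thesis using spanned_monom by (metis (no_types, lifting) spanned_cong)
qed

lemma spanned_y:
  assumes "j \<in> J" shows "y j \<in> spanned 0 1"
proof -
  have "(\<lambda>_. 0, \<lambda>r. if r = j then 1 else 0) \<in> exponents 0 1"
    using assms finite_J by (auto simp: exponents_def deg_exponents_def box_exponents_def)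
  moreover have "monom_fun (\<lambda>_. 0, \<lambda>r. if r = j then 1 else 0) w = y j w" for w
    using prod.remove[OF finite_J assms, of "\<lambda>r. y r w ^ (if r = j then 1 else 0)"]
    by (simp add: monom_fun_def prod.neutral)
  ultimately show ?thesis using spanned_monom by (metis (no_types, lifting) spanned_cong)
qed

lemma poly_alg_spanned: "f \<in> poly_alg W y J \<Longrightarrow> \<exists>e. f \<in> spanned 0 e"
proof (induction rule: poly_alg.induct)
  case (add f g)
  then obtain e e' where "f \<in> spanned 0 e" "g \<in> spanned 0 e'" by blast
  then have "f \<in> spanned 0 (e + e')" "g \<in> spanned 0 (e + e')" by (auto intro: spanned_mono)
  then show ?case using spanned_add by blast
next
  case (mult f g)
  then obtain e e' where "f \<in> spanned 0 e" "g \<in> spanned 0 e'" by blast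
  then show ?case using spanned_mult by (metis add_0)
next
  case (cong f g)
  then show ?case using spanned_cong by blast
qed (use spanned_const spanned_y in blast)+

lemma spanned_uniform:
  assumes "finite A" "\<And>a. a \<in> A \<Longrightarrow> \<exists>e. f a \<in> spanned l e"
  shows "\<exists>e. \<forall>a\<in>A. f a \<in> spanned l e"
  using assms
proof (induction A rule: finite_induct)
  case (insert a A)
  obtain e where e: "\<forall>a\<in>A. f a \<in> spanned l e" using insert.IH insert.prems by blast
  obtain e' where e': "f a \<in> spanned l e'" using insert.prems by blast
  show ?case using e e' by (intro exI[of _ "e + e'"]) (auto intro: spanned_mono)
qed auto

lemma spanned_power: "f \<in> spanned l e \<Longrightarrow> (\<lambda>w. f w ^ k) \<in> spanned (l * k) (e * k)"
  by (induction k) (use spanned_const[of 1] spanned_mult in auto)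

lemma spanned_prod:
  "finite K \<Longrightarrow> (\<And>k. k \<in> K \<Longrightarrow> f k \<in> spanned (l k) (e k)) \<Longrightarrow>
     (\<lambda>w. \<Prod>k\<in>K. f k w) \<in> spanned (\<Sum>k\<in>K. l k) (\<Sum>k\<in>K. e k)"
proof (induction K rule: finite_induct)
  case empty
  then show ?case using spanned_const[of 1] by simp
next
  case (insert a K)
  then show ?case using spanned_mult[of "f a" "l a" "e a"] by simp
qed

lemma card_exponents:
  "card (exponents l (e * l)) \<le> (e + 1) ^ card J * (l + 1) ^ (card Q - 1 + card J)"
proof -
  have "card (exponents l (e * l)) \<le> (l + 1) ^ (card Q - 1) * (e * l + 1) ^ card J"
    unfolding exponents_def card_cartesian_product
    by (intro mult_le_mono deg_exponents_card box_exponents_card finite_Q Q_nonempty finite_J)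
  also have "(l + 1) ^ (card Q - 1) * (e * l + 1) ^ card J \<le>
      (l + 1) ^ (card Q - 1) * ((e + 1) * (l + 1)) ^ card J"
    by (intro mult_le_mono2 power_mono) (auto simp: algebra_simps)
  also have "\<dots> = (e + 1) ^ card J * (l + 1) ^ (card Q - 1 + card J)"
    by (simp only: power_mult_distrib power_add mult_ac)
  finally show ?thesis .
qed

end

text \<open>A form of degree \<open>l\<close> in the coordinates is homogeneous of degree \<open>l\<close> in the \<open>G q\<close>, with exponents
  \<open>O(l)\<close> in the \<open>y j\<close>. There are \<open>O(l ^ (card Q - 1 + card J))\<close> monomials of this kind.\<close>

theorem growth_le_parameters:
  fixes W :: "('i \<Rightarrow> complex) set"
  assumes fin: "finite I" "finite Q" "Q \<noteq> {}" "finite J"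
    and par: "\<And>i. i \<in> I \<Longrightarrow> \<exists>A. (\<forall>q\<in>Q. A q \<in> poly_alg W y J) \<and>
                (\<forall>w\<in>W. w i = (\<Sum>q\<in>Q. G q w * A q w))"
  shows "growth_le I W (card Q - 1 + card J)"
proof -
  interpret monomial_span W G Q y J by unfold_locales (use fin in auto)
  have "\<exists>e. (\<lambda>w. w i) \<in> spanned 1 e" if i: "i \<in> I" for i
  proof -
    obtain A where A: "\<And>q. q \<in> Q \<Longrightarrow> A q \<in> poly_alg W y J"
      "\<And>w. w \<in> W \<Longrightarrow> w i = (\<Sum>q\<in>Q. G q w * A q w)"
      using par[OF i] by blast
    obtain e where e: "\<forall>q\<in>Q. A q \<in> spanned 0 e"
      using spanned_uniform[OF finite_Q, of A 0] poly_alg_spanned A(1) by blast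
    have "(\<lambda>w. \<Sum>q\<in>Q. G q w * A q w) \<in> spanned 1 e"
      using spanned_mult[OF spanned_G] e by (intro spanned_sum) fastforce
    then have "(\<lambda>w. w i) \<in> spanned 1 e" by (rule spanned_cong) (rule A(2))
    then show ?thesis by blast
  qed
  then obtain e where e: "\<forall>i\<in>I. (\<lambda>w. w i) \<in> spanned 1 e"
    using spanned_uniform[OF fin(1), of "\<lambda>i w. w i" 1] by blast
  have form: "F \<in> spanned l (e * l)" if "F \<in> forms I l" for F l
  proof -
    obtain A c where A: "\<forall>\<alpha>\<in>A. (\<Sum>i\<in>I. \<alpha> i) = l"
      "F = (\<lambda>x. \<Sum>\<alpha>\<in>A. c \<alpha> * (\<Prod>i\<in>I. x i ^ \<alpha> i))"
      using \<open>F \<in> forms I l\<close> unfolding forms_def by blast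
    show ?thesis unfolding A(2)
    proof (intro spanned_sum spanned_scale)
      fix \<alpha> assume "\<alpha> \<in> A"
      have "(\<lambda>w. \<Prod>i\<in>I. w i ^ \<alpha> i) \<in> spanned (\<Sum>i\<in>I. 1 * \<alpha> i) (\<Sum>i\<in>I. e * \<alpha> i)"
        using e by (intro spanned_prod spanned_power fin) auto
      then show "(\<lambda>w. \<Prod>i\<in>I. w i ^ \<alpha> i) \<in> spanned l (e * l)"
        using A(1) \<open>\<alpha> \<in> A\<close> by (simp add: sum_distrib_left[symmetric])
    qed
  qed
  have "\<exists>K \<phi>. K \<le> (e + 1) ^ card J * (l + 1) ^ (card Q - 1 + card J) \<and>
     (\<forall>F\<in>forms I l. \<exists>c. \<forall>w\<in>W. F w = (\<Sum>k<K. c k * \<phi> k w))" for l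
  proof -
    let ?K = "card (exponents l (e * l))"
    obtain h where h: "bij_betw h {..<?K} (exponents l (e * l))"
      using ex_bij_betw_nat_finite[OF finite_exponents] by (metis atLeast0LessThan)
    have "\<exists>c. \<forall>w\<in>W. F w = (\<Sum>k<?K. c k * monom_fun (h k) w)" if "F \<in> forms I l" for F
    proof -
      obtain c where c: "\<forall>w\<in>W. F w = (\<Sum>p\<in>exponents l (e * l). c p * monom_fun p w)"
        using form[OF \<open>F \<in> forms I l\<close>] unfolding spanned_def by blast
      have "(\<Sum>p\<in>exponents l (e * l). c p * monom_fun p w) = (\<Sum>k<?K. c (h k) * monom_fun (h k) w)" for w
        using sum.reindex_bij_betw[OF h, of "\<lambda>p. c p * monom_fun p w"] by simp
      then show ?thesis using c by (intro exI[of _ "\<lambda>k. c (h k)"]) simp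
    qed
    then show ?thesis using card_exponents[of l e]
      by (intro exI[of _ ?K] exI[of _ "\<lambda>k. monom_fun (h k)"]) simp
  qed
  then show ?thesis unfolding growth_le_def by blast
qed

section \<open>The dimension of the space of nondegenerate morphisms\<close>

text \<open>If \<open>C\<close> were the union of two proper closed subsets, there would be forms \<open>F\<close> and \<open>G\<close> vanishing on
  one each, but not everywhere on \<open>C\<close>. On the line through a point of \<open>L\<close> where \<open>F \<noteq> 0\<close> and one
  where \<open>G \<noteq> 0\<close> some point \<open>z\<close> has \<open>F z * G z \<noteq> 0\<close>, since both are polynomials along the line. By the
  same argument, the line from \<open>a\<close> to \<open>z\<close> has such points arbitrarily close to \<open>a\<close>, hence in \<open>C\<close>.\<close>

lemma irreducible_closedin_linear_section:
  assumes M: "M \<subseteq> proj_space I" and C: "C = {A \<in> M. A \<subseteq> L}"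
    and cl: "closedin (subtopology (zariski I) M) C"
    and lin: "\<And>x y e. x \<in> L \<Longrightarrow> y \<in> L \<Longrightarrow> (\<lambda>i. x i + e * (y i - x i)) \<in> L"
    and scale: "\<And>x c. x \<in> L \<Longrightarrow> (\<lambda>i. c * x i) \<in> L"
    and a: "a \<in> L" "proj_point a \<in> M" and L: "L \<subseteq> vec_space I"
    and nbhd: "\<And>v. v \<in> vec_space I \<Longrightarrow>
        \<exists>\<delta>>0. \<forall>e. norm e < \<delta> \<longrightarrow> proj_point (\<lambda>i. a i + e * v i) \<in> M"
  shows "irreducible_closedin (subtopology (zariski I) M) C"
proof -
  let ?T = "subtopology (zariski I) M"
  have pp: "proj_point x \<subseteq> L" if "x \<in> L" for x
    using scale that by (auto simp: proj_point_def)
  have False if AB: "closedin ?T A" "closedin ?T B" "C = A \<union> B" "C \<noteq> A" "C \<noteq> B" for A B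
  proof -
    obtain P where P: "P \<in> C" "P \<notin> A" using AB by blast
    obtain Q where Q: "Q \<in> C" "Q \<notin> B" using AB by blast
    have PM: "P \<in> M" "P \<in> proj_space I" "Q \<in> M" "Q \<in> proj_space I" using P Q C M by auto
    obtain m F where F: "F \<in> forms I m" "vanishes_on F A" "\<forall>x\<in>P. F x \<noteq> 0"
      using closedin_zariski_separate[OF AB(1) PM(1,2) P(2)] by blast
    obtain m' G where G: "G \<in> forms I m'" "vanishes_on G B" "\<forall>x\<in>Q. G x \<noteq> 0"
      using closedin_zariski_separate[OF AB(2) PM(3,4) Q(2)] by blast
    obtain x where x: "x \<in> P" using PM(2) by (auto simp: proj_space_def intro: self_in_proj_point)
    obtain y where y: "y \<in> Q" using PM(4) by (auto simp: proj_space_def intro: self_in_proj_point)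
    have xyL: "x \<in> L" "y \<in> L" using x y P Q C by auto
    obtain p where p: "\<And>e. F (\<lambda>i. x i + e * (y i - x i)) = poly p e"
      using form_on_line[OF F(1)] by metis
    obtain q where q: "\<And>e. G (\<lambda>i. x i + e * (y i - x i)) = poly q e"
      using form_on_line[OF G(1)] by metis
    have "poly p 0 \<noteq> 0" using p[of 0] F(3) x by auto
    moreover have "poly q 1 \<noteq> 0" using q[of 1] G(3) y by auto
    ultimately have "p * q \<noteq> 0" by auto
    then have "finite {e. poly (p * q) e = 0}" by (rule poly_roots_finite)
    then obtain e1 where e1: "poly (p * q) e1 \<noteq> 0"
      using infinite_UNIV_char_0[where 'a=complex] by (metis (mono_tags) UNIV_eq_I mem_Collect_eq)
    define z where "z = (\<lambda>i. x i + e1 * (y i - x i))"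
    have z: "z \<in> L" "F z \<noteq> 0" "G z \<noteq> 0" using lin[OF xyL] e1 p q by (auto simp: z_def)
    obtain r where r: "\<And>e. F (\<lambda>i. a i + e * (z i - a i)) = poly r e"
      using form_on_line[OF F(1)] by metis
    obtain s where s: "\<And>e. G (\<lambda>i. a i + e * (z i - a i)) = poly s e"
      using form_on_line[OF G(1)] by metis
    have "poly r 1 \<noteq> 0" "poly s 1 \<noteq> 0" using r[of 1] s[of 1] z by auto
    then have "r * s \<noteq> 0" by auto
    then have fin: "finite {e. poly (r * s) e = 0}" by (rule poly_roots_finite)
    have "z \<in> vec_space I" "a \<in> vec_space I" using z(1) a(1) L by blast+
    then have "(\<lambda>i. z i - a i) \<in> vec_space I" by (simp add: vec_space_def)
    then obtain \<delta> where \<delta>: "\<delta> > 0"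
      "\<And>e. norm e < \<delta> \<Longrightarrow> proj_point (\<lambda>i. a i + e * (z i - a i)) \<in> M"
      using nbhd by blast
    have "infinite (ball (0::complex) \<delta>)"
      using uncountable_ball[OF \<delta>(1), of "0::complex"] countable_finite by blast
    then obtain e where e: "e \<in> ball 0 \<delta>" "poly (r * s) e \<noteq> 0"
      using fin by (metis (mono_tags) finite_subset mem_Collect_eq subsetI)
    define w where "w = (\<lambda>i. a i + e * (z i - a i))"
    have w: "w \<in> L" "proj_point w \<in> M" "F w \<noteq> 0" "G w \<noteq> 0"
      using lin[OF a(1) z(1), of e] \<delta>(2)[of e] e r s by (auto simp: w_def)
    then have "proj_point w \<in> A \<union> B" using pp AB(3) C by blast
    then show False using F(2) G(2) w(3,4) self_in_proj_point[of w] by (auto simp: vanishes_on_def)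
  qed
  moreover have "proj_point a \<in> C" using a pp C by blast
  ultimately show ?thesis unfolding irreducible_closedin_def using cl by blast
qed

text \<open>The chain consists of the sections of \<open>M\<close> by a full flag of linear subspaces through \<open>a\<close>. The
  subspace \<open>L m\<close> fixes the ratio to the coordinate \<open>i0\<close> of all but the first \<open>m\<close> other coordinates.\<close>

theorem krull_dim_ge_interior_point:
  assumes fin: "finite I" and i0: "i0 \<in> I" and M: "M \<subseteq> proj_space I"
    and a: "a \<in> vec_space I" "a i0 \<noteq> 0"
    and nbhd: "\<And>v. v \<in> vec_space I \<Longrightarrow>
        \<exists>\<delta>>0. \<forall>e. norm e < \<delta> \<longrightarrow> proj_point (\<lambda>i. a i + e * v i) \<in> M"
  shows "krull_dim (subtopology (zariski I) M) \<ge> ereal (real (card I - 1))"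
proof -
  define N where "N = card I - 1"
  have "card (I - {i0}) = N" using fin i0 by (simp add: N_def)
  then obtain idx where idx: "bij_betw idx {..<N} (I - {i0})"
    using ex_bij_betw_nat_finite[of "I - {i0}"] fin by (metis atLeast0LessThan finite_Diff)
  have idxI: "idx k \<in> I" "idx k \<noteq> i0" if "k < N" for k
    using bij_betw_apply[OF idx, of k] that by auto
  define L where "L m = {x \<in> vec_space I. \<forall>k\<in>{m..<N}. x (idx k) * a i0 - x i0 * a (idx k) = 0}" for m
  define C where "C m = {A \<in> M. A \<subseteq> L m}" for m
  have aL: "a \<in> L m" for m using a by (auto simp: L_def)
  have "(\<lambda>i. 0) \<in> vec_space I" by (simp add: vec_space_def)
  from nbhd[OF this] obtain \<delta>
    where \<delta>: "\<delta> > 0" "\<And>e. cmod e < \<delta> \<Longrightarrow> proj_point (\<lambda>i. a i + e * 0) \<in> M"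
    by blast
  from \<delta>(2)[of 0] \<delta>(1) have aM: "proj_point a \<in> M" by simp
  have scale: "(\<lambda>i. c * x i) \<in> L m" if "x \<in> L m" for x c m
    using that by (auto simp: L_def vec_space_def mult.assoc)
  have lin: "(\<lambda>i. x i + e * (y i - x i)) \<in> L m" if "x \<in> L m" "y \<in> L m" for x y e m
    using that by (auto simp: L_def vec_space_def algebra_simps) 
  have cl: "closedin (subtopology (zariski I) M) (C m)" for m
  proof -
    have "closedin (subtopology (zariski I) M)
        {A \<in> M. \<forall>k\<in>K. \<forall>x\<in>A. x (idx k) * a i0 - x i0 * a (idx k) = 0}"
      if "finite K" "K \<subseteq> {..<N}" for K
      using that
    proof (induction K rule: finite_induct)
      case empty
      have "topspace (subtopology (zariski I) M) = M" using M by (auto simp: topspace_zariski)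
      then show ?case using closedin_topspace[of "subtopology (zariski I) M"] by simp
    next
      case (insert k K)
      have "(\<lambda>x. a i0 * x (idx k) + (- a (idx k)) * x i0) \<in> forms I 1"
        using idxI[of k] i0 fin insert.prems
        by (intro forms_add forms_cmult forms_coordinate) auto
      then have "(\<lambda>x. x (idx k) * a i0 - x i0 * a (idx k)) \<in> forms I 1"
        by (simp add: mult.commute)
      from closedin_zero_locus[OF insert.IH this] insert.prems show ?case
        by (simp add: conj_ac)
    qed
    then have
      "closedin (subtopology (zariski I) M)
        {A \<in> M. \<forall>k\<in>{m..<N}. \<forall>x\<in>A. x (idx k) * a i0 - x i0 * a (idx k) = 0}"
      by (meson atLeastLessThan_iff finite_atLeastLessThan lessThan_iff subsetI)
    also have "{A \<in> M. \<forall>k\<in>{m..<N}. \<forall>x\<in>A. x (idx k) * a i0 - x i0 * a (idx k) = 0} = C m"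
      using proj_space_memD(1) M unfolding C_def L_def by blast
    finally show ?thesis .
  qed
  have irr: "irreducible_closedin (subtopology (zariski I) M) (C m)" for m
    by (rule irreducible_closedin_linear_section[OF M C_def cl lin scale aL aM _ nbhd])
      (auto simp: L_def)
  have strict: "C m \<subset> C (Suc m)" if m: "m < N" for m
  proof -
    have "L m \<subseteq> L (Suc m)" by (auto simp: L_def)
    then have "C m \<subseteq> C (Suc m)" by (auto simp: C_def)
    define v where "v = (\<lambda>i. if i = idx m then (1::complex) else 0)"
    have "v \<in> vec_space I" using idxI[OF m] by (auto simp: v_def vec_space_def)
    then obtain \<delta> where \<delta>: "\<delta> > 0" "\<And>e. norm e < \<delta> \<Longrightarrow> proj_point (\<lambda>i. a i + e * v i) \<in> M"
      using nbhd by blast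
    define e where "e = complex_of_real (\<delta> / 2)"
    define w where "w = (\<lambda>i. a i + e * v i)"
    have "norm e < \<delta>" "e \<noteq> 0" using \<delta>(1) by (auto simp: e_def)
    have "proj_point w \<in> M" using \<delta>(2)[OF \<open>norm e < \<delta>\<close>] by (simp add: w_def)
    have wi0: "w i0 = a i0" using idxI[OF m] by (simp add: w_def v_def)
    have "idx k \<noteq> idx m" if "k \<in> {Suc m..<N}" for k
      using inj_onD[OF bij_betw_imp_inj_on[OF idx], of k m] that m by auto
    then have "w (idx k) = a (idx k)" if "k \<in> {Suc m..<N}" for k
      using that by (simp add: w_def v_def)
    then have "w \<in> L (Suc m)" using wi0 a \<open>v \<in> vec_space I\<close>
      by (auto simp: L_def w_def vec_space_def)
    then have "proj_point w \<in> C (Suc m)"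
      using \<open>proj_point w \<in> M\<close> scale by (auto simp: C_def proj_point_def)
    moreover have "w \<notin> L m"
    proof
      assume "w \<in> L m"
      then have "w (idx m) * a i0 - w i0 * a (idx m) = 0" using m by (simp add: L_def)
      then have "e * a i0 = 0" unfolding wi0 by (simp add: w_def v_def algebra_simps)
      then show False using a \<open>e \<noteq> 0\<close> by simp
    qed
    then have "proj_point w \<notin> C m" using self_in_proj_point[of w] by (auto simp: C_def)
    ultimately show ?thesis using \<open>C m \<subseteq> C (Suc m)\<close> by blast
  qed
  show ?thesis unfolding krull_dim_def N_def[symmetric]
    by (rule Sup_upper) (use irr strict in blast)
qed

lemma morph_proj_point:
  "morph n d (proj_point a) (proj_point u) = proj_point (param_eval n d a u)"
proof -
  have *: "param_eval n d (\<lambda>i. c * a i) (\<lambda>i. e * u i) = (\<lambda>i. (c * e ^ d) * param_eval n d a u i)" for c e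
  proof
    fix i
    have "c * a (i, j) * (e * u 0) ^ (d - j) * (e * u 1) ^ j =
       c * e ^ d * (a (i, j) * u 0 ^ (d - j) * u 1 ^ j)" if "j \<le> d" for j
    proof -
      have "e ^ d = e ^ (d - j) * e ^ j" using that by (simp add: power_add[symmetric])
      then show ?thesis by (simp add: power_mult_distrib)
    qed
    then have "(\<Sum>j\<le>d. c * a (i, j) * (e * u 0) ^ (d - j) * (e * u 1) ^ j) =
        c * e ^ d * (\<Sum>j\<le>d. a (i, j) * u 0 ^ (d - j) * u 1 ^ j)"
      unfolding sum_distrib_left by (intro sum.cong refl) (simp only: atMost_iff)
    then show "param_eval n d (\<lambda>i. c * a i) (\<lambda>i. e * u i) i = (c * e ^ d) * param_eval n d a u i"
      by (simp only: param_eval_def) simp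
  qed
  show ?thesis
  proof (intro equalityI subsetI)
    fix x assume "x \<in> morph n d (proj_point a) (proj_point u)"
    then obtain c e where "c \<noteq> 0" "e \<noteq> 0" "x = param_eval n d (\<lambda>i. c * a i) (\<lambda>i. e * u i)"
      by (auto simp: morph_def proj_point_def)
    then show "x \<in> proj_point (param_eval n d a u)"
      unfolding * proj_point_def by (intro CollectI exI[of _ "c * e ^ d"]) simp
  next
    fix x assume "x \<in> proj_point (param_eval n d a u)"
    then obtain c where c: "c \<noteq> 0" "x = (\<lambda>i. c * param_eval n d a u i)" by (auto simp: proj_point_def)
    then have "x = param_eval n d (\<lambda>i. c * a i) u" using *[of c 1] by simp
    moreover have "(\<lambda>i. c * a i) \<in> proj_point a" using c by (auto simp: proj_point_def)
    ultimately show "x \<in> morph n d (proj_point a) (proj_point u)"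
      using self_in_proj_point[of u] by (auto simp: morph_def)
  qed
qed

lemma M_nd_intro:
  assumes a: "a \<in> vec_space (coeff_index n d)" "a \<noteq> 0"
    and base: "\<And>u. u \<in> vec_space {..1} \<Longrightarrow> u \<noteq> 0 \<Longrightarrow> \<exists>i\<le>n. param_eval n d a u i \<noteq> 0"
    and indep: "\<And>b. (\<And>j. j \<le> d \<Longrightarrow> (\<Sum>i\<le>n. b i * a (i, j)) = 0) \<Longrightarrow> \<forall>i\<le>n. b i = 0"
  shows "proj_point a \<in> M_nd n d"
  unfolding M_nd_def
proof (intro CollectI conjI ballI allI impI)
  show "proj_point a \<in> proj_space (coeff_index n d)" using a by (simp add: proj_space_def)
next
  fix p assume "p \<in> P1"
  then obtain u where u: "p = proj_point u" "u \<in> vec_space {..1}" "u \<noteq> 0" by (auto simp: proj_space_def)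
  have "param_eval n d a u \<in> vec_space {..n} - {0}"
    using base[OF u(2,3)] by (auto simp: vec_space_def param_eval_def fun_eq_iff)
  then show "morph n d (proj_point a) p \<in> proj_space {..n}"
    unfolding u(1) morph_proj_point by (simp add: proj_space_def)
next
  fix b i assume b: "\<forall>x\<in>\<Union>(curve_image n d (proj_point a)). (\<Sum>i\<le>n. b i * x i) = 0" and i: "i \<le> n"
  define q where "q = (\<Sum>j\<le>d. monom (\<Sum>i\<le>n. b i * a (i, j)) j)"
  have cq: "coeff q j = (if j \<le> d then \<Sum>i\<le>n. b i * a (i, j) else 0)" for j
    unfolding q_def coeff_sum by (simp add: sum.delta')
  have "poly q t = 0" for t
  proof -
    define u where "u = (\<lambda>m::nat. if m = 0 then 1 else if m = 1 then t else 0)"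
    have "u \<in> vec_space {..1}" by (auto simp: vec_space_def u_def)
    moreover have "u \<noteq> 0" by (auto simp: u_def fun_eq_iff)
    ultimately have "proj_point u \<in> P1" by (auto simp: proj_space_def)
    from imageI[OF this, of "morph n d (proj_point a)"]
    have "proj_point (param_eval n d a u) \<in> curve_image n d (proj_point a)"
      by (simp only: curve_image_def morph_proj_point)
    then have "param_eval n d a u \<in> \<Union>(curve_image n d (proj_point a))"
      using self_in_proj_point by blast
    then have "(\<Sum>i\<le>n. b i * param_eval n d a u i) = 0" using b by blast
    also have "(\<Sum>i\<le>n. b i * param_eval n d a u i) = (\<Sum>i\<le>n. \<Sum>j\<le>d. b i * a (i, j) * t ^ j)"
      by (simp add: param_eval_def u_def sum_distrib_left mult.assoc)
    also have "\<dots> = poly q t"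
      by (subst sum.swap) (simp add: q_def poly_sum poly_monom sum_distrib_right)
    finally show ?thesis .
  qed
  then have "q = 0" using poly_all_0_iff_0 by blast
  then have "(\<Sum>i\<le>n. b i * a (i, j)) = 0" if "j \<le> d" for j
    using cq[of j] that by simp
  then show "b i = 0" using indep i by blast
qed

text \<open>The morphism with parameterizing forms \<open>u\<^sub>0\<^sup>d, u\<^sub>0\<^sup>d\<^sup>-\<^sup>1 u\<^sub>1, \<dots>\<close> (\<open>n\<close> of them) and \<open>u\<^sub>1\<^sup>d\<close> stays a
  nondegenerate morphism under small perturbations: one of the two pure powers dominates the
  perturbation at each point, and the coefficient matrix contains a diagonally dominant square matrix.\<close>

lemma M_nd_interior:
  assumes n: "n \<ge> 1" and d: "d \<ge> n"
  defines "a \<equiv> \<lambda>(i, j). if i \<le> n \<and> j = (if i < n then i else d) then (1::complex) else 0"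
  assumes v: "v \<in> vec_space (coeff_index n d)"
  shows "\<exists>\<delta>>0. \<forall>e. norm e < \<delta> \<longrightarrow> proj_point (\<lambda>i. a i + e * v i) \<in> M_nd n d"
proof (intro exI conjI allI impI)
  define S where "S = (\<Sum>p\<in>coeff_index n d. norm (v p))"
  have S: "S \<ge> 0" by (simp add: S_def sum_nonneg)
  show "1 / (1 + S) > 0" using S by simp
  fix e :: complex assume "norm e < 1 / (1 + S)"
  then have "norm e * (1 + S) < 1" using S by (simp add: field_simps)
  moreover have "norm e * S \<le> norm e * (1 + S)" by (intro mult_left_mono) auto
  ultimately have eS: "norm e * S < 1" by linarith
  have row: "norm e * (\<Sum>j\<le>d. norm (v (i, j))) < 1" if "i \<le> n" for i
  proof -
    have "(\<Sum>j\<le>d. norm (v (i, j))) = (\<Sum>p\<in>{i}\<times>{..d}. norm (v p))"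
      using sum.cartesian_product[where g = "\<lambda>x y. norm (v (x, y))" and A = "{i}" and B = "{..d}"]
      by (simp add: case_prod_unfold)
    also have "\<dots> \<le> S" unfolding S_def coeff_index_def
      using that by (intro sum_mono2) auto
    finally show ?thesis using eS by (meson le_less_trans mult_left_mono norm_ge_zero)
  qed
  have col: "norm e * (\<Sum>i\<le>n. norm (v (i, j))) < 1" if "j \<le> d" for j
  proof -
    have "(\<Sum>i\<le>n. norm (v (i, j))) = (\<Sum>p\<in>{..n}\<times>{j}. norm (v p))"
      using sum.cartesian_product[where g = "\<lambda>x y. norm (v (x, y))" and A = "{..n}" and B = "{j}"]
      by (simp add: case_prod_unfold)
    also have "\<dots> \<le> S" unfolding S_def coeff_index_def
      using that by (intro sum_mono2) auto
    finally show ?thesis using eS by (meson le_less_trans mult_left_mono norm_ge_zero)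
  qed
  define c where "c = (\<lambda>p. a p + e * v p)"
  have nv: "norm e * norm (v (i, j)) < 1" if "i \<le> n" "j \<le> d" for i j
  proof -
    have "norm (v (i, j)) \<le> (\<Sum>j\<le>d. norm (v (i, j)))"
      using that by (intro member_le_sum) auto
    then show ?thesis using row[OF that(1)] by (meson le_less_trans mult_left_mono norm_ge_zero)
  qed
  have "proj_point c \<in> M_nd n d"
  proof (rule M_nd_intro)
    show "c \<in> vec_space (coeff_index n d)"
      using v n d by (auto simp: c_def a_def vec_space_def coeff_index_def)
    have "c (0, 0) \<noteq> 0"
    proof
      assume "c (0, 0) = 0"
      then have "e * v (0, 0) = -1" using n by (simp add: c_def a_def eq_neg_iff_add_eq_0 add.commute)
      then have "norm (e * v (0, 0)) = 1" by simp
      then show False using nv[of 0 0] by (simp add: norm_mult)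
    qed
    then show "c \<noteq> 0" by auto
  next
    fix u :: "nat \<Rightarrow> complex" assume u: "u \<in> vec_space {..1}" "u \<noteq> 0"
    have u01: "u 0 \<noteq> 0 \<or> u 1 \<noteq> 0"
    proof (rule ccontr)
      assume *: "\<not> (u 0 \<noteq> 0 \<or> u 1 \<noteq> 0)"
      have "u i = 0" for i
      proof (cases "i \<le> 1")
        case True
        then have "i = 0 \<or> i = 1" by auto
        then show ?thesis using * by auto
      qed (use u(1) in \<open>auto simp: vec_space_def\<close>)
      then show False using u(2) by auto
    qed
    define R where "R = max (norm (u 0)) (norm (u 1))"
    have R: "R > 0" using u01 by (auto simp: R_def less_max_iff_disj)
    have bound: "norm (param_eval n d c u i - (\<Sum>j\<le>d. a (i, j) * u 0 ^ (d - j) * u 1 ^ j)) < R ^ d"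
      if "i \<le> n" for i
    proof -
      have "param_eval n d c u i - (\<Sum>j\<le>d. a (i, j) * u 0 ^ (d - j) * u 1 ^ j) =
          (\<Sum>j\<le>d. e * v (i, j) * (u 0 ^ (d - j) * u 1 ^ j))"
        using that by (simp add: param_eval_def c_def sum_subtractf[symmetric] algebra_simps)
      also have "norm \<dots> \<le> (\<Sum>j\<le>d. norm e * norm (v (i, j)) * R ^ d)"
      proof (intro sum_norm_le)
        fix j assume "j \<in> {..d}"
        have "norm (u 0 ^ (d - j) * u 1 ^ j) \<le> R ^ (d - j) * R ^ j"
          unfolding norm_mult norm_power R_def
          by (intro mult_mono power_mono) (auto simp: le_max_iff_disj)
        also have "\<dots> = R ^ d" using \<open>j \<in> {..d}\<close> by (simp add: power_add[symmetric])
        finally show "norm (e * v (i, j) * (u 0 ^ (d - j) * u 1 ^ j)) \<le> norm e * norm (v (i, j)) * R ^ d"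
          unfolding norm_mult[of "e * v (i,j)"] norm_mult[of e] by (intro mult_left_mono) auto
      qed
      also have "\<dots> = norm e * (\<Sum>j\<le>d. norm (v (i, j))) * R ^ d"
        by (simp add: sum_distrib_left sum_distrib_right)
      also have "\<dots> < 1 * R ^ d" using row[OF that] R by (intro mult_strict_right_mono) auto
      finally show ?thesis by simp
    qed
    show "\<exists>i\<le>n. param_eval n d c u i \<noteq> 0"
    proof (cases "norm (u 0) \<ge> norm (u 1)")
      case True
      have "(\<Sum>j\<le>d. a (0, j) * u 0 ^ (d - j) * u 1 ^ j) = (\<Sum>j\<in>{0}. a (0, j) * u 0 ^ (d - j) * u 1 ^ j)"
        using n by (intro sum.mono_neutral_right) (auto simp: a_def)
      then have "(\<Sum>j\<le>d. a (0, j) * u 0 ^ (d - j) * u 1 ^ j) = u 0 ^ d" using n by (simp add: a_def)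
      then have "param_eval n d c u 0 \<noteq> 0"
        using bound[of 0] True by (auto simp: R_def norm_power max_def)
      then show ?thesis by blast
    next
      case False
      have "(\<Sum>j\<le>d. a (n, j) * u 0 ^ (d - j) * u 1 ^ j) = (\<Sum>j\<in>{d}. a (n, j) * u 0 ^ (d - j) * u 1 ^ j)"
        by (intro sum.mono_neutral_right) (auto simp: a_def)
      then have "(\<Sum>j\<le>d. a (n, j) * u 0 ^ (d - j) * u 1 ^ j) = u 1 ^ d" by (simp add: a_def)
      then have "param_eval n d c u n \<noteq> 0"
        using bound[of n] False by (auto simp: R_def norm_power max_def)
      then show ?thesis by blast
    qed
  next
    fix b :: "nat \<Rightarrow> complex"
    assume b: "\<And>j. j \<le> d \<Longrightarrow> (\<Sum>i\<le>n. b i * c (i, j)) = 0"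
    define B where "B = Max ((\<lambda>i. norm (b i)) ` {..n})"
    have Bge: "norm (b i) \<le> B" if "i \<le> n" for i unfolding B_def using that by (intro Max_ge) auto
    have "B \<in> (\<lambda>i. norm (b i)) ` {..n}" unfolding B_def by (intro Max_in) auto
    then obtain m where m: "m \<le> n" "norm (b m) = B" by auto
    define j where "j = (if m < n then m else d)"
    have j: "j \<le> d" using d by (auto simp: j_def)
    have "(\<Sum>i\<le>n. b i * a (i, j)) = (\<Sum>i\<in>{m}. b i * a (i, j))"
      using m d by (intro sum.mono_neutral_right) (auto simp: a_def j_def split: if_splits)
    also have "\<dots> = b m" using m by (simp add: a_def j_def)
    finally have "b m = - (\<Sum>i\<le>n. e * v (i, j) * b i)"
      using b[OF j] by (simp add: c_def algebra_simps sum.distrib eq_neg_iff_add_eq_0)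
    then have "B = norm (\<Sum>i\<le>n. e * v (i, j) * b i)" using m(2) by simp
    also have "\<dots> \<le> (\<Sum>i\<le>n. norm e * norm (v (i, j)) * B)"
      using Bge by (intro sum_norm_le) (simp add: norm_mult mult_left_mono)
    also have "\<dots> = (norm e * (\<Sum>i\<le>n. norm (v (i, j)))) * B"
      by (simp add: sum_distrib_left sum_distrib_right)
    finally have le: "B * (1 - norm e * (\<Sum>i\<le>n. norm (v (i, j)))) \<le> 0" by (simp add: algebra_simps)
    have "B \<le> 0"
    proof (rule ccontr)
      assume "\<not> B \<le> 0"
      then have "B * (1 - norm e * (\<Sum>i\<le>n. norm (v (i, j)))) > 0" using col[OF j] by simp
      then show False using le by linarith
    qed
    then show "\<forall>i\<le>n. b i = 0" using Bge by (meson norm_le_zero_iff order_trans)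
  qed
  then show "proj_point (\<lambda>i. a i + e * v i) \<in> M_nd n d" by (simp add: c_def)
qed

theorem krull_dim_M_nd_ge:
  assumes "n \<ge> 1" "d \<ge> n"
  shows "krull_dim (subtopology (zariski (coeff_index n d)) (M_nd n d))
           \<ge> ereal (real ((n + 1) * (d + 1) - 1))"
proof -
  define a where "a = (\<lambda>(i, j). if i \<le> n \<and> j = (if i < n then i else d) then (1::complex) else 0)"
  have "ereal (real (card (coeff_index n d) - 1))
      \<le> krull_dim (subtopology (zariski (coeff_index n d)) (M_nd n d))"
  proof (rule krull_dim_ge_interior_point)
    show "a \<in> vec_space (coeff_index n d)"
      using assms by (auto simp: a_def vec_space_def coeff_index_def)
    show "a (0, 0) \<noteq> 0" using assms by (simp add: a_def)
    show "\<exists>\<delta>>0. \<forall>e. cmod e < \<delta> \<longrightarrow> proj_point (\<lambda>i. a i + e * v i) \<in> M_nd n d"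
      if "v \<in> vec_space (coeff_index n d)" for v
      using M_nd_interior[OF assms that] unfolding a_def .
  qed (auto simp: coeff_index_def M_nd_def)
  then show ?thesis by (simp add: coeff_index_def card_cartesian_product)
qed

section \<open>Relations between the coefficients of a normal form\<close>

lemma poly_alg_cmult: "f \<in> poly_alg W y J \<Longrightarrow> (\<lambda>w. a * f w) \<in> poly_alg W y J"
  by (rule poly_alg.mult[OF poly_alg.const])

lemma poly_alg_diff:
  "f \<in> poly_alg W y J \<Longrightarrow> g \<in> poly_alg W y J \<Longrightarrow> (\<lambda>w. f w - g w) \<in> poly_alg W y J"
  using poly_alg.add[OF _ poly_alg_cmult[of g W y J "-1"], of f] by simp

lemma poly_alg_sum:
  "(\<And>k. k \<in> K \<Longrightarrow> f k \<in> poly_alg W y J) \<Longrightarrow> (\<lambda>w. \<Sum>k\<in>K. f k w) \<in> poly_alg W y J"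
  by (induction K rule: infinite_finite_induct) (auto intro: poly_alg.const poly_alg.add)

text \<open>A family of power series over \<open>W\<close> whose coefficients up to \<open>t ^ N\<close> are polynomials in the parameters.\<close>

definition alg_coeffs ::
    "'w set \<Rightarrow> ('j \<Rightarrow> 'w \<Rightarrow> complex) \<Rightarrow> 'j set \<Rightarrow> nat \<Rightarrow> ('w \<Rightarrow> complex fps) \<Rightarrow> bool" where
  "alg_coeffs W y J N f \<longleftrightarrow> (\<forall>i\<le>N. (\<lambda>w. fps_nth (f w) i) \<in> poly_alg W y J)"

lemma alg_coeffs_mult:
  assumes "alg_coeffs W y J N f" "alg_coeffs W y J N g"
  shows "alg_coeffs W y J N (\<lambda>w. f w * g w)"
  unfolding alg_coeffs_def fps_mult_nth
  using assms by (auto simp: alg_coeffs_def intro!: poly_alg_sum poly_alg.mult)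

lemma alg_coeffs_power:
  assumes "alg_coeffs W y J N f" shows "alg_coeffs W y J N (\<lambda>w. f w ^ k)"
proof (induction k)
  case 0
  have "(\<lambda>w. if i = 0 then 1 else 0) \<in> poly_alg W y J" for i :: nat by (rule poly_alg.const)
  then show ?case by (auto simp: alg_coeffs_def)
next
  case (Suc k)
  then show ?case using alg_coeffs_mult[OF assms] by simp
qed

lemma alg_coeffs_inverse:
  assumes f: "alg_coeffs W y J N f" and f0: "\<And>w. w \<in> W \<Longrightarrow> fps_nth (f w) 0 = 1"
  shows "alg_coeffs W y J N (\<lambda>w. inverse (f w))"
proof -
  have "i \<le> N \<Longrightarrow> (\<lambda>w. fps_nth (inverse (f w)) i) \<in> poly_alg W y J" for i
  proof (induction i rule: less_induct)
    case (less i)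
    show ?case
    proof (cases "i = 0")
      case True
      show ?thesis
        by (rule poly_alg.cong[OF poly_alg.const[of 1]]) (simp add: True f0)
    next
      case False
      have "(\<lambda>w. - 1 * (\<Sum>k=1..i. fps_nth (f w) k * fps_nth (inverse (f w)) (i - k))) \<in> poly_alg W y J"
        using f less False
        by (intro poly_alg_cmult poly_alg_sum poly_alg.mult) (auto simp: alg_coeffs_def)
      moreover have "fps_nth (inverse (f w)) i =
          - 1 * (\<Sum>k=1..i. fps_nth (f w) k * fps_nth (inverse (f w)) (i - k))" if "w \<in> W" for w
      proof -
        have "fps_nth (f w * inverse (f w)) i = 0"
          using f0[OF that] False inverse_mult_eq_1'[of "f w"] by simp
        then show ?thesis
          using f0[OF that] by (simp add: fps_mult_nth sum.atLeast_Suc_atMost eq_neg_iff_add_eq_0)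
      qed
      ultimately show ?thesis by (rule poly_alg.cong) auto
    qed
  qed
  then show ?thesis by (simp add: alg_coeffs_def)
qed

text \<open>The coefficient of \<open>t ^ j\<close> in \<open>U * H ^ m\<close> involves the coefficient of \<open>t ^ j\<close> in \<open>H\<close> only linearly,
  with factor \<open>m\<close>. So, for \<open>m > 0\<close>, a value of the former can be solved for the latter.\<close>

lemma power_coeff_leading_part:
  assumes j: "j \<ge> 1" and U: "alg_coeffs W y J j U" and U0: "\<And>w. w \<in> W \<Longrightarrow> fps_nth (U w) 0 = 1"
    and H: "alg_coeffs W y J (j - 1) H" and H0: "\<And>w. w \<in> W \<Longrightarrow> fps_nth (H w) 0 = 1"
  shows "(\<lambda>w. fps_nth (U w * H w ^ m) j - of_nat m * fps_nth (H w) j) \<in> poly_alg W y J"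
proof (induction m)
  case 0
  then show ?case using U by (simp add: alg_coeffs_def)
next
  case (Suc m)
  let ?V = "\<lambda>w. U w * H w ^ m"
  have "alg_coeffs W y J (j - 1) U" using U by (simp add: alg_coeffs_def)
  then have V: "alg_coeffs W y J (j - 1) ?V" by (intro alg_coeffs_mult alg_coeffs_power H)
  have V0: "fps_nth (?V w) 0 = 1" if "w \<in> W" for w using U0 H0 that by (simp add: fps_power_zeroth)
  have split: "fps_nth (U w * H w ^ Suc m) j - of_nat (Suc m) * fps_nth (H w) j =
      (fps_nth (?V w) j - of_nat m * fps_nth (H w) j) +
      (\<Sum>i=1..j-1. fps_nth (?V w) i * fps_nth (H w) (j - i))" if w: "w \<in> W" for w
  proof -
    obtain j' where j': "j = Suc j'" using j by (cases j) auto
    have "fps_nth (U w * H w ^ Suc m) j = fps_nth (?V w * H w) j" by (simp add: mult_ac)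
    also have "\<dots> = (\<Sum>i=0..Suc j'. fps_nth (?V w) i * fps_nth (H w) (j - i))"
      by (simp only: fps_mult_nth j')
    also have "\<dots> = (\<Sum>i=0..j'. fps_nth (?V w) i * fps_nth (H w) (j - i)) + fps_nth (?V w) j"
      using H0[OF w] by (simp add: j')
    also have "(\<Sum>i=0..j'. fps_nth (?V w) i * fps_nth (H w) (j - i)) =
        fps_nth (H w) j + (\<Sum>i=1..j'. fps_nth (?V w) i * fps_nth (H w) (j - i))"
      using V0[OF w] by (subst sum.atLeast_Suc_atMost) auto
    finally show ?thesis by (simp add: j' algebra_simps)
  qed
  have "(\<lambda>w. (fps_nth (?V w) j - of_nat m * fps_nth (H w) j) +
      (\<Sum>i=1..j-1. fps_nth (?V w) i * fps_nth (H w) (j - i))) \<in> poly_alg W y J"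
    using V H by (intro poly_alg.add Suc.IH poly_alg_sum poly_alg.mult) (auto simp: alg_coeffs_def)
  then show ?case by (rule poly_alg.cong) (rule split)
qed

text \<open>If \<open>h 2 / h 0 = s ^ 2\<close> with a local coordinate \<open>s\<close>, then these are the series \<open>h 0 * s ^ (2 * m)\<close>.
  The coordinate \<open>s\<close> itself, a square root, is never needed.\<close>

definition even_power :: "(nat \<Rightarrow> complex fps) \<Rightarrow> nat \<Rightarrow> complex fps" where
  "even_power h m = h 0 * (h 2 * inverse (h 0)) ^ m"

text \<open>The analogue of a reduced row echelon form, for a space of polynomials of degree at most \<open>d\<close> with
  vanishing orders \<open>P\<close>.\<close>

definition reduced_basis :: "nat \<Rightarrow> nat set \<Rightarrow> (nat \<Rightarrow> complex fps) \<Rightarrow> bool" where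
  "reduced_basis d P h \<longleftrightarrow> (\<forall>r\<in>P. fps_nth (h r) r = 1 \<and>
     (\<forall>j. j < r \<or> j > d \<or> (j \<in> P \<and> j \<noteq> r) \<longrightarrow> fps_nth (h r) j = 0))"

definition even_expansion :: "nat \<Rightarrow> nat set \<Rightarrow> (nat \<Rightarrow> complex fps) \<Rightarrow> (nat \<Rightarrow> nat \<Rightarrow> complex) \<Rightarrow> bool" where
  "even_expansion g P h c \<longleftrightarrow> (\<forall>r\<in>P - {0, 2}. \<forall>j<2 * g.
     fps_nth (h r) j = (\<Sum>m<g. c r m * fps_nth (even_power h m) j))"

text \<open>The coefficients of a reduced basis that are not fixed to be \<open>0\<close> or \<open>1\<close>.\<close>

definition free_positions :: "nat \<Rightarrow> nat set \<Rightarrow> (nat \<times> nat) set" where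
  "free_positions d P = {(r, j). r \<in> P \<and> r < j \<and> j \<le> d \<and> j \<notin> P}"

definition odd_positions :: "nat \<Rightarrow> nat \<Rightarrow> nat set \<Rightarrow> (nat \<times> nat) set" where
  "odd_positions d g P = {(r, j). r \<in> P - {0, 2} \<and> r < j \<and> odd j \<and> j < 2 * g \<and> j \<le> d}"

lemma even_power_nth:
  assumes "fps_nth (h 0) 0 = 1" "fps_nth (h 2) 2 = 1" "\<And>j. j < 2 \<Longrightarrow> fps_nth (h 2) j = 0"
  shows "even_power h m = fps_X ^ (2 * m) * (h 0 * inverse (h 0) ^ m * (fps_shift 2 (h 2)) ^ m)"
    and "j < 2 * m \<Longrightarrow> fps_nth (even_power h m) j = 0"
    and "fps_nth (even_power h m) (2 * m) = 1"
proof -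
  have "h 2 = fps_X ^ 2 * fps_shift 2 (h 2)"
  proof (rule fps_ext)
    fix k show "fps_nth (h 2) k = fps_nth (fps_X ^ 2 * fps_shift 2 (h 2)) k"
    proof (cases "k < 2")
      case False
      then have "Suc (Suc (k - 2)) = k" by simp
      then show ?thesis using False by (simp add: fps_X_power_mult_nth)
    qed (simp add: assms(3) fps_X_power_mult_nth)
  qed
  then have "(h 2) ^ m = fps_X ^ (2 * m) * fps_shift 2 (h 2) ^ m"
    by (metis power_mult_distrib power_mult)
  then show eq: "even_power h m = fps_X ^ (2 * m) * (h 0 * inverse (h 0) ^ m * (fps_shift 2 (h 2)) ^ m)"
    unfolding even_power_def power_mult_distrib by (simp only: mult_ac)
  show "j < 2 * m \<Longrightarrow> fps_nth (even_power h m) j = 0"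
    unfolding eq by (simp add: fps_X_power_mult_nth)
  have "fps_nth (fps_shift 2 (h 2)) 0 = 1" using assms(2) by (simp add: numeral_2_eq_2)
  then show "fps_nth (even_power h m) (2 * m) = 1"
    unfolding eq fps_X_power_mult_nth using assms by (simp add: fps_power_zeroth)
qed

text \<open>The series \<open>even_power h k\<close> starts with \<open>t ^ (2 * k)\<close>, so the coefficients \<open>c r m\<close> can be read off
  from the even positions one after the other.\<close>

lemma even_expansion_recursion:
  assumes basis: "reduced_basis d P h" and expansion: "even_expansion g P h c"
    and P: "0 \<in> P" "2 \<in> P" and r: "r \<in> P - {0, 2}" and m: "m < g"
  shows "c r m = fps_nth (h r) (2 * m) - (\<Sum>k<m. c r k * fps_nth (even_power h k) (2 * m))"
proof -
  have "fps_nth (h 0) 0 = 1" "fps_nth (h 2) 2 = 1" "\<And>j. j < 2 \<Longrightarrow> fps_nth (h 2) j = 0"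
    using basis P by (auto simp: reduced_basis_def)
  note ep = even_power_nth[OF this]
  have "fps_nth (h r) (2 * m) = (\<Sum>k<g. c r k * fps_nth (even_power h k) (2 * m))"
    using expansion r m unfolding even_expansion_def by auto
  also have "\<dots> = (\<Sum>k<Suc m. c r k * fps_nth (even_power h k) (2 * m))"
    using m ep(2) by (intro sum.mono_neutral_right) auto
  finally show ?thesis using ep(3)[of m] by simp
qed

text \<open>A family of reduced bases with fixed orders \<open>P\<close>, all satisfying the relations of a hyperelliptic cusp.
  The parameters are the position \<open>\<tau>\<close> of the cusp and the coefficients at the positions \<open>F\<close>; which
  other coefficients are polynomials in them is the question of this section.\<close>

locale cusp_family =
  fixes W :: "'w set" and d g :: nat and P :: "nat set"
    and \<tau> :: "'w \<Rightarrow> complex" and h :: "'w \<Rightarrow> nat \<Rightarrow> complex fps" and c :: "'w \<Rightarrow> nat \<Rightarrow> nat \<Rightarrow> complex"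
    and F :: "(nat \<times> nat) set"
  assumes P0: "0 \<in> P" and P2: "2 \<in> P" and P_le: "P \<subseteq> {..d}"
    and P_odd: "\<And>r. r \<in> P \<Longrightarrow> odd r \<Longrightarrow> r \<ge> 2 * g"
    and basis: "\<And>w. w \<in> W \<Longrightarrow> reduced_basis d P (h w)"
    and expansion: "\<And>w. w \<in> W \<Longrightarrow> even_expansion g P (h w) (c w)"
begin

text \<open>The parameter \<open>None\<close> is the position of the cusp.\<close>

definition param :: "(nat \<times> nat) option \<Rightarrow> 'w \<Rightarrow> complex" where
  "param p w = (case p of None \<Rightarrow> \<tau> w | Some (r, j) \<Rightarrow> fps_nth (h w r) j)"

abbreviation alg :: "('w \<Rightarrow> complex) set" where
  "alg \<equiv> poly_alg W param (insert None (Some ` F))"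

abbreviation algc :: "nat \<Rightarrow> ('w \<Rightarrow> complex fps) \<Rightarrow> bool" where
  "algc \<equiv> alg_coeffs W param (insert None (Some ` F))"

lemma tau_alg: "\<tau> \<in> alg"
  by (rule poly_alg.cong[OF poly_alg.gen[of None]]) (auto simp: param_def)

lemma basis_nth:
  assumes "w \<in> W" "r \<in> P"
  shows "fps_nth (h w r) r = 1" "j < r \<or> j > d \<or> (j \<in> P \<and> j \<noteq> r) \<Longrightarrow> fps_nth (h w r) j = 0"
  using basis[OF assms(1)] assms(2) unfolding reduced_basis_def by blast+

lemma coeff_alg:
  assumes r: "r \<in> P" and j: "(r, j) \<in> free_positions d P \<Longrightarrow> (r, j) \<in> F"
  shows "(\<lambda>w. fps_nth (h w r) j) \<in> alg"
proof (cases "(r, j) \<in> free_positions d P")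
  case True
  show ?thesis
    by (rule poly_alg.cong[OF poly_alg.gen[of "Some (r, j)"]]) (use j True in \<open>auto simp: param_def\<close>)
next
  case False
  show ?thesis
  proof (cases "j = r")
    case True
    show ?thesis by (rule poly_alg.cong[OF poly_alg.const[of 1]]) (use r True basis_nth in auto)
  next
    case neq: False
    then have "j < r \<or> j > d \<or> (j \<in> P \<and> j \<noteq> r)" using False r by (auto simp: free_positions_def)
    then show ?thesis using basis_nth(2)[OF _ r]
      by (intro poly_alg.cong[OF poly_alg.const[of 0]]) auto
  qed
qed

lemma h0_nth: "w \<in> W \<Longrightarrow> fps_nth (h w 0) 0 = 1"
  using basis_nth(1) P0 by blast

lemma h2_nth: "w \<in> W \<Longrightarrow> fps_nth (h w 2) 2 = 1" "w \<in> W \<Longrightarrow> j < 2 \<Longrightarrow> fps_nth (h w 2) j = 0"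
  using basis_nth P2 by blast+

lemma even_power_alg:
  assumes "algc N (\<lambda>w. h w 0)" "algc N (\<lambda>w. h w 2)"
  shows "algc N (\<lambda>w. even_power (h w) m)"
  unfolding even_power_def
  by (intro alg_coeffs_mult alg_coeffs_power alg_coeffs_inverse assms h0_nth)

lemma expansion_recursion:
  assumes "w \<in> W" "r \<in> P - {0, 2}" "m < g"
  shows "c w r m = fps_nth (h w r) (2 * m) - (\<Sum>k<m. c w r k * fps_nth (even_power (h w) k) (2 * m))"
  using even_expansion_recursion[OF basis[OF assms(1)] expansion[OF assms(1)] P0 P2 assms(2,3)] .

text \<open>The recursion for the \<open>c r m\<close>, in a form that permits gaps: at each step either the coefficient at
  the position \<open>2 * m\<close> or \<open>c r m\<close> itself has to be known. The factor \<open>\<epsilon>\<close> serves as a common denominator.\<close>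

lemma scaled_expansion_alg:
  assumes ep: "\<And>m. algc (2 * g) (\<lambda>w. even_power (h w) m)" and r: "r \<in> P - {0, 2}" and M: "M \<le> g"
    and step: "\<And>m. m < M \<Longrightarrow> (\<lambda>w. \<epsilon> w * fps_nth (h w r) (2 * m)) \<in> alg \<or> (\<lambda>w. \<epsilon> w * c w r m) \<in> alg"
    and m: "m < M"
  shows "(\<lambda>w. \<epsilon> w * c w r m) \<in> alg"
  using m
proof (induction m rule: less_induct)
  case (less m)
  show ?case
  proof (cases "(\<lambda>w. \<epsilon> w * c w r m) \<in> alg")
    case False
    then have "(\<lambda>w. \<epsilon> w * fps_nth (h w r) (2 * m)) \<in> alg" using step less.prems by blast
    moreover have "(\<lambda>w. \<Sum>k<m. (\<epsilon> w * c w r k) * fps_nth (even_power (h w) k) (2 * m)) \<in> alg"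
      using less ep M by (intro poly_alg_sum, intro poly_alg.mult[of "\<lambda>w. \<epsilon> w * c w r _"]) (auto simp: alg_coeffs_def)
    ultimately have "(\<lambda>w. \<epsilon> w * fps_nth (h w r) (2 * m) -
        (\<Sum>k<m. (\<epsilon> w * c w r k) * fps_nth (even_power (h w) k) (2 * m))) \<in> alg"
      by (rule poly_alg_diff)
    then show ?thesis
    proof (rule poly_alg.cong)
      fix w assume "w \<in> W"
      from expansion_recursion[OF this r, of m] less.prems M
      have "c w r m = fps_nth (h w r) (2 * m) - (\<Sum>k<m. c w r k * fps_nth (even_power (h w) k) (2 * m))"
        by simp
      then show "\<epsilon> w * c w r m = \<epsilon> w * fps_nth (h w r) (2 * m) -
          (\<Sum>k<m. (\<epsilon> w * c w r k) * fps_nth (even_power (h w) k) (2 * m))"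
        by (simp only: right_diff_distrib sum_distrib_left mult.assoc)
    qed
  qed
qed

lemma scaled_coeff_alg:
  assumes ep: "\<And>m. algc (2 * g) (\<lambda>w. even_power (h w) m)" and r: "r \<in> P - {0, 2}"
    and \<epsilon>: "\<epsilon> \<in> alg" and c: "\<And>m. m < g \<Longrightarrow> (\<lambda>w. \<epsilon> w * c w r m) \<in> alg"
    and high: "\<And>j. j \<ge> 2 * g \<Longrightarrow> (r, j) \<in> free_positions d P \<Longrightarrow> (r, j) \<in> F"
  shows "(\<lambda>w. \<epsilon> w * fps_nth (h w r) j) \<in> alg"
proof (cases "j < 2 * g")
  case True
  have "(\<lambda>w. \<Sum>m<g. (\<epsilon> w * c w r m) * fps_nth (even_power (h w) m) j) \<in> alg"
    using c ep True by (intro poly_alg_sum, intro poly_alg.mult[of "\<lambda>w. \<epsilon> w * c w r _"]) (auto simp: alg_coeffs_def)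
  then show ?thesis
    by (rule poly_alg.cong)
      (use expansion r True in \<open>auto simp: even_expansion_def sum_distrib_left mult.assoc\<close>)
next
  case False
  then show ?thesis using r high by (intro poly_alg.mult \<epsilon> coeff_alg) auto
qed

text \<open>No coefficient at an odd position below \<open>2 * g\<close> is needed as a parameter, except for those of \<open>h 0\<close>
  and \<open>h 2\<close>: the even positions determine the \<open>c r m\<close>, and these determine everything below \<open>2 * g\<close>.\<close>

lemma coeffs_alg_regular:
  assumes F: "free_positions d P - odd_positions d g P \<subseteq> F" and r: "r \<in> P"
  shows "(\<lambda>w. fps_nth (h w r) j) \<in> alg"
proof -
  have low: "(\<lambda>w. fps_nth (h w s) j) \<in> alg" if "s = 0 \<or> s = 2" for s j
    using that F P0 P2 by (intro coeff_alg) (auto simp: odd_positions_def)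
  then have ep: "algc N (\<lambda>w. even_power (h w) m)" for N m
    by (intro even_power_alg) (auto simp: alg_coeffs_def)
  show ?thesis
  proof (cases "r = 0 \<or> r = 2")
    case True then show ?thesis by (rule low)
  next
    case False
    then have r': "r \<in> P - {0, 2}" using r by blast
    have one: "(\<lambda>w. 1) \<in> alg" by (rule poly_alg.const)
    have "(\<lambda>w. fps_nth (h w r) (2 * m)) \<in> alg" for m
      using r F by (intro coeff_alg) (auto simp: odd_positions_def)
    then have "(\<lambda>w. 1 * c w r m) \<in> alg" if "m < g" for m
      using scaled_expansion_alg[OF ep r' order_refl, of "\<lambda>w. 1" m] that by auto
    moreover have "(r, i) \<in> F" if "i \<ge> 2 * g" "(r, i) \<in> free_positions d P" for i
      using F that by (auto simp: odd_positions_def)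
    ultimately have "(\<lambda>w. 1 * fps_nth (h w r) j) \<in> alg"
      using scaled_coeff_alg[OF ep r' one, of j] by blast
    then show ?thesis by simp
  qed
qed

text \<open>The stratum \<open>\<mu>\<close> of the case \<open>d = 2 * g - 2\<close>; here \<open>\<mu> = 1\<close> stands for the stratum on which all the
  coefficients \<open>e m\<close> of \<open>t ^ (2 * g - 1)\<close> in \<open>even_power h m\<close> vanish, for \<open>m \<ge> 2\<close>. In addition to the odd
  positions, one parameter is saved for every \<open>r \<in> P - {0, 2}\<close>: at the position \<open>(r, 2 * \<mu>)\<close> if
  \<open>r < 2 * \<mu>\<close>, and at the position \<open>(2, 2 * g + 1 - r)\<close>, by \<open>e (r / 2) = 0\<close>, if \<open>r > 2 * \<mu>\<close>. Solving
  the relation \<open>(\<Sum>m<g. c r m * e m) = 0\<close> for \<open>c r \<mu>\<close> introduces the denominator \<open>\<epsilon> = e \<mu>\<close>, with which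
  all coefficients of \<open>h r\<close> are multiplied.\<close>

lemma coeffs_alg_special:
  assumes d: "d + 2 = 2 * g" and \<mu>: "1 \<le> \<mu>" "\<mu> < g"
    and zero: "\<And>m w. \<mu> < m \<Longrightarrow> m < g \<Longrightarrow> w \<in> W \<Longrightarrow> fps_nth (even_power (h w) m) (2 * g - 1) = 0"
    and F: "free_positions d P - odd_positions d g P - (\<lambda>r. (r, 2 * \<mu>)) ` {r \<in> P - {0, 2}. r < 2 * \<mu>}
        - (\<lambda>r. (2, 2 * g + 1 - r)) ` {r \<in> P - {0, 2}. 2 * \<mu> < r} \<subseteq> F"
    and \<mu>P: "2 * \<mu> \<in> P \<Longrightarrow> \<mu> = 1"
    and r: "r \<in> P"
  defines "\<epsilon> \<equiv> \<lambda>w. if \<mu> = 1 then 1 else fps_nth (even_power (h w) \<mu>) (2 * g - 1)"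
  shows "(\<lambda>w. \<epsilon> w * fps_nth (h w r) j) \<in> alg"
proof -
  have P_even: "even s" if "s \<in> P" for s
    using P_odd[OF that] P_le that d by (cases "even s") auto
  have Pge: "s \<ge> 4" if "s \<in> P - {0, 2}" for s
  proof -
    have "even s" using P_even that by blast
    then obtain k where "s = 2 * k" by (rule evenE)
    then show ?thesis using that by (cases "k = 0"; cases "k = 1") auto
  qed
  have h0: "algc N (\<lambda>w. h w 0)" for N
    unfolding alg_coeffs_def using F P0 by (intro allI impI coeff_alg) (auto simp: odd_positions_def)
  have h2: "(\<lambda>w. fps_nth (h w 2) i) \<in> alg" for i
  proof (induction i rule: less_induct)
    case (less i)
    show ?case
    proof (cases "\<exists>s\<in>P - {0, 2}. 2 * \<mu> < s \<and> i = 2 * g + 1 - s")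
      case False
      then show ?thesis using F P2 by (intro coeff_alg) (auto simp: odd_positions_def)
    next
      case True
      then obtain s where s: "s \<in> P - {0, 2}" "2 * \<mu> < s" "i = 2 * g + 1 - s" by blast
      have "even s" using P_even s(1) by blast
      then obtain m where m: "s = 2 * m" by (rule evenE)
      have "s \<le> d" using s(1) P_le by auto
      then have bounds: "\<mu> < m" "m < g" "m \<ge> 2" "i \<ge> 3" "i - 2 = 2 * g - 1 - 2 * m"
        using s m d Pge[OF s(1)] by auto
      define H where "H w = fps_shift 2 (h w 2)" for w
      define U where "U w = h w 0 * inverse (h w 0) ^ m" for w
      \<comment> \<open>the coefficient \<open>e m\<close> is the one of \<open>t ^ (i - 2)\<close> in \<open>U * H ^ m\<close>\<close>
      have "algc N U" for N unfolding U_def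
        by (intro alg_coeffs_mult alg_coeffs_power alg_coeffs_inverse h0 h0_nth)
      moreover have "fps_nth (U w) 0 = 1" "fps_nth (H w) 0 = 1" if "w \<in> W" for w
        using h0_nth[OF that] h2_nth(1)[OF that] by (auto simp: U_def H_def fps_power_zeroth numeral_2_eq_2)
      moreover have "algc (i - 2 - 1) H" using less bounds(4) by (auto simp: alg_coeffs_def H_def)
      ultimately have "(\<lambda>w. fps_nth (U w * H w ^ m) (i - 2) - of_nat m * fps_nth (H w) (i - 2)) \<in> alg"
        using bounds(4) by (intro power_coeff_leading_part) auto
      from poly_alg_cmult[OF this, of "- 1 / of_nat m"] show ?thesis
      proof (rule poly_alg.cong)
        fix w assume w: "w \<in> W"
        have "fps_nth (even_power (h w) m) (2 * g - 1) = 0" using zero bounds w by blast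
        moreover have "even_power (h w) m = fps_X ^ (2 * m) * (U w * H w ^ m)"
          unfolding U_def H_def by (rule even_power_nth(1)[OF h0_nth[OF w] h2_nth[OF w]])
        moreover have "\<not> 2 * g - 1 < 2 * m" "2 * g - 1 - 2 * m = i - 2" using bounds by linarith+
        ultimately have "fps_nth (U w * H w ^ m) (i - 2) = 0"
          by (simp only: fps_X_power_mult_nth if_False)
        moreover have "fps_nth (H w) (i - 2) = fps_nth (h w 2) i"
        proof -
          have "Suc (Suc (i - 2)) = i" using bounds(4) by simp
          then show ?thesis by (simp add: H_def)
        qed
        ultimately show "fps_nth (h w 2) i =
            - 1 / of_nat m * (fps_nth (U w * H w ^ m) (i - 2) - of_nat m * fps_nth (H w) (i - 2))"
          using bounds(3) by simp
      qed
    qed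
  qed
  then have ep: "algc N (\<lambda>w. even_power (h w) m)" for N m
    by (intro even_power_alg h0) (auto simp: alg_coeffs_def)
  have \<epsilon>: "\<epsilon> \<in> alg"
  proof (cases "\<mu> = 1")
    case True then show ?thesis unfolding \<epsilon>_def by (simp add: poly_alg.const)
  next
    case False then show ?thesis unfolding \<epsilon>_def using ep[of "2 * g - 1" \<mu>] by (simp add: alg_coeffs_def)
  qed
  show ?thesis
  proof (cases "r = 0 \<or> r = 2")
    case True
    then show ?thesis using h2 h0 by (auto intro!: poly_alg.mult \<epsilon> simp: alg_coeffs_def)
  next
    case False
    then have r': "r \<in> P - {0, 2}" using r by blast
    have even_coeff: "(\<lambda>w. fps_nth (h w r) (2 * m)) \<in> alg" if "\<not> (r < 2 * \<mu> \<and> m = \<mu>)" for m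
      using r' F that by (intro coeff_alg) (auto simp: odd_positions_def)
    have "(\<lambda>w. \<epsilon> w * c w r m) \<in> alg" if "m < g" for m
    proof (rule scaled_expansion_alg[OF ep r' order_refl _ that])
      fix m assume m: "m < g"
      show "(\<lambda>w. \<epsilon> w * fps_nth (h w r) (2 * m)) \<in> alg \<or> (\<lambda>w. \<epsilon> w * c w r m) \<in> alg"
      proof (cases "r < 2 * \<mu> \<and> m = \<mu>")
        case False
        then show ?thesis using poly_alg.mult[OF \<epsilon> even_coeff] by blast
      next
        case True
        have c_low: "(\<lambda>w. 1 * c w r k) \<in> alg" if "k < \<mu>" for k
        proof (rule scaled_expansion_alg[OF ep r' _ _ that])
          fix m assume "m < \<mu>"
          then show "(\<lambda>w. 1 * fps_nth (h w r) (2 * m)) \<in> alg \<or> (\<lambda>w. 1 * c w r m) \<in> alg"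
            using even_coeff[of m] by simp
        qed (use \<mu> in auto)
        have "\<mu> \<noteq> 1" using True Pge[OF r'] by auto
        have "(\<lambda>w. - 1 * (\<Sum>k<\<mu>. c w r k * fps_nth (even_power (h w) k) (2 * g - 1))) \<in> alg"
          using c_low ep[of "2 * g - 1"]
          by (intro poly_alg_cmult poly_alg_sum poly_alg.mult) (auto simp: alg_coeffs_def)
        then have "(\<lambda>w. \<epsilon> w * c w r m) \<in> alg"
        proof (rule poly_alg.cong)
          fix w assume w: "w \<in> W"
          have "2 * g - 1 > d" using d by simp
          then have "fps_nth (h w r) (2 * g - 1) = 0" using basis_nth(2)[OF w r] by blast
          then have "0 = (\<Sum>k<g. c w r k * fps_nth (even_power (h w) k) (2 * g - 1))"
            using expansion[OF w] r' \<mu> unfolding even_expansion_def by auto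
          also have "\<dots> = (\<Sum>k<Suc \<mu>. c w r k * fps_nth (even_power (h w) k) (2 * g - 1))"
            using \<mu> zero[OF _ _ w] by (intro sum.mono_neutral_right) auto
          finally show "\<epsilon> w * c w r m =
              - 1 * (\<Sum>k<\<mu>. c w r k * fps_nth (even_power (h w) k) (2 * g - 1))"
            using True \<open>\<mu> \<noteq> 1\<close> by (simp add: \<epsilon>_def eq_neg_iff_add_eq_0 mult.commute add.commute)
        qed
        then show ?thesis by blast
      qed
    qed
    then show ?thesis
    proof (rule scaled_coeff_alg[OF ep r' \<epsilon>])
      fix j assume "2 * g \<le> j" "(r, j) \<in> free_positions d P"
      then show "(r, j) \<in> F" using d by (auto simp: free_positions_def)
    qed
  qed
qed

end

section \<open>Counting parameters\<close>

lemma growth_le_subset: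
  assumes "growth_le I W D" "V \<subseteq> W" shows "growth_le I V D"
proof -
  obtain C where C: "\<And>l. \<exists>K \<phi>. K \<le> C * (l + 1) ^ D \<and>
     (\<forall>F\<in>forms I l. \<exists>c. \<forall>w\<in>W. F w = (\<Sum>k<K. c k * \<phi> k w))"
    using assms(1) unfolding growth_le_def by blast
  have "\<exists>K \<phi>. K \<le> C * (l + 1) ^ D \<and>
     (\<forall>F\<in>forms I l. \<exists>c. \<forall>w\<in>V. F w = (\<Sum>k<K. c k * \<phi> k w))" for l
  proof -
    obtain K \<phi> where K: "K \<le> C * (l + 1) ^ D"
      "\<forall>F\<in>forms I l. \<exists>c. \<forall>w\<in>W. F w = (\<Sum>k<K. c k * \<phi> k w)" using C by metis
    have "\<exists>c. \<forall>w\<in>V. F w = (\<Sum>k<K. c k * \<phi> k w)" if "F \<in> forms I l" for F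
      using K(2) that assms(2) by blast
    then show ?thesis using K(1) by blast
  qed
  then show ?thesis unfolding growth_le_def by blast
qed

text \<open>Expressing a form by its expansion at the cusp: if \<open>x\<^sub>l\<close> is the coefficient of \<open>t ^ l\<close> in the expansion
  of a form at the point \<open>(1 : \<tau>)\<close>, or at \<open>(0 : 1)\<close> if \<open>at_inf\<close> holds, then
  \<open>\<Sum>l\<le>d. shift_coeff at_inf d \<tau> j l * x\<^sub>l\<close> is the coefficient of \<open>u\<^sub>0\<^sup>d\<^sup>-\<^sup>j u\<^sub>1\<^sup>j\<close>.\<close>

definition shift_coeff :: "bool \<Rightarrow> nat \<Rightarrow> complex \<Rightarrow> nat \<Rightarrow> nat \<Rightarrow> complex" where
  "shift_coeff at_inf d \<tau> j l =
     (if at_inf then if l = d - j then 1 else 0 else coeff ([:-\<tau>, 1:] ^ l) j)"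

lemma shift_coeff_alg:
  assumes "\<tau> \<in> poly_alg W y J"
  shows "(\<lambda>w. shift_coeff at_inf d (\<tau> w) j l) \<in> poly_alg W y J"
proof (cases at_inf)
  case True
  then show ?thesis unfolding shift_coeff_def by (simp add: poly_alg.const)
next
  case False
  have "(\<lambda>w. coeff ([:-\<tau> w, 1:] ^ l) j) \<in> poly_alg W y J"
  proof (induction l arbitrary: j)
    case 0
    show ?case by (simp add: poly_alg.const)
  next
    case (Suc l)
    have rec: "coeff ([:-t, 1:] ^ Suc l) j =
        (- 1 * t) * coeff ([:-t, 1:] ^ l) j + (if j = 0 then 0 else coeff ([:-t, 1:] ^ l) (j - 1))" for t :: complex
      by (cases j) (simp_all add: algebra_simps)
    have "(\<lambda>w. if j = 0 then 0 else coeff ([:-\<tau> w, 1:] ^ l) (j - 1)) \<in> poly_alg W y J"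
      using Suc by (cases "j = 0") (auto intro: poly_alg.const)
    then show ?case unfolding rec
      by (intro poly_alg.add poly_alg.mult poly_alg.const assms Suc)
  qed
  then show ?thesis using False by (simp add: shift_coeff_def)
qed

text \<open>The rows of the coefficient matrix \<open>a\<close>, expanded at the cusp, have the coordinates \<open>G\<close> with respect
  to the reduced basis \<open>h\<close>.\<close>

definition cusp_normal_form ::
    "nat \<Rightarrow> nat \<Rightarrow> nat \<Rightarrow> nat set \<Rightarrow> bool \<Rightarrow> (nat \<times> nat \<Rightarrow> complex) \<Rightarrow> complex \<Rightarrow>
     (nat \<Rightarrow> nat \<Rightarrow> complex) \<Rightarrow> (nat \<Rightarrow> complex fps) \<Rightarrow> (nat \<Rightarrow> nat \<Rightarrow> complex) \<Rightarrow> bool" where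
  "cusp_normal_form n d g P at_inf a \<tau> G h c \<longleftrightarrow> reduced_basis d P h \<and> even_expansion g P h c \<and>
     (\<forall>i\<le>n. \<forall>j\<le>d. a (i, j) =
        (\<Sum>l\<le>d. shift_coeff at_inf d \<tau> j l * (\<Sum>r\<in>P. G i r * fps_nth (h r) l)))"

text \<open>The common denominator \<open>\<epsilon>\<close> is absorbed by the functions in which the coefficient vector is linear:
  \<open>G a i r * h a r = (G a i r / \<epsilon> a) * (\<epsilon> a * h a r)\<close>.\<close>

lemma growth_le_normal_forms:
  fixes W :: "(nat \<times> nat \<Rightarrow> complex) set"
  assumes fam: "cusp_family W d g P h c" and F: "finite F"
    and G: "\<And>a i j. a \<in> W \<Longrightarrow> i \<le> n \<Longrightarrow> j \<le> d \<Longrightarrow> a (i, j) =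
        (\<Sum>l\<le>d. shift_coeff at_inf d (\<tau> a) j l * (\<Sum>r\<in>P. G a i r * fps_nth (h a r) l))"
    and \<epsilon>: "\<And>a. a \<in> W \<Longrightarrow> \<epsilon> a \<noteq> 0"
    and alg: "\<And>r l. r \<in> P \<Longrightarrow> (\<lambda>a. \<epsilon> a * fps_nth (h a r) l) \<in>
        poly_alg W (cusp_family.param \<tau> h) (insert None (Some ` F))"
  shows "growth_le (coeff_index n d) W ((n + 1) * card P + card F)"
proof -
  interpret cusp_family W d g P \<tau> h c F by (rule fam)
  have finP: "finite P" using P_le finite_subset by blast
  let ?Q = "{..n} \<times> P"
  have "growth_le (coeff_index n d) W (card ?Q - 1 + card (insert None (Some ` F)))"
  proof (rule growth_le_parameters[where y = param and G = "\<lambda>(i, r) a. G a i r / \<epsilon> a"])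
    fix p assume "p \<in> coeff_index n d"
    then obtain i j where p: "p = (i, j)" "i \<le> n" "j \<le> d" by (auto simp: coeff_index_def)
    define A where "A = (\<lambda>(i', r) a. if i' = i then
        (\<Sum>l\<le>d. shift_coeff at_inf d (\<tau> a) j l * (\<epsilon> a * fps_nth (h a r) l)) else 0)"
    have "A q \<in> alg" if q: "q \<in> ?Q" for q
    proof -
      obtain i' r where q': "q = (i', r)" "r \<in> P" using q by auto
      have "(\<lambda>a. \<Sum>l\<le>d. shift_coeff at_inf d (\<tau> a) j l * (\<epsilon> a * fps_nth (h a r) l)) \<in> alg"
        by (intro poly_alg_sum, rule poly_alg.mult[OF shift_coeff_alg[OF tau_alg] assms(5)[OF q'(2)]])
      then show ?thesis unfolding A_def q' by (cases "i' = i") (auto intro: poly_alg.const)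
    qed
    moreover have "a p = (\<Sum>q\<in>?Q. (case q of (i, r) \<Rightarrow> \<lambda>a. G a i r / \<epsilon> a) a * A q a)" if a: "a \<in> W" for a
    proof -
      have "(\<Sum>q\<in>?Q. (case q of (i, r) \<Rightarrow> \<lambda>a. G a i r / \<epsilon> a) a * A q a) =
          (\<Sum>i'\<le>n. \<Sum>r\<in>P. G a i' r / \<epsilon> a * A (i', r) a)"
        using sum.cartesian_product[where g = "\<lambda>i' r. G a i' r / \<epsilon> a * A (i', r) a" and A = "{..n}" and B = P]
        by (simp add: case_prod_unfold)
      also have "\<dots> = (\<Sum>i'\<in>{i}. \<Sum>r\<in>P. G a i' r / \<epsilon> a * A (i', r) a)"
        using p(2) by (intro sum.mono_neutral_right) (auto simp: A_def)
      also have "\<dots> = (\<Sum>r\<in>P. \<Sum>l\<le>d. shift_coeff at_inf d (\<tau> a) j l * (G a i r * fps_nth (h a r) l))"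
        using \<epsilon>[OF a] by (simp add: A_def sum_distrib_left mult_ac)
      also have "\<dots> = a p"
        unfolding p(1) G[OF a p(2,3)] sum_distrib_left by (rule sum.swap)
      finally show ?thesis by simp
    qed
    ultimately show "\<exists>A. (\<forall>q\<in>?Q. A q \<in> alg) \<and>
        (\<forall>w\<in>W. w p = (\<Sum>q\<in>?Q. (case q of (i, r) \<Rightarrow> \<lambda>a. G a i r / \<epsilon> a) w * A q w))"
      by blast
  qed (use finP F P0 in \<open>auto simp: coeff_index_def\<close>)
  moreover have "card (insert None (Some ` F)) = Suc (card F)"
    using F by (simp add: card_image)
  moreover have "card ?Q = (n + 1) * card P" by (simp add: card_cartesian_product)
  moreover have "(n + 1) * card P \<ge> 1" using finP P0 by (auto simp: card_gt_0_iff Suc_le_eq)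
  ultimately have "card ?Q - 1 + card (insert None (Some ` F)) = (n + 1) * card P + card F" by linarith
  with \<open>growth_le _ W _\<close> show ?thesis by (simp only:)
qed

text \<open>The lower bound for the codimension of the cuspidal locus with vanishing orders \<open>P\<close> that the parameter
  count yields.\<close>

definition cusp_excess :: "nat \<Rightarrow> nat set \<Rightarrow> real" where
  "cusp_excess g P = (\<Sum>r\<in>P - {0, 2}.
     real r - real (card {s \<in> P. s < r}) + max 0 (real g - real r / 2))"

lemma card_free_positions:
  assumes P: "P \<subseteq> {..d}" and c: "card P = n + 1"
  shows "real (card (free_positions d P)) =
    (\<Sum>r\<in>P. real d - real n - (real r - real (card {s \<in> P. s < r})))"
proof -
  have finP: "finite P" using P finite_subset by blast
  have "free_positions d P = Sigma P (\<lambda>r. {r<..d} - {s \<in> P. r < s})"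
    using P by (auto simp: free_positions_def)
  then have "card (free_positions d P) = (\<Sum>r\<in>P. card ({r<..d} - {s \<in> P. r < s}))"
    using finP by (simp add: card_SigmaI)
  moreover have "real (card ({r<..d} - {s \<in> P. r < s})) =
      real d - real n - (real r - real (card {s \<in> P. s < r}))" if r: "r \<in> P" for r
  proof -
    have "P = {s \<in> P. s < r} \<union> insert r {s \<in> P. r < s}" using r by auto
    then have "card P = card ({s \<in> P. s < r} \<union> insert r {s \<in> P. r < s})" by simp
    also have "\<dots> = card {s \<in> P. s < r} + card (insert r {s \<in> P. r < s})"
      using finP by (intro card_Un_disjoint) auto
    also have "card (insert r {s \<in> P. r < s}) = Suc (card {s \<in> P. r < s})"
      using finP by simp
    finally have n: "n = card {s \<in> P. s < r} + card {s \<in> P. r < s}" using c by simp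
    have "card ({r<..d} - {s \<in> P. r < s}) = card {r<..d} - card {s \<in> P. r < s}"
      using P finP by (intro card_Diff_subset) auto
    moreover have "card {s \<in> P. r < s} \<le> card {r<..d}" using P by (intro card_mono) auto
    moreover have "r \<le> d" using P r by auto
    ultimately show ?thesis using n by simp
  qed
  ultimately show ?thesis by simp
qed

text \<open>Without removals there are \<open>N + 1 - (\<Sum>r\<in>P. r - card {s \<in> P. s < r})\<close> parameters. The summand of
  \<open>r = 2\<close> is \<open>1\<close>, as \<open>1 \<notin> P\<close>; it compensates for the free position of the cusp.\<close>

lemma parameter_count:
  assumes P: "P \<subseteq> {..d}" "card P = n + 1" "0 \<in> P" "2 \<in> P" "1 \<notin> P"
    and R: "R \<subseteq> free_positions d P" "(\<Sum>r\<in>P - {0, 2}. max 0 (real g - real r / 2)) \<le> real (card R)"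
  shows "real ((n + 1) * card P + card (free_positions d P - R))
      \<le> real ((n + 1) * (d + 1) - 1) - cusp_excess g P"
proof -
  have finP: "finite P" using P finite_subset by blast
  define \<phi> where "\<phi> r = real r - real (card {s \<in> P. s < r})" for r
  have "{s \<in> P. s < 2} = {0}"
  proof -
    have "s = 0" if "s \<in> P" "s < 2" for s using that P(5) by (cases s) auto
    then show ?thesis using P(3) by auto
  qed
  then have "\<phi> 2 = 1" by (simp add: \<phi>_def)
  moreover have "\<phi> 0 = 0" by (simp add: \<phi>_def)
  moreover have "P - {0} - {2} = P - {0, 2}" by auto
  ultimately have sum: "(\<Sum>r\<in>P. \<phi> r) = 1 + (\<Sum>r\<in>P - {0, 2}. \<phi> r)"
    using finP P(3,4) by (simp add: sum.remove[of P 0] sum.remove[of "P - {0}" 2])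
  have excess: "cusp_excess g P = (\<Sum>r\<in>P - {0, 2}. \<phi> r) + (\<Sum>r\<in>P - {0, 2}. max 0 (real g - real r / 2))"
    by (simp add: cusp_excess_def \<phi>_def sum.distrib)
  have "finite (free_positions d P)"
    by (rule finite_subset[of _ "P \<times> {..d}"]) (use finP in \<open>auto simp: free_positions_def\<close>)
  then have "card (free_positions d P - R) = card (free_positions d P) - card R"
    "card R \<le> card (free_positions d P)"
    using R(1) by (auto intro: card_Diff_subset card_mono finite_subset)
  then have "real (card (free_positions d P - R)) = real (card (free_positions d P)) - real (card R)"
    by simp
  also have "real (card (free_positions d P)) = (real n + 1) * (real d - real n) - (\<Sum>r\<in>P. \<phi> r)"
    unfolding card_free_positions[OF P(1,2)] \<phi>_def[symmetric]
    by (simp add: sum_subtractf sum.distrib P(2) algebra_simps)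
  finally have "real (card (free_positions d P - R)) \<le>
      (real n + 1) * (real d - real n) - 1 - cusp_excess g P"
    using sum excess R(2) by simp
  moreover have "real ((n + 1) * (d + 1) - 1) = (real n + 1) * (real d + 1) - 1"
    by (simp add: of_nat_diff algebra_simps)
  ultimately show ?thesis using P(2) by (simp add: algebra_simps)
qed

lemma card_odd_between:
  assumes "even r" shows "card {j. r < j \<and> odd j \<and> j < 2 * k} = k - r div 2"
proof -
  obtain m where m: "r = 2 * m" using assms by (rule evenE)
  have "{j. r < j \<and> odd j \<and> j < 2 * k} = (\<lambda>i. 2 * i + 1) ` {m..<k}"
  proof (intro equalityI subsetI)
    fix j assume j: "j \<in> {j. r < j \<and> odd j \<and> j < 2 * k}"
    then obtain i where "j = 2 * i + 1" by (auto elim: oddE)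
    then show "j \<in> (\<lambda>i. 2 * i + 1) ` {m..<k}" using j m by (intro image_eqI[of _ _ i]) auto
  qed (use m in auto)
  moreover have "inj_on (\<lambda>i. 2 * i + 1) {m..<k}" for m :: nat by (auto simp: inj_on_def)
  ultimately show ?thesis using m by (simp add: card_image)
qed

lemma card_odd_positions:
  assumes "finite P"
  shows "card (odd_positions d g P) = (\<Sum>r\<in>P - {0, 2}. card {j. r < j \<and> odd j \<and> j < 2 * g \<and> j \<le> d})"
proof -
  have "odd_positions d g P = Sigma (P - {0, 2}) (\<lambda>r. {j. r < j \<and> odd j \<and> j < 2 * g \<and> j \<le> d})"
    by (auto simp: odd_positions_def)
  then show ?thesis using assms by (simp add: card_SigmaI)
qed

lemma growth_le_regular:
  assumes P: "P \<subseteq> {..d}" "card P = n + 1" "0 \<in> P" "2 \<in> P" and g: "g \<ge> 1"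
    and odd: "\<And>r. r \<in> P \<Longrightarrow> odd r \<Longrightarrow> r \<ge> 2 * g"
    and d: "d + 1 \<ge> 2 * g"
  shows "\<exists>D. real D \<le> real ((n + 1) * (d + 1) - 1) - cusp_excess g P \<and>
      growth_le (coeff_index n d) {a. \<exists>\<tau> G h c. cusp_normal_form n d g P at_inf a \<tau> G h c} D"
proof -
  let ?W = "{a. \<exists>\<tau> G h c. cusp_normal_form n d g P at_inf a \<tau> G h c}"
  have "\<forall>a\<in>?W. \<exists>\<tau> G h c. cusp_normal_form n d g P at_inf a \<tau> G h c" by blast
  then obtain \<tau> G h c where nf: "\<And>a. a \<in> ?W \<Longrightarrow> cusp_normal_form n d g P at_inf a (\<tau> a) (G a) (h a) (c a)"
    by metis
  have finP: "finite P" using P finite_subset by blast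
  let ?F = "free_positions d P - odd_positions d g P"
  interpret cusp_family ?W d g P \<tau> h c ?F
    by unfold_locales (use P odd nf in \<open>auto simp: cusp_normal_form_def\<close>)
  have "finite (free_positions d P)"
    by (rule finite_subset[of _ "P \<times> {..d}"]) (use finP in \<open>auto simp: free_positions_def\<close>)
  then have finF: "finite ?F" by blast
  have "growth_le (coeff_index n d) ?W ((n + 1) * card P + card ?F)"
  proof (rule growth_le_normal_forms[OF cusp_family_axioms finF, where \<epsilon> = "\<lambda>_. 1" and G = G])
    show "a (i, j) = (\<Sum>l\<le>d. shift_coeff at_inf d (\<tau> a) j l * (\<Sum>r\<in>P. G a i r * fps_nth (h a r) l))"
      if "a \<in> ?W" "i \<le> n" "j \<le> d" for a i j
      using nf[OF that(1)] that(2,3) unfolding cusp_normal_form_def by blast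
    show "(\<lambda>a. 1 * fps_nth (h a r) l) \<in> alg" if "r \<in> P" for r l
      using coeffs_alg_regular[OF order_refl that] by simp
  qed simp
  moreover have "real ((n + 1) * card P + card ?F) \<le> real ((n + 1) * (d + 1) - 1) - cusp_excess g P"
  proof (rule parameter_count[OF P])
    show "1 \<notin> P" using odd[of 1] g by auto
    show "odd_positions d g P \<subseteq> free_positions d P"
      using odd by (fastforce simp: odd_positions_def free_positions_def)
    have "max 0 (real g - real r / 2) \<le> real (card {j. r < j \<and> odd j \<and> j < 2 * g \<and> j \<le> d})"
      if r: "r \<in> P" for r
    proof (cases "even r")
      case True
      have "{j. r < j \<and> odd j \<and> j < 2 * g \<and> j \<le> d} = {j. r < j \<and> odd j \<and> j < 2 * g}" using d by auto
      then show ?thesis using card_odd_between[OF True, of g] True by (auto elim!: evenE)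
    next
      case False
      then show ?thesis using odd[OF r] by simp
    qed
    then show "(\<Sum>r\<in>P - {0, 2}. max 0 (real g - real r / 2)) \<le> real (card (odd_positions d g P))"
      unfolding card_odd_positions[OF finP] of_nat_sum by (intro sum_mono) auto
  qed
  ultimately show ?thesis by blast
qed

text \<open>Removing the odd positions saves \<open>g - 1 - r / 2\<close> parameters for \<open>r\<close>, as \<open>2 * g - 1\<close> exceeds \<open>d\<close>. The
  sets \<open>A\<close> and \<open>B\<close> supply the missing one.\<close>

lemma growth_le_special:
  assumes P: "P \<subseteq> {..d}" "card P = n + 1" "0 \<in> P" "2 \<in> P"
    and odd: "\<And>r. r \<in> P \<Longrightarrow> odd r \<Longrightarrow> r \<ge> 2 * g"
    and d: "d + 2 = 2 * g" and \<mu>: "1 \<le> \<mu>" "\<mu> < g" "2 * \<mu> \<in> P \<Longrightarrow> \<mu> = 1"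
  shows "\<exists>D. real D \<le> real ((n + 1) * (d + 1) - 1) - cusp_excess g P \<and>
      growth_le (coeff_index n d) {a. \<exists>\<tau> G h c. cusp_normal_form n d g P at_inf a \<tau> G h c \<and>
      (\<forall>m. \<mu> < m \<and> m < g \<longrightarrow> fps_nth (even_power h m) (2 * g - 1) = 0) \<and>
      (\<mu> \<noteq> 1 \<longrightarrow> fps_nth (even_power h \<mu>) (2 * g - 1) \<noteq> 0)} D"
    (is "\<exists>D. _ D \<and> growth_le _ ?W D")
proof -
  define R where "R a \<tau> G h c \<longleftrightarrow> cusp_normal_form n d g P at_inf a \<tau> G h c \<and>
      (\<forall>m. \<mu> < m \<and> m < g \<longrightarrow> fps_nth (even_power h m) (2 * g - 1) = 0) \<and>
      (\<mu> \<noteq> 1 \<longrightarrow> fps_nth (even_power h \<mu>) (2 * g - 1) \<noteq> 0)" for a \<tau> G h c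
  define W where "W = ?W"
  have "\<forall>a\<in>W. \<exists>\<tau> G h c. R a \<tau> G h c" unfolding R_def W_def by blast
  then obtain \<tau> G h c where R: "\<And>a. a \<in> W \<Longrightarrow> R a (\<tau> a) (G a) (h a) (c a)"
    by metis
  have nf: "\<And>a. a \<in> W \<Longrightarrow> cusp_normal_form n d g P at_inf a (\<tau> a) (G a) (h a) (c a)"
    and zero: "\<And>a m. a \<in> W \<Longrightarrow> \<mu> < m \<and> m < g \<Longrightarrow> fps_nth (even_power (h a) m) (2 * g - 1) = 0"
    and nonzero: "\<And>a. a \<in> W \<Longrightarrow> \<mu> \<noteq> 1 \<Longrightarrow> fps_nth (even_power (h a) \<mu>) (2 * g - 1) \<noteq> 0"
    using R unfolding R_def by blast+
  have finP: "finite P" using P finite_subset by blast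
  define A where "A = (\<lambda>r. (r, 2 * \<mu>)) ` {r \<in> P - {0, 2}. r < 2 * \<mu>}"
  define B where "B = (\<lambda>r. (2::nat, 2 * g + 1 - r)) ` {r \<in> P - {0, 2}. 2 * \<mu> < r}"
  let ?O = "odd_positions d g P"
  let ?F = "free_positions d P - (?O \<union> A \<union> B)"
  interpret cusp_family W d g P \<tau> h c ?F
    by unfold_locales (use P odd nf in \<open>auto simp: cusp_normal_form_def\<close>)
  have finfree: "finite (free_positions d P)"
    by (rule finite_subset[of _ "P \<times> {..d}"]) (use finP in \<open>auto simp: free_positions_def\<close>)
  then have finF: "finite ?F" by blast
  have P_even: "even r" if "r \<in> P" for r
    using odd[OF that] P(1) that d by (cases "even r") auto
  have Pge: "r \<ge> 4" if "r \<in> P - {0, 2}" for r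
  proof -
    have "even r" using P_even that by blast
    then obtain k where "r = 2 * k" by (rule evenE)
    then show ?thesis using that by (cases "k = 0"; cases "k = 1") auto
  qed
  have Ple: "r + 2 \<le> 2 * g" if "r \<in> P" for r using P(1) that d by auto
  have "growth_le (coeff_index n d) W ((n + 1) * card P + card ?F)"
  proof (rule growth_le_normal_forms[OF cusp_family_axioms finF, where G = G and
      \<epsilon> = "\<lambda>a. if \<mu> = 1 then 1 else fps_nth (even_power (h a) \<mu>) (2 * g - 1)"])
    show "a (i, j) = (\<Sum>l\<le>d. shift_coeff at_inf d (\<tau> a) j l * (\<Sum>r\<in>P. G a i r * fps_nth (h a r) l))"
      if "a \<in> W" "i \<le> n" "j \<le> d" for a i j
      using nf[OF that(1)] that(2,3) unfolding cusp_normal_form_def by blast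
    show "(\<lambda>a. (if \<mu> = 1 then 1 else fps_nth (even_power (h a) \<mu>) (2 * g - 1)) * fps_nth (h a r) l) \<in> alg"
      if "r \<in> P" for r l
      using zero by (intro coeffs_alg_special[OF d \<mu>(1,2) _ _ \<mu>(3) that]) (auto simp: A_def B_def)
  qed (use nonzero in auto)
  moreover have "real ((n + 1) * card P + card ?F) \<le> real ((n + 1) * (d + 1) - 1) - cusp_excess g P"
  proof (rule parameter_count[OF P])
    show "1 \<notin> P" using P_even[of 1] by auto
    have O: "?O \<subseteq> free_positions d P"
      using P_even by (fastforce simp: odd_positions_def free_positions_def)
    have A: "A \<subseteq> free_positions d P"
    proof
      fix p assume "p \<in> A"
      then obtain r where r: "p = (r, 2 * \<mu>)" "r \<in> P - {0, 2}" "r < 2 * \<mu>" by (auto simp: A_def)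
      have "2 * \<mu> \<notin> P" using \<mu>(3) Pge[OF r(2)] r(3) by auto
      then show "p \<in> free_positions d P" using r d \<mu>(2) by (auto simp: free_positions_def)
    qed
    have B: "B \<subseteq> free_positions d P"
    proof
      fix p assume "p \<in> B"
      then obtain r where r: "p = (2, 2 * g + 1 - r)" "r \<in> P - {0, 2}" "2 * \<mu> < r" by (auto simp: B_def)
      have b: "r \<ge> 4" "r + 2 \<le> 2 * g" "even r" using Pge r(2) Ple P_even by auto
      then have "odd (2 * g + 1 - r)" by simp
      then have "2 * g + 1 - r \<notin> P" using P_even by blast
      then show "p \<in> free_positions d P" using r b d P(4) by (auto simp: free_positions_def)
    qed
    show "?O \<union> A \<union> B \<subseteq> free_positions d P" using O A B by blast
    have fin: "finite ?O" "finite A" "finite B"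
      using O A B finfree finite_subset by blast+
    have "card (?O \<union> A \<union> B) = card ?O + card A + card B"
    proof -
      have "?O \<inter> A = {}" by (auto simp: odd_positions_def A_def)
      moreover have "(?O \<union> A) \<inter> B = {}" by (auto simp: odd_positions_def A_def B_def)
      ultimately show ?thesis using fin by (simp add: card_Un_disjoint)
    qed
    also have "card A = card {r \<in> P - {0, 2}. r < 2 * \<mu>}"
      unfolding A_def by (intro card_image) (auto simp: inj_on_def)
    also have "card B = card {r \<in> P - {0, 2}. 2 * \<mu> < r}"
      unfolding B_def
    proof (intro card_image inj_onI)
      fix r s assume "r \<in> {r \<in> P - {0, 2}. 2 * \<mu> < r}" "s \<in> {r \<in> P - {0, 2}. 2 * \<mu> < r}"
        "(2::nat, 2 * g + 1 - r) = (2, 2 * g + 1 - s)"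
      then show "r = s" using Ple[of r] Ple[of s] by auto
    qed
    also have "card ?O = (\<Sum>r\<in>P - {0, 2}. g - 1 - r div 2)"
      unfolding card_odd_positions[OF finP]
    proof (intro sum.cong refl)
      fix r assume "r \<in> P - {0, 2}"
      then have "even r" using P_even by blast
      have "{j. r < j \<and> odd j \<and> j < 2 * g \<and> j \<le> d} = {j. r < j \<and> odd j \<and> j < 2 * (g - 1)}"
      proof -
        have "j < 2 * g \<and> j \<le> d \<longleftrightarrow> j < 2 * (g - 1)" if oddj: "odd j" for j
        proof -
          obtain i where "j = 2 * i + 1" using oddj by (rule oddE)
          then show ?thesis using d by presburger
        qed
        then show ?thesis by blast
      qed
      then show "card {j. r < j \<and> odd j \<and> j < 2 * g \<and> j \<le> d} = g - 1 - r div 2"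
        using card_odd_between[OF \<open>even r\<close>, of "g - 1"] by simp
    qed
    finally have "card (?O \<union> A \<union> B) = (\<Sum>r\<in>P - {0, 2}. g - 1 - r div 2) +
        (card {r \<in> P - {0, 2}. r < 2 * \<mu>} + card {r \<in> P - {0, 2}. 2 * \<mu> < r})" by simp
    also have "card {r \<in> P - {0, 2}. r < 2 * \<mu>} + card {r \<in> P - {0, 2}. 2 * \<mu> < r} = card (P - {0, 2})"
    proof -
      have "2 * \<mu> \<notin> P - {0, 2}" using \<mu>(3) by auto
      then have "r < 2 * \<mu> \<or> 2 * \<mu> < r" if "r \<in> P - {0, 2}" for r
        using that by (metis linorder_neqE_nat)
      then have U: "{r \<in> P - {0, 2}. r < 2 * \<mu>} \<union> {r \<in> P - {0, 2}. 2 * \<mu> < r} = P - {0, 2}"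
        by blast
      have "card ({r \<in> P - {0, 2}. r < 2 * \<mu>} \<union> {r \<in> P - {0, 2}. 2 * \<mu> < r}) =
          card {r \<in> P - {0, 2}. r < 2 * \<mu>} + card {r \<in> P - {0, 2}. 2 * \<mu> < r}"
        using finP by (intro card_Un_disjoint) auto
      then show ?thesis unfolding U by (rule sym)
    qed
    also have "(\<Sum>r\<in>P - {0, 2}. g - 1 - r div 2) + card (P - {0, 2}) =
        (\<Sum>r\<in>P - {0, 2}. (g - 1 - r div 2) + 1)"
      unfolding sum.distrib by simp
    finally have "real (card (?O \<union> A \<union> B)) = (\<Sum>r\<in>P - {0, 2}. real ((g - 1 - r div 2) + 1))"
      by simp
    moreover have "max 0 (real g - real r / 2) \<le> real ((g - 1 - r div 2) + 1)" if "r \<in> P - {0, 2}" for r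
    proof -
      have "even r" using P_even that by blast
      then obtain k where k: "r = 2 * k" by (rule evenE)
      then show ?thesis using Ple[of r] that by (simp add: of_nat_diff)
    qed
    ultimately show "(\<Sum>r\<in>P - {0, 2}. max 0 (real g - real r / 2)) \<le> real (card (?O \<union> A \<union> B))"
      by (simp only:) (intro sum_mono)
  qed
  ultimately show ?thesis unfolding W_def by blast
qed

text \<open>In the case \<open>d = 2 * g - 2\<close> it remains to see that the strata with \<open>2 * \<mu> \<in> P\<close> and \<open>\<mu> \<noteq> 1\<close> are
  empty. For \<open>r = 2 * \<mu>\<close> the expansion of \<open>h r\<close> starts with \<open>c r \<mu> = 1\<close>, so the coefficient of
  \<open>t ^ (2 * g - 1)\<close> in \<open>h r\<close>, which is zero, would be \<open>e \<mu>\<close>.\<close>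

theorem growth_le_cusp_normal_forms:
  assumes P: "P \<subseteq> {..d}" "card P = n + 1" "0 \<in> P" "2 \<in> P" and g: "g \<ge> 1"
    and odd: "\<And>r. r \<in> P \<Longrightarrow> odd r \<Longrightarrow> r \<ge> 2 * g"
    and d: "d > 0" "d + 2 \<ge> 2 * g"
  shows "\<exists>D. real D \<le> real ((n + 1) * (d + 1) - 1) - cusp_excess g P \<and>
      growth_le (coeff_index n d) {a. \<exists>\<tau> G h c. cusp_normal_form n d g P at_inf a \<tau> G h c} D"
proof (cases "d + 1 \<ge> 2 * g")
  case True
  then show ?thesis using growth_le_regular[OF P g odd True] by blast
next
  case False
  then have d2: "d + 2 = 2 * g" using d by linarith
  let ?e = "\<lambda>h m. fps_nth (even_power h m) (2 * g - 1)"
  define W where "W \<mu> = {a. \<exists>\<tau> G h c. cusp_normal_form n d g P at_inf a \<tau> G h c \<and>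
      (\<forall>m. \<mu> < m \<and> m < g \<longrightarrow> ?e h m = 0) \<and> (\<mu> \<noteq> 1 \<longrightarrow> ?e h \<mu> \<noteq> 0)}" for \<mu>
  define T where "T = {\<mu>. 1 \<le> \<mu> \<and> \<mu> < g \<and> (2 * \<mu> \<in> P \<longrightarrow> \<mu> = 1)}"
  define x where "x = real ((n + 1) * (d + 1) - 1) - cusp_excess g P"
  define D where "D = nat \<lfloor>x\<rfloor>"
  have piece: "\<exists>D'. real D' \<le> x \<and> growth_le (coeff_index n d) (W \<mu>) D'" if "\<mu> \<in> T" for \<mu>
    unfolding x_def W_def by (rule growth_le_special[OF P odd d2]) (use that in \<open>auto simp: T_def\<close>)
  have "1 \<in> T" using d d2 by (auto simp: T_def)
  then have "x \<ge> 0" using piece[of 1] of_nat_0_le_iff order_trans by blast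
  then have D: "real D \<le> x" by (simp add: D_def)
  have "finite T" by (rule finite_subset[of _ "{..<g}"]) (auto simp: T_def)
  then have gr: "growth_le (coeff_index n d) (\<Union>\<mu>\<in>T. W \<mu>) D"
  proof (rule growth_le_UN)
    fix \<mu> assume "\<mu> \<in> T"
    then obtain D' where D': "real D' \<le> x" "growth_le (coeff_index n d) (W \<mu>) D'" using piece by blast
    have "D' \<le> D" using D'(1) by (simp add: D_def le_nat_floor)
    then show "growth_le (coeff_index n d) (W \<mu>) D" by (rule growth_le_mono[OF D'(2)])
  qed
  have "{a. \<exists>\<tau> G h c. cusp_normal_form n d g P at_inf a \<tau> G h c} \<subseteq> (\<Union>\<mu>\<in>T. W \<mu>)"
  proof clarify
    fix a \<tau> G h c assume nf: "cusp_normal_form n d g P at_inf a \<tau> G h c"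
    then have rb: "reduced_basis d P h" and ee: "even_expansion g P h c"
      by (auto simp: cusp_normal_form_def)
    define S where "S = {m. 2 \<le> m \<and> m < g \<and> ?e h m \<noteq> 0}"
    have finS: "finite S" by (rule finite_subset[of _ "{..<g}"]) (auto simp: S_def)
    define \<mu> where "\<mu> = Max (insert 1 S)"
    have \<mu>in: "\<mu> \<in> insert 1 S" unfolding \<mu>_def using finS by (intro Max_in) auto
    have \<mu>ge: "m \<le> \<mu>" if "m \<in> insert 1 S" for m
      unfolding \<mu>_def using finS that by (intro Max_ge) auto
    have zero: "?e h m = 0" if "\<mu> < m" "m < g" for m
    proof (rule ccontr)
      assume "?e h m \<noteq> 0"
      moreover have "m \<ge> 2" using \<mu>ge[of 1] that by simp
      ultimately have "m \<in> S" using that by (simp add: S_def)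
      then show False using \<mu>ge[of m] that by simp
    qed
    have nonzero: "?e h \<mu> \<noteq> 0" if "\<mu> \<noteq> 1" using \<mu>in that by (auto simp: S_def)
    have \<mu>g: "\<mu> < g" "1 \<le> \<mu>" using \<mu>in \<mu>ge[of 1] d d2 by (auto simp: S_def)
    have "\<mu> = 1" if \<mu>P: "2 * \<mu> \<in> P"
    proof (rule ccontr)
      assume "\<mu> \<noteq> 1"
      then have r: "2 * \<mu> \<in> P - {0, 2}" using \<mu>P \<mu>g by auto
      note rec = even_expansion_recursion[OF rb ee P(3,4) r]
      have low: "c (2 * \<mu>) m = 0" if "m < \<mu>" for m
        using that
      proof (induction m rule: less_induct)
        case (less m)
        have "fps_nth (h (2 * \<mu>)) (2 * m) = 0"
          using rb \<mu>P less.prems unfolding reduced_basis_def by auto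
        then show ?case using rec[of m] less \<mu>g by simp
      qed
      have "fps_nth (h (2 * \<mu>)) (2 * \<mu>) = 1" using rb \<mu>P unfolding reduced_basis_def by auto
      then have "c (2 * \<mu>) \<mu> = 1" using rec[of \<mu>] low \<mu>g by simp
      have "2 * g - 1 > d" using d2 by simp
      then have "fps_nth (h (2 * \<mu>)) (2 * g - 1) = 0" using rb \<mu>P unfolding reduced_basis_def by blast
      then have "0 = (\<Sum>m<g. c (2 * \<mu>) m * ?e h m)"
        using ee r g unfolding even_expansion_def by auto
      also have "\<dots> = (\<Sum>m\<in>{\<mu>}. c (2 * \<mu>) m * ?e h m)"
        using low zero \<mu>g by (intro sum.mono_neutral_right) (auto simp: neq_iff)
      finally show False using \<open>c (2 * \<mu>) \<mu> = 1\<close> nonzero[OF \<open>\<mu> \<noteq> 1\<close>] by simp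
    qed
    then have "\<mu> \<in> T" using \<mu>g by (simp add: T_def)
    moreover have "a \<in> W \<mu>" unfolding W_def using nf zero nonzero by blast
    ultimately show "a \<in> (\<Union>\<mu>\<in>T. W \<mu>)" by blast
  qed
  from growth_le_subset[OF gr this] D show ?thesis unfolding x_def by blast
qed

section \<open>The local ring of a hyperelliptic cusp\<close>

lemma fps_mult_nth_cong:
  assumes "\<And>j. j < N \<Longrightarrow> fps_nth a j = fps_nth b j" "\<And>j. j < N \<Longrightarrow> fps_nth c j = fps_nth d j" "j < N"
  shows "fps_nth (a * c) j = fps_nth (b * d) j"
  unfolding fps_mult_nth using assms by (intro sum.cong refl) auto

text \<open>The polynomials in the series \<open>f i\<close>. Their closure under products is immediate, whereas
  for the power series in the \<open>f i\<close>, which define the value semigroup, it would need a Cauchy product.\<close>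

inductive_set monomial_sums :: "nat set \<Rightarrow> (nat \<Rightarrow> complex fps) \<Rightarrow> complex fps set"
  for I :: "nat set" and f :: "nat \<Rightarrow> complex fps" where
  monomial: "fps_const c * (\<Prod>i\<in>I. f i ^ \<alpha> i) \<in> monomial_sums I f"
| add: "x \<in> monomial_sums I f \<Longrightarrow> y \<in> monomial_sums I f \<Longrightarrow> x + y \<in> monomial_sums I f"

lemma monomial_sums_mult:
  assumes "x \<in> monomial_sums I f" "y \<in> monomial_sums I f"
  shows "x * y \<in> monomial_sums I f"
  using assms(1)
proof induction
  case (monomial c \<alpha>)
  from assms(2) show ?case
  proof induction
    case (monomial c' \<beta>)
    have "fps_const c * (\<Prod>i\<in>I. f i ^ \<alpha> i) * (fps_const c' * (\<Prod>i\<in>I. f i ^ \<beta> i)) =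
        fps_const (c * c') * (\<Prod>i\<in>I. f i ^ (\<alpha> i + \<beta> i))"
      by (simp add: power_add prod.distrib mult_ac flip: fps_const_mult)
    then show ?case by (simp only: monomial_sums.monomial)
  next
    case (add y z)
    then show ?case by (simp only: distrib_left monomial_sums.add)
  qed
next
  case (add x z)
  then show ?case by (simp only: distrib_right monomial_sums.add)
qed

lemma monomial_sums_const: "fps_const c \<in> monomial_sums I f"
  using monomial_sums.monomial[where c = c and I = I and f = f and \<alpha> = "\<lambda>_. 0"] by simp

lemma monomial_sums_gen:
  assumes "finite I" "i \<in> I" shows "f i \<in> monomial_sums I f"
proof -
  have "(\<Prod>k\<in>I. f k ^ (if k = i then 1 else 0)) = f i"
    using assms by (subst prod.remove[OF assms]) (simp add: prod.neutral)
  then show ?thesis using monomial_sums.monomial[where c = 1 and I = I and f = f and \<alpha> = "\<lambda>k. if k = i then 1 else 0"] by simp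
qed

lemma prod_power_nth_zero:
  assumes "finite I" "\<And>i. i \<in> I \<Longrightarrow> fps_nth (f i) 0 = (0::complex)" "m < (\<Sum>i\<in>I. \<alpha> i)"
  shows "fps_nth (\<Prod>i\<in>I. f i ^ \<alpha> i) m = 0"
proof -
  have "f i = fps_X * fps_shift 1 (f i)" if "i \<in> I" for i
    using assms(2)[OF that] by (intro fps_ext) (simp add: fps_X_mult_nth fps_shift_def)
  then have "(\<Prod>i\<in>I. f i ^ \<alpha> i) = (\<Prod>i\<in>I. fps_X ^ \<alpha> i * fps_shift 1 (f i) ^ \<alpha> i)"
    by (intro prod.cong refl) (metis power_mult_distrib)
  also have "\<dots> = fps_X ^ (\<Sum>i\<in>I. \<alpha> i) * (\<Prod>i\<in>I. fps_shift 1 (f i) ^ \<alpha> i)"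
    by (simp add: prod.distrib power_sum)
  finally show ?thesis using assms(3) by (simp add: fps_X_power_mult_nth)
qed

lemma monomial_sums_range:
  assumes fin: "finite I" and f0: "\<And>i. i \<in> I \<Longrightarrow> fps_nth (f i) 0 = 0"
    and x: "x \<in> monomial_sums I f"
  shows "x \<in> range (fps_substitute I f)"
  using x
proof induction
  case (monomial c \<alpha>)
  define \<beta> where "\<beta> = (\<lambda>i. if i \<in> I then \<alpha> i else 0)"
  have eq: "(\<Prod>i\<in>I. f i ^ \<alpha> i) = (\<Prod>i\<in>I. f i ^ \<beta> i)" by (intro prod.cong) (auto simp: \<beta>_def)
  have "fps_substitute I f (\<lambda>\<gamma>. if \<gamma> = \<beta> then c else 0) = fps_const c * (\<Prod>i\<in>I. f i ^ \<beta> i)"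
  proof (rule fps_ext)
    fix m :: nat
    let ?E = "{\<gamma>. (\<forall>i. i \<notin> I \<longrightarrow> \<gamma> i = 0) \<and> (\<Sum>i\<in>I. \<gamma> i) \<le> m}"
    have "?E \<subseteq> box_exponents I m"
    proof
      fix \<gamma> assume g: "\<gamma> \<in> ?E"
      have "\<gamma> i \<le> m" if "i \<in> I" for i
        using member_le_sum[OF that, of \<gamma>] fin g by auto
      then show "\<gamma> \<in> box_exponents I m" using g by (auto simp: box_exponents_def)
    qed
    then have finE: "finite ?E" using box_exponents_card(1)[OF fin] finite_subset by blast
    have "fps_nth (fps_substitute I f (\<lambda>\<gamma>. if \<gamma> = \<beta> then c else 0)) m =
        (\<Sum>\<gamma>\<in>?E. if \<gamma> = \<beta> then c * fps_nth (\<Prod>i\<in>I. f i ^ \<beta> i) m else 0)"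
      unfolding fps_substitute_def fps_nth_Abs_fps by (intro sum.cong) auto
    also have "\<dots> = (if \<beta> \<in> ?E then c * fps_nth (\<Prod>i\<in>I. f i ^ \<beta> i) m else 0)"
      using finE by (simp add: sum.delta')
    also have "\<dots> = c * fps_nth (\<Prod>i\<in>I. f i ^ \<beta> i) m"
    proof (cases "\<beta> \<in> ?E")
      case False
      then have "m < (\<Sum>i\<in>I. \<beta> i)" by (auto simp: \<beta>_def)
      then show ?thesis using prod_power_nth_zero[of I f m \<beta>, OF fin f0] False by simp
    qed simp
    finally show "fps_nth (fps_substitute I f (\<lambda>\<gamma>. if \<gamma> = \<beta> then c else 0)) m =
        fps_nth (fps_const c * (\<Prod>i\<in>I. f i ^ \<beta> i)) m" by simp
  qed
  then show ?case
    unfolding eq by (intro range_eqI[where x = "\<lambda>\<gamma>. if \<gamma> = \<beta> then c else 0"]) simp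
next
  case (add x y)
  then obtain G H where "x = fps_substitute I f G" "y = fps_substitute I f H" by blast
  then have "x + y = fps_substitute I f (\<lambda>\<alpha>. G \<alpha> + H \<alpha>)"
    by (intro fps_ext) (simp add: fps_substitute_def distrib_right sum.distrib)
  then show ?case by blast
qed

text \<open>What the value semigroup contributes, apart from an element of order \<open>2\<close>: the germs lie in a ring of
  power series that is closed under inverses of units and has no elements of odd order below \<open>2 * g\<close>.\<close>

definition even_order_ring :: "nat \<Rightarrow> complex fps set \<Rightarrow> bool" where
  "even_order_ring g T \<longleftrightarrow> (\<forall>c. fps_const c \<in> T) \<and> (\<forall>x\<in>T. \<forall>y\<in>T. x + y \<in> T) \<and>
     (\<forall>x\<in>T. \<forall>y\<in>T. x * y \<in> T) \<and> (\<forall>x\<in>T. fps_nth x 0 \<noteq> 0 \<longrightarrow> inverse x \<in> T) \<and>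
     (\<forall>x\<in>T. x \<noteq> 0 \<longrightarrow> subdegree x < 2 * g \<longrightarrow> even (subdegree x))"

lemma even_order_ringD:
  assumes "even_order_ring g T"
  shows "fps_const c \<in> T"
    and "x \<in> T \<Longrightarrow> y \<in> T \<Longrightarrow> x + y \<in> T"
    and "x \<in> T \<Longrightarrow> y \<in> T \<Longrightarrow> x * y \<in> T"
    and "x \<in> T \<Longrightarrow> fps_nth x 0 \<noteq> 0 \<Longrightarrow> inverse x \<in> T"
    and "x \<in> T \<Longrightarrow> x \<noteq> 0 \<Longrightarrow> subdegree x < 2 * g \<Longrightarrow> even (subdegree x)"
  using assms[unfolded even_order_ring_def] by simp_all

lemma hyperelliptic_semigroup_even: "s \<in> hyperelliptic_semigroup g \<Longrightarrow> s < 2 * g \<Longrightarrow> even s"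
proof -
  assume "s \<in> hyperelliptic_semigroup g" and s: "s < 2 * g"
  then obtain a b where ab: "s = 2 * a + (2 * g + 1) * b" by (auto simp: hyperelliptic_semigroup_def)
  then show "even s" using s by (cases b) auto
qed

text \<open>The ring consists of the series that agree modulo \<open>t ^ (2 * g)\<close> with a polynomial in the \<open>f i\<close>. Working
  modulo \<open>t ^ (2 * g)\<close> makes it closed under inverses, by truncated geometric series, without affecting
  orders below \<open>2 * g\<close>.\<close>

lemma even_order_ring_of_semigroup:
  assumes fin: "finite I" and f0: "\<And>i. i \<in> I \<Longrightarrow> fps_nth (f i) 0 = 0"
    and S: "value_semigroup I f = hyperelliptic_semigroup g"
  shows "\<exists>T. even_order_ring g T \<and> (\<forall>i\<in>I. f i \<in> T)"
proof (intro exI conjI ballI)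
  define R where "R = monomial_sums I f"
  define T where "T = {\<phi>. \<exists>\<rho>\<in>R. \<forall>j<2 * g. fps_nth \<phi> j = fps_nth \<rho> j}"
  have RT: "x \<in> T" if "x \<in> R" for x using that by (auto simp: T_def)
  have constT: "fps_const c \<in> T" for c using RT monomial_sums_const by (simp add: R_def)
  have addT: "x + y \<in> T" if xy: "x \<in> T" "y \<in> T" for x y
  proof -
    obtain a b where "a \<in> R" "b \<in> R" "\<forall>j<2 * g. fps_nth x j = fps_nth a j"
      "\<forall>j<2 * g. fps_nth y j = fps_nth b j" using xy by (auto simp: T_def)
    then show ?thesis unfolding T_def R_def by (auto intro!: bexI[of _ "a + b"] monomial_sums.add)
  qed
  have multT: "x * y \<in> T" if xy: "x \<in> T" "y \<in> T" for x y
  proof -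
    obtain a b where ab: "a \<in> R" "b \<in> R" "\<forall>j<2 * g. fps_nth x j = fps_nth a j"
      "\<forall>j<2 * g. fps_nth y j = fps_nth b j" using xy by (auto simp: T_def)
    then have "\<forall>j<2 * g. fps_nth (x * y) j = fps_nth (a * b) j"
      using fps_mult_nth_cong[of "2 * g" x a y b] by blast
    then show ?thesis using ab monomial_sums_mult unfolding T_def R_def by blast
  qed
  have powT: "x ^ k \<in> T" if "x \<in> T" for x k
  proof (induction k)
    case 0 then show ?case using constT[of 1] by simp
  qed (use that multT in simp)
  have sumT: "(\<Sum>k<N. x k) \<in> T" if "\<And>k. x k \<in> T" for x and N :: nat
  proof (induction N)
    case 0 then show ?case using constT[of 0] by simp
  qed (use that addT in simp)
  have invT: "inverse u \<in> T" if u: "u \<in> T" "fps_nth u 0 \<noteq> 0" for u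
  proof -
    define c where "c = 1 / fps_nth u 0"
    define y where "y = 1 - fps_const c * u"
    have "y = fps_const 1 + fps_const (-1) * (fps_const c * u)"
      unfolding y_def by (simp flip: fps_const_neg)
    then have yT: "y \<in> T" using u(1) addT multT constT by metis
    have y0: "fps_nth y 0 = 0" using u(2) by (simp add: y_def c_def)
    let ?s = "fps_const c * (\<Sum>k<2 * g. y ^ k)"
    have "?s \<in> T" using multT constT sumT powT yT by blast
    moreover have "fps_nth (inverse u) j = fps_nth ?s j" if "j < 2 * g" for j
    proof -
      have "u * ?s = (1 - y) * (\<Sum>k<2 * g. y ^ k)" by (simp add: y_def mult_ac)
      also have "\<dots> = 1 - y ^ (2 * g)" by (simp add: one_diff_power_eq)
      finally have "inverse u * (u * ?s) = inverse u - inverse u * y ^ (2 * g)"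
        by (simp add: right_diff_distrib)
      moreover have "inverse u * (u * ?s) = ?s"
        using inverse_mult_eq_1[OF u(2)] by (simp only: mult.assoc[symmetric]) simp
      ultimately have "inverse u = ?s + inverse u * y ^ (2 * g)" by (metis diff_add_cancel)
      moreover have "fps_nth (inverse u * y ^ (2 * g)) j = fps_nth (inverse u * 0) j"
        using startsby_zero_power_prefix[OF y0, of "2 * g"] that
        by (intro fps_mult_nth_cong[of "2 * g"]) auto
      ultimately show ?thesis by (metis add.right_neutral fps_add_nth fps_zero_nth mult_zero_right)
    qed
    ultimately show ?thesis unfolding T_def by auto
  qed
  have evenT: "even (subdegree x)" if x: "x \<in> T" "x \<noteq> 0" "subdegree x < 2 * g" for x
  proof -
    obtain a where a: "a \<in> R" "\<forall>j<2 * g. fps_nth x j = fps_nth a j" using x by (auto simp: T_def)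
    have "subdegree a = subdegree x" using a(2) x by (intro subdegreeI) (auto simp flip: a(2))
    moreover have "a \<noteq> 0" using a(2) x nth_subdegree_nonzero[OF x(2)] by auto
    moreover have "a \<in> range (fps_substitute I f)"
      using a(1) f0 by (intro monomial_sums_range[OF fin]) (auto simp: R_def)
    ultimately have "subdegree x \<in> value_semigroup I f"
      unfolding value_semigroup_def by (metis Diff_iff empty_iff imageI insert_iff)
    then show ?thesis using hyperelliptic_semigroup_even x(3) unfolding S by blast
  qed
  show "even_order_ring g T"
    unfolding even_order_ring_def using constT addT multT invT evenT by blast
  show "f i \<in> T" if "i \<in> I" for i using RT monomial_sums_gen[OF fin that] by (simp add: R_def)
qed

text \<open>Composition with a series of order \<open>1\<close>, that is, a change of the local coordinate, preserves orders.\<close>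

lemma even_order_ring_compose:
  assumes T: "even_order_ring g T" and \<psi>: "fps_nth \<psi> 0 = 0" "fps_nth \<psi> 1 \<noteq> 0"
  shows "even_order_ring g {x. fps_compose x \<psi> \<in> T}"
proof -
  have sd: "subdegree \<psi> = 1" using \<psi> by (intro subdegreeI) auto
  have "fps_compose x \<psi> = 0 \<longleftrightarrow> x = 0" for x
    using fps_compose_eq_0_iff[OF \<psi>(1)] \<psi>(2) by auto
  moreover have "subdegree (fps_compose x \<psi>) = subdegree x" for x
    using subdegree_fps_compose[OF \<psi>(1)] sd by simp
  moreover have "fps_nth (fps_compose x \<psi>) 0 = fps_nth x 0" for x by simp
  moreover have "fps_compose (inverse x) \<psi> = inverse (fps_compose x \<psi>)" if "fps_nth x 0 \<noteq> 0" for x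
    by (rule fps_inverse_compose[OF \<psi>(1) that])
  ultimately show ?thesis
    using T unfolding even_order_ring_def
    by (auto simp: fps_compose_add_distrib fps_compose_mult_distrib[OF \<psi>(1)])
qed

text \<open>Subtracting a multiple of \<open>x ^ k\<close> removes the term \<open>t ^ (2 * k)\<close>. The next term \<open>t ^ (2 * k + 1)\<close> is then
  absent as well, because the order of the difference is not odd.\<close>

lemma even_order_ring_expansion:
  assumes T: "even_order_ring g T" and x: "x \<in> T" "subdegree x = 2" and \<phi>: "\<phi> \<in> T"
  shows "\<exists>c. \<forall>j<2 * g. fps_nth \<phi> j = (\<Sum>m<g. c m * fps_nth (x ^ m) j)"
proof -
  note constT = even_order_ringD(1)[OF T] and addT = even_order_ringD(2)[OF T]
    and multT = even_order_ringD(3)[OF T] and evenT = even_order_ringD(5)[OF T]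
  have powT: "x ^ k \<in> T" for k
  proof (induction k)
    case 0 then show ?case using constT[of 1] by simp
  qed (use x multT in simp)
  have "x \<noteq> 0" using x(2) by auto
  have sdx: "subdegree (x ^ m) = 2 * m" for m using subdegree_power[of x m] x(2) by simp
  have "\<exists>c. \<phi> - (\<Sum>m<k. fps_const (c m) * x ^ m) \<in> T \<and>
      (\<forall>j<2 * k. fps_nth (\<phi> - (\<Sum>m<k. fps_const (c m) * x ^ m)) j = 0)" if "k \<le> g" for k
    using that
  proof (induction k)
    case 0
    then show ?case using \<phi> by simp
  next
    case (Suc k)
    then obtain c where c: "\<phi> - (\<Sum>m<k. fps_const (c m) * x ^ m) \<in> T"
      "\<forall>j<2 * k. fps_nth (\<phi> - (\<Sum>m<k. fps_const (c m) * x ^ m)) j = 0" by auto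
    define \<xi> where "\<xi> = \<phi> - (\<Sum>m<k. fps_const (c m) * x ^ m)"
    define b where "b = fps_nth \<xi> (2 * k) / fps_nth (x ^ k) (2 * k)"
    define \<xi>' where "\<xi>' = \<xi> - fps_const b * x ^ k"
    have nz: "fps_nth (x ^ k) (2 * k) \<noteq> 0"
    proof -
      have "x ^ k \<noteq> 0" using \<open>x \<noteq> 0\<close> by simp
      from nth_subdegree_nonzero[OF this] show ?thesis unfolding sdx .
    qed
    have low: "fps_nth \<xi>' j = 0" if "j \<le> 2 * k" for j
    proof (cases "j = 2 * k")
      case True
      then show ?thesis using nz by (simp add: \<xi>'_def b_def)
    next
      case False
      then have "j < 2 * k" using that by simp
      then show ?thesis using c(2) sdx[of k] nth_less_subdegree_zero[of j "x ^ k"]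
        by (simp add: \<xi>'_def \<xi>_def)
    qed
    have "\<xi>' = \<xi> + fps_const (- b) * x ^ k" by (simp add: \<xi>'_def flip: fps_const_neg)
    then have "\<xi>' \<in> T" using c(1) addT multT constT powT unfolding \<xi>_def by metis
    moreover have "fps_nth \<xi>' j = 0" if "j < 2 * Suc k" for j
    proof (rule ccontr)
      assume nzj: "fps_nth \<xi>' j \<noteq> 0"
      then have "\<not> j \<le> 2 * k" using low by blast
      then have j: "j = 2 * k + 1" using that by presburger
      have "subdegree \<xi>' = 2 * k + 1" using nzj low by (intro subdegreeI) (auto simp: j)
      moreover have "\<xi>' \<noteq> 0" using nzj by auto
      ultimately show False using evenT[OF \<open>\<xi>' \<in> T\<close>] Suc.prems by auto
    qed
    moreover have "\<phi> - (\<Sum>m<Suc k. fps_const ((c(k := b)) m) * x ^ m) = \<xi>'"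
      by (simp add: \<xi>'_def \<xi>_def)
    ultimately show ?case by (intro exI[of _ "c(k := b)"]) auto
  qed
  from this[of g] obtain c where "\<forall>j<2 * g. fps_nth (\<phi> - (\<Sum>m<g. fps_const (c m) * x ^ m)) j = 0"
    by auto
  then show ?thesis by (intro exI[of _ c]) (auto simp: fps_sum_nth)
qed

text \<open>Otherwise all nonzero \<open>f i\<close> have order at least \<open>3\<close>, the order \<open>1\<close> being excluded by the semigroup, and no
  power series in them has order \<open>2\<close>.\<close>

lemma order_two_of_semigroup:
  assumes fin: "finite I" and f0: "\<And>i. i \<in> I \<Longrightarrow> fps_nth (f i) 0 = 0"
    and S: "value_semigroup I f = hyperelliptic_semigroup g" and g: "g \<ge> 1"
  shows "\<exists>i\<in>I. subdegree (f i) = 2"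
proof (rule ccontr)
  assume no2: "\<not> (\<exists>i\<in>I. subdegree (f i) = 2)"
  have low: "fps_nth (f i) j = 0" if i: "i \<in> I" and j: "j \<le> 2" for i j
  proof (cases "f i = 0")
    case False
    have "f i \<in> range (fps_substitute I f)"
      using f0 by (intro monomial_sums_range[OF fin _ monomial_sums_gen[OF fin i]]) auto
    then have "subdegree (f i) \<in> hyperelliptic_semigroup g"
      using False unfolding S[symmetric] value_semigroup_def by blast
    then have "subdegree (f i) \<noteq> 1" using hyperelliptic_semigroup_even[of 1 g] g by fastforce
    moreover have "subdegree (f i) \<noteq> 0" using f0[OF i] False by (simp add: subdegree_eq_0_iff)
    moreover have "subdegree (f i) \<noteq> 2" using no2 i by blast
    ultimately have "j < subdegree (f i)" using j by linarith
    then show ?thesis by (rule nth_less_subdegree_zero)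
  qed simp
  have "2 \<in> hyperelliptic_semigroup g"
    unfolding hyperelliptic_semigroup_def by (intro CollectI exI[of _ 1] exI[of _ 0]) simp
  then obtain G where G: "subdegree (fps_substitute I f G) = 2" "fps_substitute I f G \<noteq> 0"
    unfolding S[symmetric] value_semigroup_def by force
  have "fps_nth (\<Prod>i\<in>I. f i ^ \<alpha> i) 2 = 0" for \<alpha>
  proof (cases "\<exists>i\<in>I. \<alpha> i \<noteq> 0")
    case True
    then obtain i where i: "i \<in> I" "\<alpha> i \<noteq> 0" by blast
    then obtain k where k: "\<alpha> i = Suc k" by (cases "\<alpha> i") auto
    have "(\<Prod>i\<in>I. f i ^ \<alpha> i) = f i * (f i ^ k * (\<Prod>i\<in>I - {i}. f i ^ \<alpha> i))"
      using prod.remove[OF fin i(1), of "\<lambda>i. f i ^ \<alpha> i"] k by (simp add: mult_ac)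
    then show ?thesis using low[OF i(1)] by (simp add: fps_mult_nth)
  next
    case False
    then have "(\<Prod>i\<in>I. f i ^ \<alpha> i) = 1" by (intro prod.neutral) auto
    then show ?thesis by simp
  qed
  then have "fps_nth (fps_substitute I f G) 2 = 0"
    unfolding fps_substitute_def by simp
  moreover have "fps_nth (fps_substitute I f G) 2 \<noteq> 0"
    using nth_subdegree_nonzero[OF G(2)] G(1) by simp
  ultimately show False by simp
qed

section \<open>The normal form of a morphism at its cusp\<close>

lemma fps_const_of_sum: "fps_const (\<Sum>k\<in>K. f k) = (\<Sum>k\<in>K. fps_const (f k))"
  by (rule fps_ext) (simp add: fps_sum_nth)

lemma pcompose_power: "pcompose (p ^ k) q = pcompose p q ^ k"
  by (induction k) (simp_all add: pcompose_1 pcompose_mult)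

text \<open>On the line \<open>u' + t * w'\<close> one has \<open>u' + t * w' = (c + \<alpha> * t) * (u + \<psi>(t) * w)\<close>: passing to another
  affine coordinate at the same point means composing with the fractional linear series \<open>\<psi>\<close> and
  multiplying all forms with a common unit.\<close>

lemma local_form_reparam:
  assumes c: "c \<noteq> 0" and u': "u' 0 = c * u 0" "u' 1 = c * u 1"
    and w': "w' 0 = \<alpha> * u 0 + \<beta> * w 0" "w' 1 = \<alpha> * u 1 + \<beta> * w 1"
  defines "s \<equiv> fps_const c + fps_const \<alpha> * fps_X"
  defines "\<psi> \<equiv> fps_const \<beta> * fps_X * inverse s"
  shows "local_form d (\<lambda>p. e * a p) u' w' i =
     fps_const e * s ^ d * fps_compose (local_form d a u w i) \<psi>"
proof -
  have s0: "fps_nth s 0 \<noteq> 0" using c by (simp add: s_def)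
  have \<psi>0: "fps_nth \<psi> 0 = 0" by (simp add: \<psi>_def)
  have s\<psi>: "s * \<psi> = fps_const \<beta> * fps_X"
    using inverse_mult_eq_1[OF s0] by (simp add: \<psi>_def mult_ac)
  define lin where "lin x y = fps_const x + fps_const y * fps_X" for x y :: complex
  have lin: "lin (c * x) (\<alpha> * x + \<beta> * y) = s * fps_compose (lin x y) \<psi>" for x y
  proof -
    have "fps_compose (lin x y) \<psi> = fps_const x + fps_const y * \<psi>"
      unfolding lin_def using \<psi>0
      by (simp add: fps_compose_add_distrib fps_compose_mult_distrib[OF \<psi>0])
    then have "s * fps_compose (lin x y) \<psi> = fps_const x * s + fps_const y * (s * \<psi>)"
      by (simp add: algebra_simps)
    also have "\<dots> = lin (c * x) (\<alpha> * x + \<beta> * y)"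
      unfolding s\<psi> unfolding s_def lin_def
      by (simp add: algebra_simps flip: fps_const_add fps_const_mult)
    finally show ?thesis by simp
  qed
  have "local_form d (\<lambda>p. e * a p) u' w' i = (\<Sum>j\<le>d. fps_const (e * a (i, j)) *
      (s * fps_compose (lin (u 0) (w 0)) \<psi>) ^ (d - j) * (s * fps_compose (lin (u 1) (w 1)) \<psi>) ^ j)"
    unfolding local_form_def u' w' lin_def[symmetric] lin ..
  also have "\<dots> = (\<Sum>j\<le>d. fps_const e * s ^ d * fps_compose (fps_const (a (i, j)) *
      lin (u 0) (w 0) ^ (d - j) * lin (u 1) (w 1) ^ j) \<psi>)"
  proof (intro sum.cong refl)
    fix j assume "j \<in> {..d}"
    then have sd: "s ^ d = s ^ (d - j) * s ^ j" by (simp add: power_add[symmetric])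
    show "fps_const (e * a (i, j)) * (s * fps_compose (lin (u 0) (w 0)) \<psi>) ^ (d - j) *
        (s * fps_compose (lin (u 1) (w 1)) \<psi>) ^ j =
      fps_const e * s ^ d * fps_compose (fps_const (a (i, j)) *
        lin (u 0) (w 0) ^ (d - j) * lin (u 1) (w 1) ^ j) \<psi>"
      unfolding sd fps_compose_mult_distrib[OF \<psi>0] fps_compose_power[OF \<psi>0, symmetric]
        fps_const_compose fps_const_mult[symmetric] power_mult_distrib
      by (simp only: mult_ac)
  qed
  also have "\<dots> = fps_const e * s ^ d * fps_compose (local_form d a u w i) \<psi>"
    unfolding local_form_def lin_def[symmetric] fps_compose_sum_distrib sum_distrib_left ..
  finally show ?thesis .
qed

text \<open>The value semigroup and the vanishing sequence may refer to different germs. Here both are related to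
  the expansions \<open>L\<close> in one fixed frame, by a series \<open>\<psi>\<close> of order \<open>1\<close>.\<close>

lemma local_germ_compose:
  assumes A: "A \<in> proj_space I" "a \<in> A" and p: "p \<in> P1" "u \<in> p"
    and frame: "u 0 * w 1 - u 1 * w 0 \<noteq> 0" and germ: "local_germ n d A p r f"
  defines "L \<equiv> local_form d a u w"
  shows "\<exists>\<psi>. fps_nth \<psi> 0 = 0 \<and> fps_nth \<psi> 1 \<noteq> 0 \<and> r \<le> n \<and> fps_nth (L r) 0 \<noteq> 0 \<and>
     (\<forall>i. f i = fps_compose (L i * inverse (L r)) \<psi> - fps_const (fps_nth (L i * inverse (L r)) 0))"
proof -
  obtain a' u' w' where g: "a' \<in> A" "u' \<in> p" "u' 0 * w' 1 - u' 1 * w' 0 \<noteq> 0" "r \<le> n"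
    "fps_nth (local_form d a' u' w' r) 0 \<noteq> 0"
    "f = (\<lambda>i. let h = local_form d a' u' w' i / local_form d a' u' w' r
              in h - fps_const (fps_nth h 0))"
    using germ unfolding local_germ_def by blast
  obtain e where e: "e \<noteq> 0" "a' = (\<lambda>p. e * a p)"
    using proj_space_scale[OF A(1,2) g(1)] by blast
  obtain c where c: "c \<noteq> 0" "u' = (\<lambda>m. c * u m)" using proj_space_scale[OF p g(2)] by blast
  define D where "D = u 0 * w 1 - u 1 * w 0"
  define \<alpha> where "\<alpha> = (w' 0 * w 1 - w' 1 * w 0) / D"
  define \<beta> where "\<beta> = (u 0 * w' 1 - u 1 * w' 0) / D"
  have D: "D \<noteq> 0" using frame by (simp add: D_def)
  have "c * (u 0 * w' 1 - u 1 * w' 0) \<noteq> 0" using g(3) by (simp add: c(2) algebra_simps)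
  then have \<beta>: "\<beta> \<noteq> 0" using D by (simp add: \<beta>_def)
  have "D * w' 0 = D * (\<alpha> * u 0 + \<beta> * w 0)" "D * w' 1 = D * (\<alpha> * u 1 + \<beta> * w 1)"
    using D by (simp_all add: \<alpha>_def \<beta>_def field_simps) (simp_all add: D_def algebra_simps)
  then have w': "w' 0 = \<alpha> * u 0 + \<beta> * w 0" "w' 1 = \<alpha> * u 1 + \<beta> * w 1" using D by simp_all
  define s where "s = fps_const c + fps_const \<alpha> * fps_X"
  define \<psi> where "\<psi> = fps_const \<beta> * fps_X * inverse s"
  have s0: "fps_nth s 0 = c" by (simp add: s_def)
  have \<psi>0: "fps_nth \<psi> 0 = 0" by (simp add: \<psi>_def)
  have "fps_nth \<psi> 1 = \<beta> * inverse c"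
    unfolding \<psi>_def mult.assoc by (simp add: s0 fps_X_mult_nth)
  then have \<psi>1: "fps_nth \<psi> 1 \<noteq> 0" using \<beta> c by simp
  define U where "U = fps_const e * s ^ d"
  have U0: "fps_nth U 0 \<noteq> 0" using e c by (simp add: U_def s0 fps_power_zeroth)
  have rep: "local_form d a' u' w' i = U * fps_compose (L i) \<psi>" for i
    unfolding U_def L_def e(2) \<psi>_def s_def
    by (rule local_form_reparam) (use c w' in auto)
  have Lr0: "fps_nth (L r) 0 \<noteq> 0" using g(5) unfolding rep by auto
  have "f i = fps_compose (L i * inverse (L r)) \<psi> - fps_const (fps_nth (L i * inverse (L r)) 0)" for i
  proof -
    have "local_form d a' u' w' i / local_form d a' u' w' r =
        U * fps_compose (L i) \<psi> * inverse (U * fps_compose (L r) \<psi>)"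
      using g(5) unfolding rep by (rule fps_divide_unit)
    also have "\<dots> = (inverse U * U) * (fps_compose (L i) \<psi> * inverse (fps_compose (L r) \<psi>))"
      by (simp add: fps_inverse_mult mult_ac)
    also have "\<dots> = fps_compose (L i) \<psi> * fps_compose (inverse (L r)) \<psi>"
      using inverse_mult_eq_1[OF U0] fps_inverse_compose[OF \<psi>0 Lr0] by simp
    also have "\<dots> = fps_compose (L i * inverse (L r)) \<psi>"
      by (rule fps_compose_mult_distrib[OF \<psi>0, symmetric])
    finally show ?thesis by (simp add: g(6) Let_def)
  qed
  then show ?thesis using \<psi>0 \<psi>1 Lr0 g(4) by blast
qed

definition row_span :: "nat \<Rightarrow> (nat \<Rightarrow> complex fps) \<Rightarrow> complex fps set" where
  "row_span n L = {\<Sum>i\<le>n. fps_const (b i) * L i | b. True}"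

definition span_orders :: "nat \<Rightarrow> (nat \<Rightarrow> complex fps) \<Rightarrow> nat set" where
  "span_orders n L = subdegree ` (row_span n L - {0})"

text \<open>The relation between a germ \<open>f\<close> and the expansions \<open>L\<close> that \<open>local_germ_compose\<close> provides.\<close>

locale germ_chart =
  fixes n r :: nat and L f :: "nat \<Rightarrow> complex fps" and \<psi> :: "complex fps"
  assumes \<psi>0: "fps_nth \<psi> 0 = 0" and \<psi>1: "fps_nth \<psi> 1 \<noteq> 0" and r: "r \<le> n"
    and Lr0: "fps_nth (L r) 0 \<noteq> 0"
    and f: "\<And>i. f i = fps_compose (L i * inverse (L r)) \<psi> - fps_const (fps_nth (L i * inverse (L r)) 0)"
begin

abbreviation I where "I \<equiv> {..n} - {r}"

definition chart :: "complex fps \<Rightarrow> complex fps" where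
  "chart v = fps_compose (v * inverse (L r)) \<psi>"

lemma subdegree_chart: "subdegree (chart v) = subdegree v" "chart v = 0 \<longleftrightarrow> v = 0"
proof -
  have sd: "subdegree \<psi> = 1" using \<psi>0 \<psi>1 by (intro subdegreeI) auto
  have i: "inverse (L r) \<noteq> 0" using Lr0 by simp
  have "chart v = 0 \<longleftrightarrow> v * inverse (L r) = 0"
    unfolding chart_def using fps_compose_eq_0_iff[OF \<psi>0] \<psi>1 by auto
  then show 0: "chart v = 0 \<longleftrightarrow> v = 0" using i by simp
  show "subdegree (chart v) = subdegree v"
  proof (cases "v = 0")
    case False
    then have "subdegree (v * inverse (L r)) = subdegree v" using i Lr0 by simp
    then show ?thesis unfolding chart_def using sd by (simp add: subdegree_fps_compose[OF \<psi>0])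
  qed (use 0 in simp)
qed

text \<open>As \<open>L r\<close> becomes \<open>1\<close> in the chart, the combinations of the rows are the combinations of \<open>1\<close> and the
  germs \<open>f i\<close>.\<close>

lemma chart_combination:
  "chart (\<Sum>i\<le>n. fps_const (b i) * L i) =
     fps_const (b r + (\<Sum>i\<in>I. b i * fps_nth (L i * inverse (L r)) 0)) + (\<Sum>i\<in>I. fps_const (b i) * f i)"
proof -
  have "chart (\<Sum>i\<le>n. fps_const (b i) * L i) = (\<Sum>i\<le>n. fps_const (b i) * fps_compose (L i * inverse (L r)) \<psi>)"
    unfolding chart_def sum_distrib_right mult.assoc fps_compose_sum_distrib
      fps_compose_mult_distrib[OF \<psi>0, of "fps_const _"] by simp
  also have "\<dots> = fps_const (b r) * fps_compose (L r * inverse (L r)) \<psi> +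
      (\<Sum>i\<in>I. fps_const (b i) * fps_compose (L i * inverse (L r)) \<psi>)"
    using r by (simp add: sum.remove)
  also have "L r * inverse (L r) = 1" using inverse_mult_eq_1'[OF Lr0] .
  also have "(\<Sum>i\<in>I. fps_const (b i) * fps_compose (L i * inverse (L r)) \<psi>) =
      (\<Sum>i\<in>I. fps_const (b i) * f i + fps_const (b i * fps_nth (L i * inverse (L r)) 0))"
    by (intro sum.cong refl) (simp add: f algebra_simps flip: fps_const_mult)
  finally show ?thesis
    by (simp add: sum.distrib fps_const_of_sum[symmetric] algebra_simps flip: fps_const_add)
qed

lemma vanishing_orders_eq: "vanishing_orders I f = span_orders n L"
proof -
  let ?V = "{fps_const c + (\<Sum>i\<in>I. fps_const (b i) * f i) | c b. True}"
  have "?V = chart ` row_span n L"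
  proof (intro equalityI subsetI)
    fix x assume "x \<in> ?V"
    then obtain c b where x: "x = fps_const c + (\<Sum>i\<in>I. fps_const (b i) * f i)" by blast
    define b' where "b' = b(r := c - (\<Sum>i\<in>I. b i * fps_nth (L i * inverse (L r)) 0))"
    have "(\<Sum>i\<in>I. b' i * fps_nth (L i * inverse (L r)) 0) = (\<Sum>i\<in>I. b i * fps_nth (L i * inverse (L r)) 0)"
      "(\<Sum>i\<in>I. fps_const (b' i) * f i) = (\<Sum>i\<in>I. fps_const (b i) * f i)"
      by (auto simp: b'_def intro!: sum.cong)
    then have "chart (\<Sum>i\<le>n. fps_const (b' i) * L i) = x"
      unfolding chart_combination x by (simp add: b'_def)
    then show "x \<in> chart ` row_span n L" unfolding row_span_def by blast
  next
    fix x assume "x \<in> chart ` row_span n L"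
    then show "x \<in> ?V" unfolding row_span_def using chart_combination by auto
  qed
  then have "?V - {0} = chart ` (row_span n L - {0})" using subdegree_chart(2) by auto
  then show ?thesis
    unfolding vanishing_orders_def span_orders_def by (simp add: image_image subdegree_chart(1))
qed

lemma f_nth_0: "fps_nth (f i) 0 = 0"
  by (simp add: f)

lemma even_order_ring_row_span:
  assumes S: "value_semigroup I f = hyperelliptic_semigroup g"
  shows "\<exists>T. even_order_ring g T \<and> (\<forall>v\<in>row_span n L. v * inverse (L r) \<in> T)"
proof -
  obtain T where T: "even_order_ring g T" "\<forall>i\<in>I. f i \<in> T"
    using even_order_ring_of_semigroup[OF _ f_nth_0 S] by auto
  note D = even_order_ringD[OF T(1)]
  have sum: "(\<Sum>i\<in>K. fps_const (b i) * f i) \<in> T" if "K \<subseteq> I" for K b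
    using that
  proof (induction K rule: infinite_finite_induct)
    case empty then show ?case using D(1)[of 0] by simp
  next
    case (infinite K) then show ?case using D(1)[of 0] by simp
  qed (use D T(2) in simp)
  have "chart v \<in> T" if "v \<in> row_span n L" for v
  proof -
    obtain b where v: "v = (\<Sum>i\<le>n. fps_const (b i) * L i)" using \<open>v \<in> row_span n L\<close> by (auto simp: row_span_def)
    show ?thesis unfolding v chart_combination by (rule D(2)[OF D(1) sum[OF order_refl]])
  qed
  then show ?thesis
    using even_order_ring_compose[OF T(1) \<psi>0 \<psi>1] unfolding chart_def by blast
qed

lemma order_two: "value_semigroup I f = hyperelliptic_semigroup g \<Longrightarrow> g \<ge> 1 \<Longrightarrow> 2 \<in> span_orders n L"
proof -
  assume "value_semigroup I f = hyperelliptic_semigroup g" "g \<ge> 1"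
  then obtain i where i: "i \<in> I" "subdegree (f i) = 2"
    using order_two_of_semigroup[where f = f and I = I and g = g, OF _ f_nth_0] by auto
  have "(\<Sum>k\<in>I. fps_const (if k = i then 1 else 0) * f k) = f i"
    using i(1) by (subst sum.remove[of _ i]) (auto intro: sum.neutral)
  then have "f i \<in> {fps_const c + (\<Sum>i\<in>I. fps_const (b i) * f i) | c b. True}"
    by (intro CollectI exI[of _ 0] exI[of _ "\<lambda>k. if k = i then 1 else 0"]) simp
  moreover have "f i \<noteq> 0" using i(2) by auto
  ultimately have "2 \<in> vanishing_orders I f" unfolding vanishing_orders_def using i(2) by force
  then show ?thesis unfolding vanishing_orders_eq .
qed

end

lemma row_span_gen: "i \<le> n \<Longrightarrow> L i \<in> row_span n L"
proof -
  assume "i \<le> n"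
  then have "(\<Sum>k\<le>n. fps_const (if k = i then 1 else 0) * L k) = L i"
    by (subst sum.remove[of _ i]) (auto intro: sum.neutral)
  then show ?thesis unfolding row_span_def
    by (intro CollectI exI[of _ "\<lambda>k. if k = i then 1 else 0"]) simp
qed

lemma row_span_combine:
  assumes "v \<in> row_span n L" "w \<in> row_span n L"
  shows "fps_const a * v + fps_const c * w \<in> row_span n L"
proof -
  obtain b b' where "v = (\<Sum>i\<le>n. fps_const (b i) * L i)" "w = (\<Sum>i\<le>n. fps_const (b' i) * L i)"
    using assms by (auto simp: row_span_def)
  then have "fps_const a * v + fps_const c * w = (\<Sum>i\<le>n. fps_const (a * b i + c * b' i) * L i)"
    by (simp add: sum_distrib_left sum.distrib[symmetric] algebra_simps flip: fps_const_add fps_const_mult)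
  then show ?thesis unfolding row_span_def by (intro CollectI exI[of _ "\<lambda>i. a * b i + c * b' i"]) simp
qed

lemma row_span_sum:
  assumes "\<And>k. k \<in> K \<Longrightarrow> v k \<in> row_span n L"
  shows "(\<Sum>k\<in>K. fps_const (a k) * v k) \<in> row_span n L"
  using assms
proof (induction K rule: infinite_finite_induct)
  case (insert k K)
  then show ?case using row_span_combine[of "v k" n L _ "a k" 1] by simp
qed (use row_span_combine[OF row_span_gen[of 0 n L] row_span_gen[of 0 n L], of 0 0] in auto)

text \<open>Starting with an element of order \<open>r\<close>, its coefficients at the larger elements of \<open>P\<close> are cleared by
  basis vectors that have already been constructed; so the construction starts with the largest order.\<close>

lemma reduced_basis_exists:
  assumes fin: "finite (span_orders n L)" and d: "\<And>i j. i \<le> n \<Longrightarrow> j > d \<Longrightarrow> fps_nth (L i) j = 0"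
  defines "P \<equiv> span_orders n L"
  shows "\<exists>h. reduced_basis d P h \<and> (\<forall>r\<in>P. h r \<in> row_span n L)"
proof -
  have finP: "finite P" using fin by (simp add: P_def)
  have high: "fps_nth v j = 0" if "v \<in> row_span n L" "j > d" for v j
    using that d by (auto simp: row_span_def fps_sum_nth)
  have "\<exists>v\<in>row_span n L. fps_nth v r = 1 \<and> (\<forall>j<r. fps_nth v j = 0) \<and>
      (\<forall>t\<in>P. r < t \<longrightarrow> fps_nth v t = 0)" if "r \<in> P" for r
    using that
  proof (induction "Max P - r" arbitrary: r rule: less_induct)
    case less
    have "\<forall>t\<in>{t \<in> P. r < t}. \<exists>v\<in>row_span n L. fps_nth v t = 1 \<and> (\<forall>j<t. fps_nth v j = 0) \<and>
        (\<forall>t'\<in>P. t < t' \<longrightarrow> fps_nth v t' = 0)"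
    proof
      fix t assume t: "t \<in> {t \<in> P. r < t}"
      then have "t \<le> Max P" using finP by simp
      then show "\<exists>v\<in>row_span n L. fps_nth v t = 1 \<and> (\<forall>j<t. fps_nth v j = 0) \<and>
        (\<forall>t'\<in>P. t < t' \<longrightarrow> fps_nth v t' = 0)" using t by (intro less.hyps) auto
    qed
    then obtain h where h: "\<And>t. t \<in> P \<Longrightarrow> r < t \<Longrightarrow> h t \<in> row_span n L \<and> fps_nth (h t) t = 1 \<and>
        (\<forall>j<t. fps_nth (h t) j = 0) \<and> (\<forall>t'\<in>P. t < t' \<longrightarrow> fps_nth (h t) t' = 0)"
      by (metis (no_types, lifting) mem_Collect_eq)
    obtain v where v: "v \<in> row_span n L" "v \<noteq> 0" "subdegree v = r"
      using less.prems unfolding P_def span_orders_def by blast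
    define v1 where "v1 = fps_const (1 / fps_nth v r) * v"
    have v1: "v1 \<in> row_span n L" using row_span_combine[OF v(1) v(1), of "1 / fps_nth v r" 0]
      by (simp add: v1_def)
    have v1r: "fps_nth v1 r = 1" using nth_subdegree_nonzero[OF v(2)] v(3) by (simp add: v1_def)
    have v1j: "fps_nth v1 j = 0" if "j < r" for j using v(3) that by (auto simp: v1_def)
    let ?Q = "{t \<in> P. r < t}"
    define x where "x = v1 - (\<Sum>t\<in>?Q. fps_const (fps_nth v1 t) * h t)"
    have "x = fps_const 1 * v1 + fps_const (-1) * (\<Sum>t\<in>?Q. fps_const (fps_nth v1 t) * h t)"
      by (simp add: x_def flip: fps_const_neg)
    then have xV: "x \<in> row_span n L"
      using row_span_combine[OF v1 row_span_sum[of ?Q h n L "fps_nth v1"], of 1 "-1"] h by simp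
    have "fps_nth x j = fps_nth v1 j" if "j \<le> r" for j
    proof -
      have "(\<Sum>t\<in>?Q. fps_nth v1 t * fps_nth (h t) j) = 0"
        using h that by (intro sum.neutral) auto
      then show ?thesis by (simp add: x_def fps_sum_nth)
    qed
    moreover have "fps_nth x s = 0" if s: "s \<in> P" "r < s" for s
    proof -
      have "(\<Sum>t\<in>?Q. fps_nth v1 t * fps_nth (h t) s) = (\<Sum>t\<in>?Q. if t = s then fps_nth v1 s else 0)"
      proof (intro sum.cong refl)
        fix t assume t: "t \<in> ?Q"
        then show "fps_nth v1 t * fps_nth (h t) s = (if t = s then fps_nth v1 s else 0)"
          using h[of t] s by (cases t s rule: linorder_cases) auto
      qed
      also have "\<dots> = fps_nth v1 s" using s finP by (simp add: sum.delta')
      finally show ?thesis by (simp add: x_def fps_sum_nth)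
    qed
    ultimately show ?case using xV v1r v1j by (intro bexI[of _ x]) auto
  qed
  then obtain h where h: "\<And>r. r \<in> P \<Longrightarrow> h r \<in> row_span n L \<and> fps_nth (h r) r = 1 \<and>
      (\<forall>j<r. fps_nth (h r) j = 0) \<and> (\<forall>t\<in>P. r < t \<longrightarrow> fps_nth (h r) t = 0)"
    by metis
  have "reduced_basis d P h"
    unfolding reduced_basis_def
  proof (intro ballI conjI allI impI)
    fix r j assume r: "r \<in> P" and j: "j < r \<or> j > d \<or> (j \<in> P \<and> j \<noteq> r)"
    show "fps_nth (h r) j = 0"
      using h[OF r] high[of "h r" j] j by (metis linorder_neqE_nat)
  qed (use h in blast)
  then show ?thesis using h by blast
qed

text \<open>The difference of both sides has coefficient zero at all positions in \<open>P\<close>, so its order would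
  not be in \<open>P\<close> unless it is zero.\<close>

lemma row_span_coordinates:
  assumes rb: "reduced_basis d P h" and hV: "\<And>r. r \<in> P \<Longrightarrow> h r \<in> row_span n L"
    and P: "P = span_orders n L" and fin: "finite P" and v: "v \<in> row_span n L"
  shows "v = (\<Sum>r\<in>P. fps_const (fps_nth v r) * h r)"
proof (rule ccontr)
  assume ne: "v \<noteq> (\<Sum>r\<in>P. fps_const (fps_nth v r) * h r)"
  define x where "x = v - (\<Sum>r\<in>P. fps_const (fps_nth v r) * h r)"
  have "x = fps_const 1 * v + fps_const (-1) * (\<Sum>r\<in>P. fps_const (fps_nth v r) * h r)"
    by (simp add: x_def flip: fps_const_neg)
  then have "x \<in> row_span n L"
    using row_span_combine[OF v row_span_sum[of P h n L "fps_nth v"], of 1 "-1"] hV by simp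
  moreover have x0: "x \<noteq> 0" using ne by (simp add: x_def)
  ultimately have s: "subdegree x \<in> P" unfolding P span_orders_def by blast
  have "(\<Sum>r\<in>P. fps_nth v r * fps_nth (h r) s) = (\<Sum>r\<in>P. if r = s then fps_nth v s else 0)"
    if "s \<in> P" for s
    using rb that unfolding reduced_basis_def by (intro sum.cong refl) auto
  then have "fps_nth x (subdegree x) = 0"
    using s fin by (simp add: x_def fps_sum_nth)
  then show False using nth_subdegree_nonzero[OF x0] by simp
qed

text \<open>Both \<open>L\<close> and \<open>h\<close> are linearly independent families that span the same space.\<close>

lemma card_span_orders:
  assumes rb: "reduced_basis d P h" and hV: "\<And>r. r \<in> P \<Longrightarrow> h r \<in> row_span n L"
    and P: "P = span_orders n L" and fin: "finite P"
    and indep: "\<And>b. (\<Sum>i\<le>n. fps_const (b i) * L i) = 0 \<Longrightarrow> \<forall>i\<le>n. b i = 0"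
  shows "card P = n + 1"
proof (rule antisym)
  show "card P \<le> n + 1"
  proof (rule ccontr)
    assume "\<not> card P \<le> n + 1"
    have "\<forall>r\<in>P. \<exists>b. h r = (\<Sum>i\<le>n. fps_const (b i) * L i)" using hV by (auto simp: row_span_def)
    then obtain B where B: "\<And>r. r \<in> P \<Longrightarrow> h r = (\<Sum>i\<le>n. fps_const (B r i) * L i)" by metis
    obtain c where c: "\<exists>r\<in>P. c r \<noteq> 0" "\<forall>i<n + 1. (\<Sum>r\<in>P. c r * B r i) = 0"
      using underdetermined_system[OF fin, of "n + 1" B] \<open>\<not> card P \<le> n + 1\<close> by auto
    have "(\<Sum>r\<in>P. fps_const (c r) * h r) = (\<Sum>r\<in>P. \<Sum>i\<le>n. fps_const (c r * B r i) * L i)"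
      using B by (intro sum.cong refl) (simp add: sum_distrib_left mult.assoc flip: fps_const_mult)
    also have "\<dots> = (\<Sum>i\<le>n. fps_const (\<Sum>r\<in>P. c r * B r i) * L i)"
      by (subst sum.swap) (simp add: fps_const_of_sum sum_distrib_right)
    also have "\<dots> = 0" using c(2) by (intro sum.neutral) auto
    finally have zero: "(\<Sum>r\<in>P. fps_const (c r) * h r) = 0" .
    have "c s = 0" if s: "s \<in> P" for s
    proof -
      have "(\<Sum>r\<in>P. c r * fps_nth (h r) s) = (\<Sum>r\<in>P. if r = s then c s else 0)"
        using rb s unfolding reduced_basis_def by (intro sum.cong refl) auto
      then show ?thesis using arg_cong[OF zero, of "\<lambda>x. fps_nth x s"] s fin by (simp add: fps_sum_nth)
    qed
    then show False using c(1) by blast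
  qed
  show "n + 1 \<le> card P"
  proof (rule ccontr)
    assume "\<not> n + 1 \<le> card P"
    then have lt: "card P < card {..n}" by simp
    obtain e where e: "bij_betw e {..<card P} P"
      using ex_bij_betw_nat_finite[OF fin] by (metis atLeast0LessThan)
    obtain b where b: "\<exists>i\<in>{..n}. b i \<noteq> 0" "\<forall>k<card P. (\<Sum>i\<le>n. b i * fps_nth (L i) (e k)) = 0"
      using underdetermined_system[OF _ lt, of "\<lambda>i k. fps_nth (L i) (e k)"] by auto
    define v where "v = (\<Sum>i\<le>n. fps_const (b i) * L i)"
    have "fps_nth v r = 0" if r: "r \<in> P" for r
    proof -
      obtain k where "k < card P" "r = e k" using e r by (auto simp: bij_betw_def)
      then show ?thesis using b(2) by (simp add: v_def fps_sum_nth)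
    qed
    moreover have "v \<in> row_span n L" unfolding v_def row_span_def by blast
    ultimately have "v = 0" using row_span_coordinates[OF rb hV P fin, of v] by simp
    then show False using indep[of b] b(1) by (simp add: v_def)
  qed
qed

text \<open>The two charts of the projective line: the point \<open>(1 : \<tau>)\<close> with direction \<open>(0, 1)\<close>, and the point
  \<open>(0 : 1)\<close> with direction \<open>(1, 0)\<close>.\<close>

definition frame_u :: "bool \<Rightarrow> complex \<Rightarrow> nat \<Rightarrow> complex" where
  "frame_u at_inf \<tau> = (\<lambda>m. if m = 0 then (if at_inf then 0 else 1)
     else if m = 1 then (if at_inf then 1 else \<tau>) else 0)"

definition frame_w :: "bool \<Rightarrow> nat \<Rightarrow> complex" where
  "frame_w at_inf = (\<lambda>m. if m = 0 then (if at_inf then 1 else 0)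
     else if m = 1 then (if at_inf then 0 else 1) else 0)"

lemma P1_frame:
  assumes "p \<in> P1" shows "\<exists>at_inf \<tau>. frame_u at_inf \<tau> \<in> p"
proof -
  obtain z where z: "p = proj_point z" "z \<in> vec_space {..1}" "z \<noteq> 0"
    using assms by (auto simp: proj_space_def)
  have z2: "z m = 0" if "m \<noteq> 0" "m \<noteq> 1" for m using z(2) that by (auto simp: vec_space_def)
  show ?thesis
  proof (cases "z 0 = 0")
    case True
    then have "z 1 \<noteq> 0" using z(3) z2 by (metis ext zero_fun_apply)
    then have "frame_u True 0 = (\<lambda>m. (1 / z 1) * z m)"
      using True z2 by (auto simp: frame_u_def fun_eq_iff)
    then show ?thesis using \<open>z 1 \<noteq> 0\<close> unfolding z(1) proj_point_def
      by (intro exI[of _ True] exI[of _ 0] CollectI exI[of _ "1 / z 1"]) simp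
  next
    case False
    then have "frame_u False (z 1 / z 0) = (\<lambda>m. (1 / z 0) * z m)"
      using z2 by (auto simp: frame_u_def fun_eq_iff)
    then show ?thesis using False unfolding z(1) proj_point_def
      by (intro exI[of _ False] exI[of _ "z 1 / z 0"] CollectI exI[of _ "1 / z 0"]) simp
  qed
qed

text \<open>At a finite point the expansion substitutes \<open>\<tau> + t\<close> into the dehomogenized form, which is
  undone by substituting \<open>t - \<tau>\<close>. At the point \<open>(0 : 1)\<close> it reverses the order of the coefficients.\<close>

lemma local_form_frame:
  fixes d :: nat and a :: "nat \<times> nat \<Rightarrow> complex"
  defines "L \<equiv> \<lambda>at_inf \<tau> i. local_form d a (frame_u at_inf \<tau>) (frame_w at_inf) i"
  shows "l > d \<Longrightarrow> fps_nth (L at_inf \<tau> i) l = 0"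
    and "j \<le> d \<Longrightarrow> a (i, j) = (\<Sum>l\<le>d. shift_coeff at_inf d \<tau> j l * fps_nth (L at_inf \<tau> i) l)"
proof -
  have inf: "fps_nth (L True \<tau> i) l = (if l \<le> d then a (i, d - l) else 0)" for l
  proof -
    have "fps_nth (L True \<tau> i) l = (\<Sum>j\<le>d. if j = d - l \<and> l \<le> d then a (i, j) else 0)"
      by (auto simp: L_def local_form_def frame_u_def frame_w_def fps_sum_nth fps_X_power_nth
          intro!: sum.cong)
    then show ?thesis by (simp add: sum.delta')
  qed
  define q where "q = (\<Sum>j\<le>d. monom (a (i, j)) j)"
  have cq: "coeff q j = (if j \<le> d then a (i, j) else 0)" for j
    unfolding q_def coeff_sum by (simp add: sum.delta')
  have dq: "degree q \<le> d" by (rule degree_le) (simp add: cq)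
  let ?s = "pcompose q [:\<tau>, 1:]"
  have fin: "L False \<tau> i = fps_of_poly ?s"
  proof -
    have "?s = (\<Sum>j\<le>d. smult (a (i, j)) ([:\<tau>, 1:] ^ j))"
      unfolding q_def pcompose_sum
      by (intro sum.cong refl) (simp add: monom_altdef pcompose_smult pcompose_power pcompose_pCons)
    then show ?thesis
      by (simp add: L_def local_form_def frame_u_def frame_w_def fps_of_poly_sum fps_of_poly_smult
          fps_of_poly_power fps_of_poly_linear add.commute)
  qed
  have ds: "degree ?s \<le> d" using dq by (simp add: degree_pcompose)
  show "l > d \<Longrightarrow> fps_nth (L at_inf \<tau> i) l = 0"
    using inf fin ds by (cases at_inf) (auto simp: coeff_eq_0)
  show "a (i, j) = (\<Sum>l\<le>d. shift_coeff at_inf d \<tau> j l * fps_nth (L at_inf \<tau> i) l)" if j: "j \<le> d"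
  proof (cases at_inf)
    case True
    have "(\<Sum>l\<le>d. shift_coeff True d \<tau> j l * fps_nth (L True \<tau> i) l) = (\<Sum>l\<le>d. if l = d - j then a (i, j) else 0)"
      using j by (intro sum.cong refl) (auto simp: shift_coeff_def inf)
    then show ?thesis using True by simp
  next
    case False
    have "q = pcompose ?s [:-\<tau>, 1:]"
      by (simp add: pcompose_assoc[symmetric] pcompose_pCons)
    also have "?s = (\<Sum>l\<le>d. monom (coeff ?s l) l)"
      using poly_as_sum_of_monoms'[OF ds] by simp
    also have "pcompose \<dots> [:-\<tau>, 1:] = (\<Sum>l\<le>d. smult (coeff ?s l) ([:-\<tau>, 1:] ^ l))"
      unfolding pcompose_sum
      by (intro sum.cong refl) (simp add: monom_altdef pcompose_smult pcompose_power pcompose_pCons)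
    finally have "coeff q j = (\<Sum>l\<le>d. coeff ?s l * coeff ([:-\<tau>, 1:] ^ l) j)"
      by (metis (no_types, lifting) coeff_smult coeff_sum sum.cong)
    then show ?thesis using j False by (simp add: cq fin shift_coeff_def mult.commute)
  qed
qed

lemma M_nd_rows_independent:
  assumes A: "A \<in> M_nd n d" "a \<in> A" and b: "\<And>j. j \<le> d \<Longrightarrow> (\<Sum>i\<le>n. b i * a (i, j)) = 0"
  shows "\<forall>i\<le>n. b i = 0"
proof -
  have AP: "A \<in> proj_space (coeff_index n d)" using A(1) by (simp add: M_nd_def)
  have "(\<Sum>i\<le>n. b i * x i) = 0" if x: "x \<in> \<Union>(curve_image n d A)" for x
  proof -
    obtain q where "x \<in> morph n d A q" using x by (auto simp: curve_image_def)
    then obtain a' u where a': "a' \<in> A" "x = param_eval n d a' u" by (auto simp: morph_def)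
    obtain e where e: "a' = (\<lambda>p. e * a p)" using proj_space_scale[OF AP A(2) a'(1)] by blast
    have "(\<Sum>i\<le>n. b i * x i) = (\<Sum>i\<le>n. \<Sum>j\<le>d. e * (b i * a (i, j)) * (u 0 ^ (d - j) * u 1 ^ j))"
      by (simp add: a'(2) e param_eval_def sum_distrib_left mult_ac)
    also have "\<dots> = (\<Sum>j\<le>d. e * (\<Sum>i\<le>n. b i * a (i, j)) * (u 0 ^ (d - j) * u 1 ^ j))"
      by (subst sum.swap) (simp add: sum_distrib_left sum_distrib_right)
    also have "\<dots> = 0" using b by (intro sum.neutral) auto
    finally show ?thesis .
  qed
  then show ?thesis using A(1) unfolding M_nd_def by blast
qed

definition admissible_orders :: "nat \<Rightarrow> nat \<Rightarrow> nat \<Rightarrow> nat set \<Rightarrow> bool" where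
  "admissible_orders n d g P \<longleftrightarrow> P \<subseteq> {..d} \<and> card P = n + 1 \<and> 0 \<in> P \<and> 2 \<in> P \<and>
     (\<forall>r\<in>P. odd r \<longrightarrow> 2 * g \<le> r)"

text \<open>The row expansions divided by a unit row lie in a ring without small odd orders. Since this ring contains
  the inverse of \<open>h 0\<close> divided by that row, it also contains all \<open>h r / h 0\<close>, and \<open>even_order_ring_expansion\<close>
  applies with \<open>x = h 2 / h 0\<close>.\<close>

theorem cusp_normal_form_exists:
  assumes A: "A \<in> M_nd n d" and p: "p \<in> P1" and g: "g \<ge> 1"
    and S: "has_value_semigroup n d A p (hyperelliptic_semigroup g)"
  shows "\<exists>P. admissible_orders n d g P \<and> (\<forall>k. has_vanishing_sequence n d A p k \<longrightarrow> P = k ` {..n}) \<and>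
     (\<exists>a\<in>A. \<exists>at_inf \<tau> G h c. cusp_normal_form n d g P at_inf a \<tau> G h c)"
proof -
  have AP: "A \<in> proj_space (coeff_index n d)" using A by (simp add: M_nd_def)
  then obtain a where a: "a \<in> A" by (auto simp: proj_space_def intro: self_in_proj_point)
  obtain at_inf \<tau> where u: "frame_u at_inf \<tau> \<in> p" using P1_frame[OF p] by blast
  define L where "L = local_form d a (frame_u at_inf \<tau>) (frame_w at_inf)"
  have frame: "frame_u at_inf \<tau> 0 * frame_w at_inf 1 - frame_u at_inf \<tau> 1 * frame_w at_inf 0 \<noteq> 0"
    by (simp add: frame_u_def frame_w_def)
  have high: "fps_nth (L i) l = 0" if "l > d" for i l
    unfolding L_def using that by (rule local_form_frame(1))
  have a_eq: "a (i, j) = (\<Sum>l\<le>d. shift_coeff at_inf d \<tau> j l * fps_nth (L i) l)" if "j \<le> d" for i j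
    unfolding L_def using that by (rule local_form_frame(2))
  define P where "P = span_orders n L"
  have P_le: "P \<subseteq> {..d}"
  proof
    fix r assume "r \<in> P"
    then obtain v where v: "v \<in> row_span n L" "v \<noteq> 0" "r = subdegree v"
      unfolding P_def span_orders_def by blast
    have "fps_nth v l = 0" if "l > d" for l
      using v(1) high[OF that] by (auto simp: row_span_def fps_sum_nth)
    then show "r \<in> {..d}" using nth_subdegree_nonzero[OF v(2)] v(3) by (metis atMost_iff not_le)
  qed
  then have finP: "finite P" using finite_subset by blast
  have vanishing: "P = k ` {..n}" if k: "has_vanishing_sequence n d A p k" for k
  proof -
    obtain r f where rf: "local_germ n d A p r f" "vanishing_orders ({..n} - {r}) f = k ` {..n}"
      using k unfolding has_vanishing_sequence_def by blast
    obtain \<psi> where "germ_chart n r L f \<psi>"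
      using local_germ_compose[OF AP a p u frame rf(1)] unfolding germ_chart_def L_def by blast
    then show ?thesis using germ_chart.vanishing_orders_eq rf(2) unfolding P_def by metis
  qed
  obtain r f where rf: "local_germ n d A p r f"
    "value_semigroup ({..n} - {r}) f = hyperelliptic_semigroup g"
    using S unfolding has_value_semigroup_def by blast
  obtain \<psi> where "germ_chart n r L f \<psi>"
    using local_germ_compose[OF AP a p u frame rf(1)] unfolding germ_chart_def L_def by blast
  then interpret germ_chart n r L f \<psi> .
  obtain T where T: "even_order_ring g T" "\<And>v. v \<in> row_span n L \<Longrightarrow> v * inverse (L r) \<in> T"
    using even_order_ring_row_span[OF rf(2)] by blast
  note TD = even_order_ringD[OF T(1)]
  have iL: "inverse (L r) \<noteq> 0" "fps_nth (inverse (L r)) 0 \<noteq> 0" using Lr0 by auto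
  have P2: "2 \<in> P" unfolding P_def by (rule order_two[OF rf(2) g])
  have P0: "0 \<in> P"
  proof -
    have "L r \<in> row_span n L" "L r \<noteq> 0" "subdegree (L r) = 0" using row_span_gen[OF r] Lr0 by auto
    then show ?thesis unfolding P_def span_orders_def by force
  qed
  have P_odd: "2 * g \<le> s" if "s \<in> P" "odd s" for s
  proof -
    obtain v where v: "v \<in> row_span n L" "v \<noteq> 0" "s = subdegree v"
      using \<open>s \<in> P\<close> unfolding P_def span_orders_def by blast
    have "subdegree (v * inverse (L r)) = s" "v * inverse (L r) \<noteq> 0" using v iL Lr0 by auto
    then show ?thesis using TD(5)[OF T(2)[OF v(1)]] that(2) by (metis not_le)
  qed
  obtain h where h: "reduced_basis d P h" "\<And>s. s \<in> P \<Longrightarrow> h s \<in> row_span n L"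
    using reduced_basis_exists[of n L d] finP high unfolding P_def by blast
  have h0: "fps_nth (h 0) 0 = 1" and h2: "fps_nth (h 2) 2 = 1" "\<And>j. j < 2 \<Longrightarrow> fps_nth (h 2) j = 0"
    using h(1) P0 P2 unfolding reduced_basis_def by blast+
  have quot: "v * inverse (h 0) \<in> T" if "v \<in> row_span n L" for v
  proof -
    have "inverse (h 0 * inverse (L r)) \<in> T"
      using TD(4)[OF T(2)[OF h(2)[OF P0]]] h0 iL by simp
    then have "v * inverse (L r) * inverse (h 0 * inverse (L r)) \<in> T" by (rule TD(3)[OF T(2)[OF that]])
    also have "v * inverse (L r) * inverse (h 0 * inverse (L r)) =
        v * inverse (h 0) * (inverse (L r) * inverse (inverse (L r)))"
      by (simp add: fps_inverse_mult mult_ac)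
    also have "\<dots> = v * inverse (h 0)" using inverse_mult_eq_1'[OF iL(2)] by simp
    finally show ?thesis .
  qed
  have x2: "subdegree (h 2 * inverse (h 0)) = 2"
  proof -
    have "subdegree (h 2) = 2" using h2 by (intro subdegreeI) auto
    moreover have "h 2 \<noteq> 0" "inverse (h 0) \<noteq> 0" "subdegree (inverse (h 0)) = 0" using h2(1) h0 by auto
    ultimately show ?thesis by simp
  qed
  have "\<forall>s\<in>P. \<exists>c. \<forall>j<2 * g. fps_nth (h s * inverse (h 0)) j =
      (\<Sum>m<g. c m * fps_nth ((h 2 * inverse (h 0)) ^ m) j)"
    using even_order_ring_expansion[OF T(1) quot[OF h(2)[OF P2]] x2 quot[OF h(2)]] by blast
  then obtain c where c: "\<And>s j. s \<in> P \<Longrightarrow> j < 2 * g \<Longrightarrow> fps_nth (h s * inverse (h 0)) j =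
      (\<Sum>m<g. c s m * fps_nth ((h 2 * inverse (h 0)) ^ m) j)"
    by metis
  have "even_expansion g P h c"
    unfolding even_expansion_def
  proof (intro ballI allI impI)
    fix s j assume s: "s \<in> P - {0, 2}" and j: "j < 2 * g"
    have "h 0 * inverse (h 0) = 1" by (rule inverse_mult_eq_1') (simp add: h0)
    moreover have "h 0 * (h s * inverse (h 0)) = h s * (h 0 * inverse (h 0))" by (rule mult.left_commute)
    ultimately have "h s = h 0 * (h s * inverse (h 0))" by simp
    then have "fps_nth (h s) j = fps_nth (h 0 * (h s * inverse (h 0))) j"
      by (rule arg_cong[where f = "\<lambda>x. fps_nth x j"])
    also have "\<dots> = fps_nth (h 0 * (\<Sum>m<g. fps_const (c s m) * (h 2 * inverse (h 0)) ^ m)) j"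
      using c s j by (intro fps_mult_nth_cong[of "2 * g"]) (auto simp: fps_sum_nth)
    also have "h 0 * (\<Sum>m<g. fps_const (c s m) * (h 2 * inverse (h 0)) ^ m) =
        (\<Sum>m<g. fps_const (c s m) * even_power h m)"
      by (simp add: sum_distrib_left even_power_def mult_ac)
    finally show "fps_nth (h s) j = (\<Sum>m<g. c s m * fps_nth (even_power h m) j)"
      by (simp add: fps_sum_nth)
  qed
  moreover have "a (i, j) = (\<Sum>l\<le>d. shift_coeff at_inf d \<tau> j l * (\<Sum>s\<in>P. fps_nth (L i) s * fps_nth (h s) l))"
    if "i \<le> n" "j \<le> d" for i j
  proof -
    have "L i = (\<Sum>s\<in>P. fps_const (fps_nth (L i) s) * h s)"
      using row_span_coordinates[OF h P_def finP row_span_gen[OF that(1)]] .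
    then have "fps_nth (L i) l = fps_nth (\<Sum>s\<in>P. fps_const (fps_nth (L i) s) * h s) l" for l
      by (rule arg_cong)
    also have "fps_nth (\<Sum>s\<in>P. fps_const (fps_nth (L i) s) * h s) l =
        (\<Sum>s\<in>P. fps_nth (L i) s * fps_nth (h s) l)" for l
      by (simp only: fps_sum_nth fps_mult_left_const_nth)
    finally have "fps_nth (L i) l = (\<Sum>s\<in>P. fps_nth (L i) s * fps_nth (h s) l)" for l .
    then show ?thesis
      unfolding a_eq[OF that(2)] by (intro sum.cong refl arg_cong2[where f = "(*)"])
  qed
  ultimately have "cusp_normal_form n d g P at_inf a \<tau> (\<lambda>i. fps_nth (L i)) h c"
    using h(1) unfolding cusp_normal_form_def by blast
  moreover have "card P = n + 1"
  proof (rule card_span_orders[OF h P_def finP])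
    fix b assume sum0: "(\<Sum>i\<le>n. fps_const (b i) * L i) = 0"
    have zero: "(\<Sum>i\<le>n. b i * fps_nth (L i) l) = 0" for l
      using arg_cong[OF sum0, of "\<lambda>x. fps_nth x l"] by (simp add: fps_sum_nth)
    show "\<forall>i\<le>n. b i = 0"
    proof (rule M_nd_rows_independent[OF A a])
      fix j assume j: "j \<le> d"
      have "(\<Sum>i\<le>n. b i * a (i, j)) = (\<Sum>i\<le>n. \<Sum>l\<le>d. shift_coeff at_inf d \<tau> j l * (b i * fps_nth (L i) l))"
        unfolding a_eq[OF j] by (simp add: sum_distrib_left mult_ac)
      also have "\<dots> = (\<Sum>l\<le>d. shift_coeff at_inf d \<tau> j l * (\<Sum>i\<le>n. b i * fps_nth (L i) l))"
        by (subst sum.swap) (simp add: sum_distrib_left)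
      also have "\<dots> = 0" using zero by simp
      finally show "(\<Sum>i\<le>n. b i * a (i, j)) = 0" .
    qed
  qed
  ultimately show ?thesis
    using vanishing a P_le P0 P2 P_odd unfolding admissible_orders_def by blast
qed

section \<open>The codimension bounds\<close>

text \<open>The points of \<open>Z\<close> are represented in the union of the sets of normal forms for all \<open>P \<in> \<P>\<close> and both
  charts, and these finitely many sets satisfy a common growth bound.\<close>

theorem krull_dim_cusps_le:
  assumes g: "g \<ge> 1" and d: "d > 0" "d + 2 \<ge> 2 * g" and Z: "Z \<subseteq> M_nd n d" "Z \<noteq> {}"
    and fin: "finite \<P>" and adm: "\<And>P. P \<in> \<P> \<Longrightarrow> admissible_orders n d g P"
    and X: "\<And>P. P \<in> \<P> \<Longrightarrow> X \<le> cusp_excess g P"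
    and nf: "\<And>A. A \<in> Z \<Longrightarrow> \<exists>P\<in>\<P>. \<exists>a\<in>A. \<exists>at_inf \<tau> G h c. cusp_normal_form n d g P at_inf a \<tau> G h c"
  shows "krull_dim (subtopology (zariski (coeff_index n d)) Z)
     \<le> ereal (real ((n + 1) * (d + 1) - 1) - X)"
proof -
  define W where "W P at_inf = {a. \<exists>\<tau> G h c. cusp_normal_form n d g P at_inf a \<tau> G h c}" for P at_inf
  define x where "x = real ((n + 1) * (d + 1) - 1) - X"
  have piece: "\<exists>D. real D \<le> x \<and> growth_le (coeff_index n d) (W P at_inf) D" if "P \<in> \<P>" for P at_inf
  proof -
    have "\<exists>D. real D \<le> real ((n + 1) * (d + 1) - 1) - cusp_excess g P \<and>
        growth_le (coeff_index n d) (W P at_inf) D"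
      unfolding W_def
      by (rule growth_le_cusp_normal_forms[OF _ _ _ _ g _ d])
        (use adm[OF that] in \<open>auto simp: admissible_orders_def\<close>)
    then obtain D where "real D \<le> real ((n + 1) * (d + 1) - 1) - cusp_excess g P"
      "growth_le (coeff_index n d) (W P at_inf) D" by blast
    then show ?thesis using X[OF that] by (intro exI[of _ D]) (simp add: x_def)
  qed
  obtain P0 where "P0 \<in> \<P>" using Z(2) nf by blast
  then have "x \<ge> 0" using piece[of P0] of_nat_0_le_iff order_trans by blast
  define D where "D = nat \<lfloor>x\<rfloor>"
  have D: "real D \<le> x" using \<open>x \<ge> 0\<close> by (simp add: D_def)
  have "growth_le (coeff_index n d) (\<Union>(P, at_inf)\<in>\<P> \<times> UNIV. W P at_inf) D"
  proof (rule growth_le_UN)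
    fix t assume "t \<in> \<P> \<times> (UNIV :: bool set)"
    then obtain P at_inf where t: "t = (P, at_inf)" "P \<in> \<P>" by auto
    then obtain D' where D': "real D' \<le> x" "growth_le (coeff_index n d) (W P at_inf) D'"
      using piece by blast
    have "D' \<le> D" using D'(1) by (simp add: D_def le_nat_floor)
    then show "growth_le (coeff_index n d) (case t of (P, at_inf) \<Rightarrow> W P at_inf) D"
      using growth_le_mono[OF D'(2)] t by simp
  qed (use fin in auto)
  then have "krull_dim (subtopology (zariski (coeff_index n d)) Z) \<le> ereal (real D)"
  proof (rule krull_dim_le_growth[rotated 3])
    show "finite (coeff_index n d)" by (simp add: coeff_index_def)
    show "Z \<subseteq> proj_space (coeff_index n d)" using Z(1) by (auto simp: M_nd_def)
    fix A assume "A \<in> Z"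
    then obtain P a at_inf \<tau> G h c where *: "P \<in> \<P>" "a \<in> A" "cusp_normal_form n d g P at_inf a \<tau> G h c"
      using nf by metis
    then have "a \<in> W P at_inf" unfolding W_def by blast
    then show "\<exists>w\<in>A. w \<in> (\<Union>(P, at_inf)\<in>\<P> \<times> UNIV. W P at_inf)" using * by blast
  qed
  also have "\<dots> \<le> ereal x" using D by simp
  finally show ?thesis unfolding x_def .
qed

text \<open>The term \<open>max 0 (g - k i / 2)\<close> is estimated by its second argument, and exactly \<open>i\<close> vanishing orders are
  smaller than \<open>k i\<close>.\<close>

lemma cusp_excess_vanishing_sequence:
  assumes adm: "admissible_orders n d g (k ` {..n})" and mono: "strict_mono_on {..n} k" and g: "g \<ge> 1"
  shows "(real n - 1) * real g + (\<Sum>i=2..n. real (k i) / 2 - real i) \<le> cusp_excess g (k ` {..n})"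
proof -
  let ?P = "k ` {..n}"
  have less: "k i < k j \<longleftrightarrow> i < j" if "i \<le> n" "j \<le> n" for i j
    using mono that by (auto simp: strict_mono_on_def) (metis atMost_iff linorder_neqE_nat not_less_iff_gr_or_eq)
  have inj: "inj_on k {..n}" using mono by (rule strict_mono_on_imp_inj_on)
  have P0: "0 \<in> ?P" and P2: "2 \<in> ?P" and odd: "\<And>r. r \<in> ?P \<Longrightarrow> odd r \<Longrightarrow> 2 * g \<le> r"
    using adm by (auto simp: admissible_orders_def)
  have P1: "1 \<notin> ?P" using odd[of 1] g by auto
  obtain i0 where i0: "i0 \<le> n" "k i0 = 0" using P0 by auto
  have k0: "k 0 = 0" using less[of 0 i0] i0 by (cases "i0 = 0") auto
  obtain i2 where i2: "i2 \<le> n" "k i2 = 2" using P2 by auto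
  have "i2 \<ge> 1" using i2 k0 by (cases i2) auto
  then have n: "n \<ge> 1" using i2 by simp
  have "k 1 > 0" using less[of 0 1] n k0 by simp
  moreover have "k 1 \<noteq> 1" using P1 n by (metis atMost_iff imageI)
  moreover have "k 1 \<le> 2" using less[of 1 i2] i2 \<open>i2 \<ge> 1\<close> n by (cases "i2 = 1") auto
  ultimately have k1: "k 1 = 2" by linarith
  have "?P - {0, 2} = k ` {2..n}"
  proof -
    have "{..n} = {0, 1} \<union> {2..n}" using n by auto
    then have P: "?P = {0, 2} \<union> k ` {2..n}" using k0 k1 by (simp add: image_Un)
    have "k i \<noteq> 0 \<and> k i \<noteq> 2" if "i \<in> {2..n}" for i
      using less[of 1 i] that n k1 by auto
    then have "0 \<notin> k ` {2..n}" "2 \<notin> k ` {2..n}" by (metis imageE)+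
    then show ?thesis unfolding P by blast
  qed
  then have "cusp_excess g ?P = (\<Sum>i=2..n. real (k i) - real (card {s \<in> ?P. s < k i}) + max 0 (real g - real (k i) / 2))"
    unfolding cusp_excess_def using inj by (subst sum.reindex[symmetric, unfolded o_def]) (auto intro: inj_on_subset)
  moreover have "card {s \<in> ?P. s < k i} = i" if "i \<in> {2..n}" for i
  proof -
    have "{s \<in> ?P. s < k i} = k ` {..<i}" using less that by auto
    moreover have "inj_on k {..<i}" using inj that by (auto intro: inj_on_subset)
    ultimately show ?thesis by (simp add: card_image)
  qed
  ultimately have "cusp_excess g ?P = (\<Sum>i=2..n. real (k i) - real i + max 0 (real g - real (k i) / 2))"
    by simp
  also have "\<dots> \<ge> (\<Sum>i=2..n. real g + (real (k i) / 2 - real i))"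
    by (intro sum_mono) (simp add: max_def)
  also have "(\<Sum>i=2..n. real g + (real (k i) / 2 - real i)) =
      (real n - 1) * real g + (\<Sum>i=2..n. real (k i) / 2 - real i)"
    using n by (simp add: sum.distrib of_nat_diff)
  finally show ?thesis by simp
qed

text \<open>Below \<open>2 * g\<close> only even numbers are admissible. So an order \<open>r < 2 * g\<close> exceeds at most \<open>r / 2\<close> others,
  and an order \<open>r \<ge> 2 * g\<close> at most \<open>r - g\<close> others.\<close>

lemma cusp_excess_ge:
  assumes adm: "admissible_orders n d g P"
  shows "(real n - 1) * real g \<le> cusp_excess g P"
proof -
  have P: "P \<subseteq> {..d}" "card P = n + 1" "0 \<in> P" "2 \<in> P" and odd: "\<And>r. r \<in> P \<Longrightarrow> odd r \<Longrightarrow> 2 * g \<le> r"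
    using adm by (auto simp: admissible_orders_def)
  have finP: "finite P" using P(1) finite_subset by blast
  have "card (P - {0, 2}) = n - 1" using P(2-4) finP by (simp add: card_Diff_subset)
  moreover have "n \<ge> 1"
  proof -
    have "card {0, 2::nat} \<le> card P" using P finP by (intro card_mono) auto
    then show ?thesis using P(2) by simp
  qed
  ultimately have n: "real (card (P - {0, 2})) = real n - 1" by simp
  have "real g \<le> real r - real (card {s \<in> P. s < r}) + max 0 (real g - real r / 2)" if r: "r \<in> P" for r
  proof (cases "r < 2 * g")
    case True
    then have "even r" using odd[OF r] by (meson not_le)
    then obtain m where m: "r = 2 * m" by (rule evenE)
    have "{s \<in> P. s < r} \<subseteq> (\<lambda>i. 2 * i) ` {..<m}"
    proof
      fix s assume s: "s \<in> {s \<in> P. s < r}"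
      then have "even s" using odd[of s] True by (cases "even s") auto
      then obtain i where "s = 2 * i" by (rule evenE)
      then show "s \<in> (\<lambda>i. 2 * i) ` {..<m}" using s m by auto
    qed
    then have "card {s \<in> P. s < r} \<le> card ((\<lambda>i. 2 * i) ` {..<m})" by (intro card_mono) auto
    also have "\<dots> \<le> m" using card_image_le[of "{..<m}" "\<lambda>i. 2 * i"] by simp
    finally show ?thesis using m True by simp
  next
    case False
    have "{s \<in> P. s < r} \<subseteq> (\<lambda>i. 2 * i) ` {..<g} \<union> {2 * g..<r}"
    proof
      fix s assume s: "s \<in> {s \<in> P. s < r}"
      show "s \<in> (\<lambda>i. 2 * i) ` {..<g} \<union> {2 * g..<r}"
      proof (cases "s < 2 * g")
        case True
        then have "even s" using odd[of s] s by (cases "even s") auto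
        then obtain i where "s = 2 * i" by (rule evenE)
        then show ?thesis using True by auto
      qed (use s in auto)
    qed
    then have "card {s \<in> P. s < r} \<le> card ((\<lambda>i. 2 * i) ` {..<g} \<union> {2 * g..<r})" by (intro card_mono) auto
    also have "\<dots> \<le> card ((\<lambda>i. 2 * i) ` {..<g}) + card {2 * g..<r}" by (rule card_Un_le)
    also have "\<dots> \<le> g + (r - 2 * g)" using card_image_le[of "{..<g}" "\<lambda>i. 2 * i"] by simp
    finally show ?thesis using False by simp
  qed
  then have "(\<Sum>r\<in>P - {0, 2}. real g) \<le> cusp_excess g P"
    unfolding cusp_excess_def by (intro sum_mono) auto
  then show ?thesis using n by simp
qed

theorem theorem2p1:
  fixes n d g :: nat and k :: "nat \<Rightarrow> nat"
  assumes "d > 0" and "g > 0"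
    and "n \<le> 2 * g" and "d \<ge> max n (2 * g - 2)"
    and "M_ndgSk n d g (hyperelliptic_semigroup g) k \<noteq> {}"
  shows "codim (coeff_index n d) (M_ndgSk n d g (hyperelliptic_semigroup g) k) (M_nd n d)
           \<ge> ereal ((real n - 1) * real g + (\<Sum>i=2..n. real (k i) / 2 - real i))
       \<and> codim (coeff_index n d) (M_ndgS n d g (hyperelliptic_semigroup g)) (M_nd n d)
           \<ge> ereal ((real n - 1) * real g)"
proof -
  let ?S = "hyperelliptic_semigroup g"
  let ?Zk = "M_ndgSk n d g ?S k" and ?Z = "M_ndgS n d g ?S"
  let ?N = "real ((n + 1) * (d + 1) - 1)"
  have g: "g \<ge> 1" and d: "d + 2 \<ge> 2 * g" and nd: "d \<ge> n" using assms by auto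
  have sub: "?Zk \<subseteq> M_nd n d" "?Z \<subseteq> M_nd n d" "?Zk \<subseteq> ?Z"
    by (auto simp: M_ndgSk_def M_ndgS_def M_ndg_def)
  have nfk: "admissible_orders n d g (k ` {..n}) \<and> strict_mono_on {..n} k \<and>
      (\<exists>a\<in>A. \<exists>at_inf \<tau> G h c. cusp_normal_form n d g (k ` {..n}) at_inf a \<tau> G h c)"
    if A: "A \<in> ?Zk" for A
  proof -
    obtain p where p: "p \<in> P1" "has_value_semigroup n d A p ?S" "has_vanishing_sequence n d A p k"
      using A unfolding M_ndgSk_def unique_cusp_at_def by blast
    moreover have "A \<in> M_nd n d" using A sub by blast
    ultimately show ?thesis using cusp_normal_form_exists[of A n d p g] g
      unfolding has_vanishing_sequence_def by blast
  qed
  have nf: "\<exists>P\<in>{P. admissible_orders n d g P}. \<exists>a\<in>A. \<exists>at_inf \<tau> G h c. cusp_normal_form n d g P at_inf a \<tau> G h c"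
    if A: "A \<in> ?Z" for A
  proof -
    obtain p where "p \<in> P1" "has_value_semigroup n d A p ?S"
      using A unfolding M_ndgS_def unique_cusp_at_def by blast
    moreover have "A \<in> M_nd n d" using A sub by blast
    ultimately show ?thesis using cusp_normal_form_exists[of A n d p g] g by blast
  qed
  obtain A0 where A0: "A0 \<in> ?Zk" using assms(5) by blast
  have adm: "admissible_orders n d g (k ` {..n})" and mono: "strict_mono_on {..n} k"
    using nfk[OF A0] by auto
  have n: "n \<ge> 1"
  proof (rule ccontr)
    assume "\<not> n \<ge> 1"
    then have "n = 0" by simp
    then have "k ` {..n} = {k 0}" by simp
    then show False using adm by (auto simp: admissible_orders_def)
  qed
  have M: "ereal ?N \<le> krull_dim (subtopology (zariski (coeff_index n d)) (M_nd n d))"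
    by (rule krull_dim_M_nd_ge[OF n nd])
  have codim: "ereal X \<le> codim (coeff_index n d) Z (M_nd n d)"
    if "krull_dim (subtopology (zariski (coeff_index n d)) Z) \<le> ereal (?N - X)" for X Z
  proof -
    have "ereal ?N - ereal (?N - X) \<le> codim (coeff_index n d) Z (M_nd n d)"
      unfolding codim_def by (rule ereal_minus_mono[OF M that])
    then show ?thesis by simp
  qed
  have fin: "finite {P. admissible_orders n d g P}"
    by (rule finite_subset[of _ "Pow {..d}"]) (auto simp: admissible_orders_def)
  show ?thesis
  proof (intro conjI codim)
    show "krull_dim (subtopology (zariski (coeff_index n d)) ?Zk) \<le>
        ereal (?N - ((real n - 1) * real g + (\<Sum>i=2..n. real (k i) / 2 - real i)))"
      using nfk adm cusp_excess_vanishing_sequence[OF adm mono g]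
      by (intro krull_dim_cusps_le[OF g assms(1) d sub(1) assms(5), of "{k ` {..n}}"]) auto
    show "krull_dim (subtopology (zariski (coeff_index n d)) ?Z) \<le> ereal (?N - (real n - 1) * real g)"
      using nf cusp_excess_ge sub assms(5)
      by (intro krull_dim_cusps_le[OF g assms(1) d sub(2) _ fin]) auto
  qed
qed

end
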